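(* Let $0\le\vartheta\le1$, $0\le n,j<+\infty$, $0\le\vartheta n-j\le\frac d2$, with $\vartheta\ne1$ if $n=j+\frac d2$; let $r\in[2,+\infty]$ be defined by $\frac1r=\frac12-\frac{\vartheta n-j}d$. Let $G(j,n,\vartheta)$ be the sharp constant of the Gagliardo-Nirenberg inequality $$H^n\subset\mathcal L^{2,r,j},\qquad\|D^jf\|_{\mathcal L^r}\le G\,\|f\|^{1-\vartheta}_{\mathcal L^2}\|D^nf\|^\vartheta_{\mathcal L^2}\quad\text{for some } G\in[0,+\infty)\text{ and all } f\in H^n.$$ Then $$G(j,n,\vartheta)\ge G_-(j,n,\vartheta\,|\,\varepsilon)\quad\text{for all }\varepsilon\in(0,+\infty),$$ which implies $G(j,n,\vartheta)\ge G_-(j,n,\vartheta):=\sup_{\varepsilon\in(0,+\infty)}G_-(j,n,\vartheta\,|\,\varepsilon)$. Here $$G_-(j,n,\vartheta\,|\,\varepsilon):=\frac{Y(j,n,\vartheta\,|\,\varepsilon)}{U(j,n\,|\,\varepsilon)^{1-\vartheta}\,V(j,n\,|\,\varepsilon)^\vartheta},$$ $$U(j,n\,|\,\varepsilon):=\left(\frac{2\pi^{d/2}}{\Gamma(d/2)}\int_0^{+\infty}d\xi\,\frac{\xi^{2n-2j+d-1}K^2_{n-j}(\xi)}{(\xi^2+\varepsilon^2)^{2n-j}}\right)^{1/2},\quad V(j,n\,|\,\varepsilon):=\left(\frac{2\pi^{d/2}}{\Gamma(d/2)}\int_0^{+\infty}d\xi\,\frac{\xi^{4n-2j+d-1}K^2_{n-j}(\xi)}{(\xi^2+\varepsilon^2)^{2n-j}}\right)^{1/2},$$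 $$Y(j,n,\vartheta\,|\,\varepsilon):=\left(\frac{2\pi^{d/2}}{\Gamma(d/2)}\int_0^{+\infty}d\rho\,\rho^{d-1}|M_{jn\varepsilon}(\rho)|^r\right)^{1/r}$$ (to be read as $\sup_{\rho\ge0}|M_{jn\varepsilon}(\rho)|$ if $r=+\infty$), where $M_{jn\varepsilon}\in C([0,+\infty),\mathbb R)$ is defined by $$M_{jn\varepsilon}(\rho):=\int_0^{+\infty}d\xi\,\frac{J_{d/2-1}(\rho\xi)}{(\rho\xi)^{d/2-1}}\,\frac{\xi^{n+d-1}K_{n-j}(\xi)}{(\xi^2+\varepsilon^2)^{n-j/2}}.$$
   Context: Fix $d\in\{1,2,3,\dots\}$; functions are complex-valued on $\mathbb R^d$. $\mathcal S$ is the Schwartz space; the Fourier transform is $\mathcal F\varphi(k)=(2\pi)^{-d/2}\int_{\mathbb R^d}e^{-ik\cdot x}\varphi(x)\,dx$. $\Phi:=\{\phi\in\mathcal S:\int x_{i_1}\cdots x_{i_m}\phi(x)dx=0 \text{ for all } m\ge 0, i_1,\dots,i_m\}$ and $\Psi:=\{\psi\in\mathcal S: \partial_{i_1\cdots i_m}\psi(0)=0\text{ for all } m\ge0,i_1,\dots,i_m\}$ are closed subspaces of $\mathcal S$ with $\mathcal F\Phi=\Psi$; $\Phi',\Psi'$ are their topological duals. $\mathcal F:\Phi'\to\Psi'$ is the bijection $\langle\mathcal Ff,\psi\rangle:=\langle f,\mathcal F^{-1}\psi_R\rangle$, $\psi_R(k)=\psi(-k)$. For $s\in\mathbb R$ and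 $g\in\Psi'$, $|k|^sg\in\Psi'$ is $\langle|k|^sg,\psi\rangle:=\langle g,|k|^s\psi\rangle$, and $D^s:\Phi'\to\Phi'$ is the bijection $D^sf:=\mathcal F^{-1}(|k|^s\mathcal Ff)$ (so $D=\sqrt{-\Delta}$). $\mathcal L^p:=L^p(\mathbb R^d,\mathbb C)$ for $p\in[1,+\infty)$, while $\mathcal L^\infty:=C_0(\mathbb R^d,\mathbb C)$ (continuous functions vanishing at infinity, sup norm). A function $f\in\mathcal L^p$ is identified with the element $\phi\mapsto\int f\phi$ of $\Phi'$ (this map is injective). $H^n:=\{f\in\mathcal L^2:D^nf\in\mathcal L^2\}$, $\mathcal L^{2,r,j}:=\{f\in\mathcal L^2:D^jf\in\mathcal L^r\}$. Convention: $0^0:=1$. The sharp constant of an inequality is the smallest constant for which it holds; under the stated conditions on $j,n,\vartheta$ the Gagliardo-Nirenberg inequality above is known to hold. $J_\nu$ is the Bessel function of the first kind, $K_\mu$ the modified Bessel function of the second kind (Macdonald function). At $\rho=0$, $J_{d/2-1}(\rho\xi)/(\rho\xi)^{d/2-1}$ is understood as $\lim_{s\to0^+}J_{d/2-1}(s)/s^{d/2-1}=1/(2^{d/2-1}\Gamma(d/2))$. *)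

theory Defs
  imports "HOL-Analysis.Analysis"
begin

text \<open>Real powers with \<open>0^0 = 1\<close>; the library has \<open>0 powr 0 = 0\<close>.\<close>

definition rpow :: "real \<Rightarrow> real \<Rightarrow> real" where
  "rpow x a = (if a = 0 then 1 else x powr a)"

definition partial :: "'d::finite \<Rightarrow> (real^'d \<Rightarrow> complex) \<Rightarrow> real^'d \<Rightarrow> complex" where
  "partial i f x = vector_derivative (\<lambda>t. f (x + t *\<^sub>R axis i 1)) (at 0)"

text \<open>Index lists \<open>[i1, ..., im]\<close> (of any length, possibly empty) encode iterated partial
  derivatives and monomials.\<close>

definition partials :: "'d::finite list \<Rightarrow> (real^'d \<Rightarrow> complex) \<Rightarrow> real^'d \<Rightarrow> complex" where
  "partials js f = foldr partial js f"

definition monomial :: "'d::finite list \<Rightarrow> real^'d \<Rightarrow> real" where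
  "monomial ms x = (\<Prod>i\<leftarrow>ms. x $ i)"

definition smooth :: "(real^'d::finite \<Rightarrow> complex) \<Rightarrow> bool" where
  "smooth f \<longleftrightarrow> (\<forall>js x. partials js f differentiable (at x))"

definition schwartz :: "(real^'d::finite \<Rightarrow> complex) set" where
  "schwartz = {f. smooth f \<and> (\<forall>ms js. bounded (range (\<lambda>x. monomial ms x *\<^sub>R partials js f x)))}"

definition schwartz_seminorm ::
    "'d::finite list \<Rightarrow> 'd list \<Rightarrow> (real^'d \<Rightarrow> complex) \<Rightarrow> real" where
  "schwartz_seminorm ms js f = (SUP x. norm (monomial ms x *\<^sub>R partials js f x))"

definition schwartz_topology :: "(real^'d::finite \<Rightarrow> complex) topology" where
  "schwartz_topology = topology_generated_by
     {{g \<in> schwartz. schwartz_seminorm ms js (\<lambda>x. g x - f x) < e} | ms js f e.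
        f \<in> schwartz \<and> e > 0}"

definition Phi_space :: "(real^'d::finite \<Rightarrow> complex) set" where
  "Phi_space = {\<phi> \<in> schwartz. \<forall>ms. (\<integral>x. monomial ms x *\<^sub>R \<phi> x \<partial>lebesgue) = 0}"

definition Psi_space :: "(real^'d::finite \<Rightarrow> complex) set" where
  "Psi_space = {\<psi> \<in> schwartz. \<forall>js. partials js \<psi> 0 = 0}"

text \<open>The topological dual of a linear subspace of the Schwartz space. Functionals are
  total HOL functions, made unique by requiring them to be \<^const>\<open>undefined\<close> outside
  the subspace.\<close>

definition dual_space ::
    "(real^'d::finite \<Rightarrow> complex) set \<Rightarrow> ((real^'d \<Rightarrow> complex) \<Rightarrow> complex) set" where
  "dual_space S = {u \<in> extensional S.
     (\<forall>\<phi>\<in>S. \<forall>\<psi>\<in>S. \<forall>a b. u (\<lambda>x. a * \<phi> x + b * \<psi> x) = a * u \<phi> + b * u \<psi>) \<and>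
     continuous_map (subtopology schwartz_topology S) euclidean u}"

definition fourier :: "(real^'d::finite \<Rightarrow> complex) \<Rightarrow> real^'d \<Rightarrow> complex" where
  "fourier \<phi> k = complex_of_real ((2 * pi) powr (- real CARD('d) / 2)) *
     (\<integral>x. exp (- (\<i> * complex_of_real (k \<bullet> x))) * \<phi> x \<partial>lebesgue)"

definition inv_fourier :: "(real^'d::finite \<Rightarrow> complex) \<Rightarrow> real^'d \<Rightarrow> complex" where
  "inv_fourier = inv_into schwartz fourier"

definition fourier_dual ::
    "((real^'d::finite \<Rightarrow> complex) \<Rightarrow> complex) \<Rightarrow> (real^'d \<Rightarrow> complex) \<Rightarrow> complex" where
  "fourier_dual u = (\<lambda>\<psi>\<in>Psi_space. u (inv_fourier (\<lambda>k. \<psi> (- k))))"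

definition inv_fourier_dual ::
    "((real^'d::finite \<Rightarrow> complex) \<Rightarrow> complex) \<Rightarrow> (real^'d \<Rightarrow> complex) \<Rightarrow> complex" where
  "inv_fourier_dual = inv_into (dual_space Phi_space) fourier_dual"

text \<open>At \<open>k = 0\<close> the product \<open>|k|^s \<psi>(k)\<close> is \<open>0\<close>, its continuous extension for \<open>\<psi>\<close> in
  \<open>\<Psi>\<close>, also when \<open>s < 0\<close>.\<close>

definition mult_norm_pow ::
    "real \<Rightarrow> ((real^'d::finite \<Rightarrow> complex) \<Rightarrow> complex) \<Rightarrow> (real^'d \<Rightarrow> complex) \<Rightarrow> complex" where
  "mult_norm_pow s g = (\<lambda>\<psi>\<in>Psi_space. g (\<lambda>k. complex_of_real (rpow (norm k) s) * \<psi> k))"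

definition D_pow ::
    "real \<Rightarrow> ((real^'d::finite \<Rightarrow> complex) \<Rightarrow> complex) \<Rightarrow> (real^'d \<Rightarrow> complex) \<Rightarrow> complex" where
  "D_pow s u = inv_fourier_dual (mult_norm_pow s (fourier_dual u))"

text \<open>Elements are represented by functions, so for \<open>p < \<infinity>\<close> they matter only up to null sets.
  For \<open>p = \<infinity>\<close> the space is \<open>C_0\<close>.\<close>

definition L_space :: "ereal \<Rightarrow> (real^'d::finite \<Rightarrow> complex) set" where
  "L_space p = (if p = \<infinity>
     then {f. continuous_on UNIV f \<and> (f \<longlongrightarrow> 0) at_infinity}
     else {f \<in> borel_measurable lebesgue.
             integrable lebesgue (\<lambda>x. norm (f x) powr real_of_ereal p)})"

definition L_norm :: "ereal \<Rightarrow> (real^'d::finite \<Rightarrow> complex) \<Rightarrow> real" where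
  "L_norm p f = (if p = \<infinity>
     then (SUP x. norm (f x))
     else (\<integral>x. norm (f x) powr real_of_ereal p \<partial>lebesgue) powr (1 / real_of_ereal p))"

definition to_dual ::
    "(real^'d::finite \<Rightarrow> complex) \<Rightarrow> (real^'d \<Rightarrow> complex) \<Rightarrow> complex" where
  "to_dual f = (\<lambda>\<phi>\<in>Phi_space. \<integral>x. f x * \<phi> x \<partial>lebesgue)"

definition H_space :: "real \<Rightarrow> (real^'d::finite \<Rightarrow> complex) set" where
  "H_space n = {f \<in> L_space 2. D_pow n (to_dual f) \<in> to_dual ` L_space 2}"

definition L2_space :: "ereal \<Rightarrow> real \<Rightarrow> (real^'d::finite \<Rightarrow> complex) set" where
  "L2_space r j = {f \<in> L_space 2. D_pow j (to_dual f) \<in> to_dual ` L_space r}"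

text \<open>Below, \<open>g\<close> and \<open>h\<close> are the functions identified with \<open>D^n f\<close> and \<open>D^j f\<close>. They are
  unique up to null sets, so quantifying over all of them just evaluates the norms of
  \<open>D^n f\<close> and \<open>D^j f\<close>. The first argument only fixes the dimension \<open>d = CARD('d)\<close>.\<close>

definition GN_constants ::
    "'d::finite itself \<Rightarrow> ereal \<Rightarrow> real \<Rightarrow> real \<Rightarrow> real \<Rightarrow> real set" where
  "GN_constants _ r j n \<theta> = {G. 0 \<le> G \<and>
     (H_space n :: (real^'d \<Rightarrow> complex) set) \<subseteq> L2_space r j \<and>
     (\<forall>f \<in> (H_space n :: (real^'d \<Rightarrow> complex) set). \<forall>g \<in> L_space 2. \<forall>h \<in> L_space r.
        to_dual g = D_pow n (to_dual f) \<longrightarrow> to_dual h = D_pow j (to_dual f) \<longrightarrow>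
        L_norm r h \<le> G * rpow (L_norm 2 f) (1 - \<theta>) * rpow (L_norm 2 g) \<theta>)}"

definition GN_sharp_constant ::
    "'d::finite itself \<Rightarrow> ereal \<Rightarrow> real \<Rightarrow> real \<Rightarrow> real \<Rightarrow> real \<Rightarrow> bool" where
  "GN_sharp_constant d r j n \<theta> G \<longleftrightarrow>
     G \<in> GN_constants d r j n \<theta> \<and> (\<forall>G' \<in> GN_constants d r j n \<theta>. G \<le> G')"

text \<open>For real order and positive argument. \<open>rGamma = 1 / Gamma\<close> is entire, so negative integer
  orders are covered as well.\<close>

definition bessel_J :: "real \<Rightarrow> real \<Rightarrow> real" where
  "bessel_J \<nu> s =
     (\<Sum>m. (-1) ^ m / fact m * rGamma (real m + \<nu> + 1) * (s / 2) powr (2 * real m + \<nu>))"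

text \<open>\<open>J_\<nu>(s) / s^\<nu>\<close>, with its limit \<open>1 / (2^\<nu> \<Gamma>(\<nu> + 1))\<close> at \<open>s = 0\<close>; only \<open>\<nu> = d/2 - 1\<close> is
  used.\<close>

definition bessel_J_quot :: "real \<Rightarrow> real \<Rightarrow> real" where
  "bessel_J_quot \<nu> s =
     (if s = 0 then 1 / (2 powr \<nu> * Gamma (\<nu> + 1)) else bessel_J \<nu> s / s powr \<nu>)"

text \<open>The integral representation \<open>K_\<mu>(x) = \<integral>\<^sub>0\<^sup>\<infinity> exp (- x cosh t) cosh (\<mu> t) dt\<close>, valid for all
  real \<open>\<mu>\<close> (integers included) and \<open>x > 0\<close>.\<close>

definition bessel_K :: "real \<Rightarrow> real \<Rightarrow> real" where
  "bessel_K \<mu> x = (LBINT t:{0<..}. exp (- x * cosh t) * cosh (\<mu> * t))"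

text \<open>Throughout, \<open>d\<close> is the space dimension and \<open>r\<close> the exponent with
  \<open>1/r = 1/2 - (\<theta>n - j)/d\<close>.\<close>

definition sphere_area :: "nat \<Rightarrow> real" where
  "sphere_area d = 2 * pi powr (real d / 2) / Gamma (real d / 2)"

definition GN_U :: "nat \<Rightarrow> real \<Rightarrow> real \<Rightarrow> real \<Rightarrow> real" where
  "GN_U d j n \<epsilon> = sqrt (sphere_area d *
     (LBINT \<xi>:{0<..}. \<xi> powr (2 * n - 2 * j + real d - 1) * (bessel_K (n - j) \<xi>)\<^sup>2
                        / (\<xi>\<^sup>2 + \<epsilon>\<^sup>2) powr (2 * n - j)))"

definition GN_V :: "nat \<Rightarrow> real \<Rightarrow> real \<Rightarrow> real \<Rightarrow> real" where
  "GN_V d j n \<epsilon> = sqrt (sphere_area d *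
     (LBINT \<xi>:{0<..}. \<xi> powr (4 * n - 2 * j + real d - 1) * (bessel_K (n - j) \<xi>)\<^sup>2
                        / (\<xi>\<^sup>2 + \<epsilon>\<^sup>2) powr (2 * n - j)))"

definition GN_M_integrand :: "nat \<Rightarrow> real \<Rightarrow> real \<Rightarrow> real \<Rightarrow> real \<Rightarrow> real \<Rightarrow> real" where
  "GN_M_integrand d j n \<epsilon> \<rho> \<xi> = bessel_J_quot (real d / 2 - 1) (\<rho> * \<xi>) *
     (\<xi> powr (n + real d - 1) * bessel_K (n - j) \<xi> / (\<xi>\<^sup>2 + \<epsilon>\<^sup>2) powr (n - j / 2))"

definition GN_M :: "nat \<Rightarrow> real \<Rightarrow> real \<Rightarrow> real \<Rightarrow> real \<Rightarrow> real" where
  "GN_M d j n \<epsilon> \<rho> = (LBINT \<xi>:{0<..}. GN_M_integrand d j n \<epsilon> \<rho> \<xi>)"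

definition GN_Y :: "nat \<Rightarrow> ereal \<Rightarrow> real \<Rightarrow> real \<Rightarrow> real \<Rightarrow> real" where
  "GN_Y d r j n \<epsilon> = (if r = \<infinity>
     then (SUP \<rho>\<in>{0..}. \<bar>GN_M d j n \<epsilon> \<rho>\<bar>)
     else (sphere_area d *
            (LBINT \<rho>:{0<..}. \<rho> ^ (d - 1) * \<bar>GN_M d j n \<epsilon> \<rho>\<bar> powr real_of_ereal r))
          powr (1 / real_of_ereal r))"

definition GN_lower_eps ::
    "nat \<Rightarrow> ereal \<Rightarrow> real \<Rightarrow> real \<Rightarrow> real \<Rightarrow> real \<Rightarrow> real" where
  "GN_lower_eps d r j n \<theta> \<epsilon> =
     GN_Y d r j n \<epsilon> / (rpow (GN_U d j n \<epsilon>) (1 - \<theta>) * rpow (GN_V d j n \<epsilon>) \<theta>)"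

definition GN_lower :: "nat \<Rightarrow> ereal \<Rightarrow> real \<Rightarrow> real \<Rightarrow> real \<Rightarrow> real" where
  "GN_lower d r j n \<theta> = (SUP \<epsilon>\<in>{0<..}. GN_lower_eps d r j n \<theta> \<epsilon>)"

end

theory Submission
  imports Defs "HOL-Probability.Levy"
begin

text \<open>A Gagliardo-Nirenberg constant bounds the quotient of \<open>\<parallel>D^j f\<parallel>\<close> in \<open>L^r\<close> by
  \<open>\<parallel>f\<parallel>^(1-\<theta>) \<parallel>D^n f\<parallel>^\<theta>\<close> in \<open>L^2\<close> for every admissible \<open>f\<close>, so every trial function gives a
  lower bound for the sharp constant. The trial function is the one whose Fourier transform is the
  radial function \<open>|k|^(n-j) K_(n-j)(|k|) / (|k|^2 + \<epsilon>^2)^(n-j/2)\<close>; it is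
  even, so that the trial function is again its Fourier transform. The Fourier transforms of \<open>D^n f\<close> and
  \<open>D^j f\<close> are this function times \<open>|k|^n\<close> and times \<open>|k|^j\<close>. In polar coordinates the \<open>L^2\<close> norms of
  the first two transforms are \<open>U\<close> and \<open>V\<close>, while \<open>D^j f\<close> itself is the radial function \<open>M(|x|)\<close>,
  whose \<open>L^r\<close> norm is \<open>Y\<close>. The norms of \<open>f\<close> and \<open>D^n f\<close> stand in the denominator, so
  \<open>\<parallel>f\<parallel> \<le> U\<close> and \<open>\<parallel>D^n f\<parallel> \<le> V\<close> give the quotient \<open>Y / (U^(1-\<theta>) V^\<theta>)\<close> as a lower bound.

  Three groups of facts carry this out. First, \<open>fourier_radial\<close> writes the Fourier transform of a
  radial function as a Hankel transform. It comes from the identity \<open>radial_cos_integral\<close>, which is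
  proved by expanding the cosine: each term \<open>(x \<bullet> k)^(2m)\<close> is homogeneous in \<open>k\<close>, so that its
  integral against a radial weight is a one-dimensional integral, and a comparison with Gaussian
  integrals shows that the constants are the coefficients of the Bessel series. The same identity,
  applied to thin shells, bounds the Bessel quotient by its value at zero, and this makes \<open>M\<close> well
  defined and continuous.

  Second, \<open>D_pow_fourier\<close> identifies \<open>D^s\<close> of the Fourier transform of an integrable function. The
  definition by duality requires that the Fourier transform exchanges the test spaces \<open>\<Phi>\<close> and \<open>\<Psi>\<close>
  and is inverted by its reflection, that \<open>|k|^s\<close> multiplies \<open>\<Psi>\<close> into itself, and that bounded
  functions are continuous functionals on \<open>\<Phi>\<close>. The pairing with a test function is then computed
  by moving the Fourier transform from one factor to the other.

  Third, the trial function has to lie in the right spaces. Its transform is bounded by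
  \<open>|k|^(-1/4) exp(-|k|/2)\<close> up to a constant, which is both integrable and square integrable in
  every dimension; \<open>fourier_L2_le\<close> controls the \<open>L^2\<close> norms, boundedness and
  square integrability give finite exponents \<open>r \<ge> 2\<close>, and the Riemann-Lebesgue lemma gives
  \<open>r = \<infinity>\<close>.\<close>

section \<open>Gaussian integrals on Euclidean space\<close>

lemma integral_lborel_prod:
  fixes f :: "'a::euclidean_space \<Rightarrow> real \<Rightarrow> complex"
  assumes "\<And>b. b \<in> Basis \<Longrightarrow> integrable lborel (f b)"
  shows "integrable lborel (\<lambda>x::'a. \<Prod>b\<in>Basis. f b (x \<bullet> b))"
    and "(LBINT x::'a. \<Prod>b\<in>Basis. f b (x \<bullet> b)) = (\<Prod>b\<in>Basis. LBINT t. f b t)"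
proof -
  interpret product_sigma_finite "\<lambda>_::'a. lborel :: real measure"
    by standard
  have [measurable]: "f b \<in> borel_measurable borel" if "b \<in> Basis" for b
    using borel_measurable_integrable[OF assms[OF that]] by simp
  have [measurable]: "(\<lambda>x::'a. \<Prod>b\<in>Basis. f b (x \<bullet> b)) \<in> borel_measurable borel"
    by measurable
  have *: "(\<Prod>b\<in>Basis. f b ((\<Sum>c\<in>Basis. y c *\<^sub>R c) \<bullet> b)) = (\<Prod>b\<in>Basis. f b (y b))" for y
    by (intro prod.cong refl) simp
  have int: "integrable (\<Pi>\<^sub>M b\<in>Basis. lborel) (\<lambda>y. \<Prod>b\<in>Basis. f b (y b))"
    using assms by (intro product_integrable_prod) auto
  show "integrable lborel (\<lambda>x::'a. \<Prod>b\<in>Basis. f b (x \<bullet> b))"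
    by (subst lborel_eq, subst integrable_distr_eq) (auto simp: * int)
  show "(LBINT x::'a. \<Prod>b\<in>Basis. f b (x \<bullet> b)) = (\<Prod>b\<in>Basis. LBINT t. f b t)"
    by (subst lborel_eq, subst integral_distr)
      (use assms in \<open>auto simp: * intro!: product_integral_prod\<close>)
qed

definition gauss :: "'a::euclidean_space \<Rightarrow> real" where
  "gauss y = exp (- (norm y)\<^sup>2 / 2) / (2 * pi) powr (DIM('a) / 2)"

lemma gauss_pos: "gauss y > 0"
  by (simp add: gauss_def)

lemma gauss_measurable[measurable]: "gauss \<in> borel_measurable borel"
  unfolding gauss_def[abs_def] by measurable

lemma gauss_eq_prod: "gauss (y::'a::euclidean_space) = (\<Prod>b\<in>Basis. std_normal_density (y \<bullet> b))"
proof -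
  have "(\<Sum>b\<in>Basis. (y \<bullet> b)\<^sup>2) = (norm y)\<^sup>2"
    unfolding power2_norm_eq_inner by (subst euclidean_inner) (simp add: power2_eq_square)
  hence "(\<Prod>b\<in>Basis. exp (- (y \<bullet> b)\<^sup>2 / 2)) = exp (- (norm y)\<^sup>2 / 2)"
    by (simp add: exp_sum[symmetric] sum_negf sum_divide_distrib[symmetric])
  moreover have "sqrt (2 * pi) ^ DIM('a) = (2 * pi) powr (DIM('a) / 2)"
    by (simp add: powr_half_sqrt[symmetric] powr_powr flip: powr_realpow)
  ultimately show ?thesis
    by (simp add: gauss_def std_normal_density_def prod.distrib power_divide prod_dividef)
qed

text \<open>The Gaussian and the plane wave are both products over the coordinates, so this is the
  one-dimensional characteristic function of the normal distribution, coordinate by coordinate.\<close>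

lemma gauss_fourier:
  fixes w :: "'a::euclidean_space"
  shows "integrable lborel (\<lambda>y. iexp (w \<bullet> y) * complex_of_real (gauss y))"
    and "(LBINT y. iexp (w \<bullet> y) * complex_of_real (gauss y)) = complex_of_real (exp (- (norm w)\<^sup>2 / 2))"
proof -
  define f where "f = (\<lambda>(b::'a) t. iexp ((w \<bullet> b) * t) * complex_of_real (std_normal_density t))"
  interpret N: prob_space std_normal_distribution
    by (rule prob_space_normal_density) simp
  have eq: "iexp (w \<bullet> y) * complex_of_real (gauss y) = (\<Prod>b\<in>Basis. f b (y \<bullet> b))" for y
  proof -
    have "(\<i> * complex_of_real (w \<bullet> y)) = (\<Sum>b\<in>Basis. \<i> * complex_of_real ((w \<bullet> b) * (y \<bullet> b)))"
      by (subst euclidean_inner) (simp add: sum_distrib_left)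
    thus ?thesis
      by (simp add: f_def prod.distrib gauss_eq_prod exp_sum)
  qed
  have int: "integrable lborel (f b)" for b
  proof (rule Bochner_Integration.integrable_bound)
    show "integrable lborel (std_normal_density)"
      using integrable_std_normal_moment[of 0] by simp
  qed (auto simp: f_def norm_mult)
  have val: "(LBINT t. f b t) = complex_of_real (exp (- (w \<bullet> b)\<^sup>2 / 2))" for b
  proof -
    have "(LBINT t. f b t) = char std_normal_distribution (w \<bullet> b)"
      unfolding char_def
      by (subst integral_density) (auto simp: f_def scaleR_conv_of_real mult_ac)
    thus ?thesis by (simp add: char_std_normal_distribution)
  qed
  have "(\<Sum>b\<in>Basis. (w \<bullet> b)\<^sup>2) = (norm w)\<^sup>2"
    unfolding power2_norm_eq_inner by (subst euclidean_inner) (simp add: power2_eq_square)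
  hence pr: "(\<Prod>b\<in>Basis. exp (- (w \<bullet> b)\<^sup>2 / 2)) = exp (- (norm w)\<^sup>2 / 2)"
    by (simp add: exp_sum[symmetric] sum_negf sum_divide_distrib[symmetric])
  show "integrable lborel (\<lambda>y. iexp (w \<bullet> y) * complex_of_real (gauss y))"
    unfolding eq by (rule integral_lborel_prod(1)) (rule int)
  show "(LBINT y. iexp (w \<bullet> y) * complex_of_real (gauss y)) = complex_of_real (exp (- (norm w)\<^sup>2 / 2))"
    unfolding eq by (subst integral_lborel_prod(2), rule int) (simp only: val of_real_prod[symmetric] pr)
qed

lemma gauss_integrable: "integrable lborel (gauss :: 'a::euclidean_space \<Rightarrow> real)"
  using gauss_fourier(1)[of "0::'a"] by (simp add: complex_of_real_integrable_eq)

lemma gauss_integral: "(LBINT y::'a::euclidean_space. gauss y) = 1"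
  using gauss_fourier(2)[of "0::'a"] by (simp flip: of_real_eq_iff)

text \<open>Characteristic functions determine distributions, and that of \<open>y \<mapsto> u \<bullet> y\<close> is known from
  \<open>gauss_fourier\<close>. This makes moments in an arbitrary direction one-dimensional without a change
  of basis.\<close>

lemma gauss_marginal:
  fixes u :: "'a::euclidean_space"
  assumes "norm u = 1"
  shows "distr (density lborel gauss) borel (\<lambda>y. u \<bullet> y) = std_normal_distribution"
proof (rule Levy_uniqueness)
  have nn: "(\<integral>\<^sup>+y. gauss (y::'a) \<partial>lborel) = 1"
    by (simp add: nn_integral_eq_integral gauss_integrable gauss_integral gauss_pos less_imp_le)
  interpret prob_space "density lborel (gauss :: 'a \<Rightarrow> real)"
    by (rule prob_spaceI) (simp add: emeasure_density nn)
  show "real_distribution (distr (density lborel gauss) borel (\<lambda>y. u \<bullet> y))"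
    by (rule real_distribution_distr) simp
  show "real_distribution std_normal_distribution"
    by (rule real_dist_normal_dist)
  show "char (distr (density lborel gauss) borel (\<lambda>y. u \<bullet> y)) = char std_normal_distribution"
  proof
    fix t
    have "char (distr (density lborel gauss) borel (\<lambda>y. u \<bullet> y)) t
       = (LBINT y. iexp ((t *\<^sub>R u) \<bullet> y) * complex_of_real (gauss y))"
      unfolding char_def
      by (subst integral_distr, simp, simp, subst integral_density)
        (auto simp: scaleR_conv_of_real mult_ac gauss_pos less_imp_le)
    thus "char (distr (density lborel gauss) borel (\<lambda>y. u \<bullet> y)) t = char std_normal_distribution t"
      by (subst (asm) gauss_fourier(2)) (simp add: char_std_normal_distribution assms)
  qed
qed

lemma gauss_even_moment:
  fixes x :: "'a::euclidean_space"
  shows "(\<integral>\<^sup>+y. ennreal ((x \<bullet> y) ^ (2 * m) * gauss y) \<partial>lborel)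
    = ennreal (norm x ^ (2 * m) * (fact (2 * m) / (2 ^ m * fact m)))"
proof (cases "x = 0")
  case True
  then show ?thesis
    by (cases "m = 0") (auto simp: nn_integral_eq_integral gauss_integrable gauss_integral gauss_pos less_imp_le
      power_0_left)
next
  case False
  define u where "u = x /\<^sub>R norm x"
  have u: "norm u = 1" using False by (simp add: u_def)
  have x: "x = norm x *\<^sub>R u" using False by (simp add: u_def)
  have "(\<integral>\<^sup>+y. ennreal ((x \<bullet> y) ^ (2 * m) * gauss y) \<partial>lborel)
      = (\<integral>\<^sup>+y. ennreal (norm x ^ (2 * m)) * (ennreal (gauss y) * ennreal ((u \<bullet> y) ^ (2 * m))) \<partial>lborel)"
    by (subst x, intro nn_integral_cong)
      (simp add: power_mult_distrib gauss_pos less_imp_le zero_le_even_power mult_ac flip: ennreal_mult)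
  also have "\<dots> = ennreal (norm x ^ (2 * m)) * (\<integral>\<^sup>+y. ennreal (gauss y) * ennreal ((u \<bullet> y) ^ (2 * m)) \<partial>lborel)"
    by (rule nn_integral_cmult) simp
  also have "(\<integral>\<^sup>+y. ennreal (gauss y) * ennreal ((u \<bullet> y) ^ (2 * m)) \<partial>lborel)
     = (\<integral>\<^sup>+t. ennreal (t ^ (2 * m)) \<partial>distr (density lborel gauss) borel (\<lambda>y. u \<bullet> y))"
    by (simp add: nn_integral_distr nn_integral_density)
  also have "\<dots> = (\<integral>\<^sup>+t. ennreal (std_normal_density t * t ^ (2 * m)) \<partial>lborel)"
    by (simp add: gauss_marginal[OF u] nn_integral_density ennreal_mult zero_le_even_power)
  also have "\<dots> = ennreal (fact (2 * m) / (2 ^ m * fact m))"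
    using std_normal_moment_even[of m]
    by (intro nn_integral_eq_integral[THEN trans] arg_cong[where f=ennreal])
      (auto simp: has_bochner_integral_iff zero_le_even_power)
  finally show ?thesis by (simp flip: ennreal_mult)
qed

section \<open>Homogeneous functions in polar coordinates\<close>

lemma nn_integral_affine:
  fixes f :: "'a::euclidean_space \<Rightarrow> ennreal"
  assumes [measurable]: "f \<in> borel_measurable borel" and c: "c \<noteq> 0"
  shows "(\<integral>\<^sup>+y. f y \<partial>lborel) = ennreal (\<bar>c\<bar> ^ DIM('a)) * (\<integral>\<^sup>+y. f (t + c *\<^sub>R y) \<partial>lborel)"
  using c by (subst lborel_affine[of c t])
     (simp_all add: nn_integral_density nn_integral_distr nn_integral_cmult)

lemma integral_affine:
  fixes f :: "'a::euclidean_space \<Rightarrow> 'b::{banach, second_countable_topology}"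
  assumes [measurable]: "f \<in> borel_measurable borel" and c: "c \<noteq> 0"
  shows "(LBINT y. f y) = \<bar>c\<bar> ^ DIM('a) *\<^sub>R (LBINT y. f (t + c *\<^sub>R y))"
  using c by (subst lborel_affine[of c t]) (simp_all add: integral_density integral_distr)

lemma integrable_affine:
  fixes f :: "'a::euclidean_space \<Rightarrow> 'b::{banach, second_countable_topology}"
  assumes f: "integrable lborel f" and c: "c \<noteq> 0"
  shows "integrable lborel (\<lambda>y. f (t + c *\<^sub>R y))"
proof -
  have [measurable]: "f \<in> borel_measurable borel" using f by simp
  have "(\<integral>\<^sup>+y. norm (f y) \<partial>lborel) = ennreal (\<bar>c\<bar> ^ DIM('a)) * (\<integral>\<^sup>+y. norm (f (t + c *\<^sub>R y)) \<partial>lborel)"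
    by (rule nn_integral_affine) (use c in auto)
  thus ?thesis using f c by (auto simp: integrable_iff_bounded ennreal_mult_less_top)
qed

text \<open>Polar coordinates without a surface measure: by scaling, the image of the weighted measure under
  the norm gives the half line \<open>{..R}\<close> a mass proportional to \<open>R^(q+d)\<close>, which determines it. The
  Gaussian integral of \<open>p\<close> controls the mass of the unit ball, and later it also identifies \<open>C\<close>.\<close>

lemma distr_norm_homogeneous:
  fixes p :: "'a::euclidean_space \<Rightarrow> real"
  assumes [measurable]: "p \<in> borel_measurable borel" and nonneg: "\<And>y. p y \<ge> 0"
    and homog: "\<And>c y. c > 0 \<Longrightarrow> p (c *\<^sub>R y) = c ^ q * p y"
    and fin: "(\<integral>\<^sup>+y. ennreal (p y * exp (- (norm y)\<^sup>2 / 2)) \<partial>lborel) < \<infinity>"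
  obtains C :: real where "C \<ge> 0"
    "distr (density lborel p) borel norm =
     density lborel (\<lambda>s. ennreal (C * s ^ (q + DIM('a) - 1)) * indicator {0<..} s)"
proof -
  define M where "M = distr (density lborel p) borel (norm :: 'a \<Rightarrow> real)"
  define d where "d = DIM('a)"
  have d: "d > 0" by (simp add: d_def)
  have M: "emeasure M {..R} = (\<integral>\<^sup>+y. ennreal (p y) * indicator {y. norm y \<le> R} y \<partial>lborel)" for R
    unfolding M_def
    by (subst emeasure_distr, simp, simp, subst emeasure_density,
        measurable)
       (auto intro!: nn_integral_cong split: split_indicator)
  \<comment> \<open>The factor compensates the least value of the Gaussian on the unit ball.\<close>
  have "emeasure M {..1} \<le> (\<integral>\<^sup>+y. ennreal (exp (1/2)) * ennreal (p y * exp (- (norm y)\<^sup>2 / 2)) \<partial>lborel)"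
    unfolding M
  proof (intro nn_integral_mono)
    fix y :: 'a
    have "p y \<le> exp (1/2) * (p y * exp (- (norm y)\<^sup>2 / 2))" if "norm y \<le> 1"
    proof -
      have "(norm y)\<^sup>2 \<le> 1" using that by (simp add: power_le_one)
      hence "1 \<le> exp (1/2 + - (norm y)\<^sup>2 / 2)" by simp
      hence "1 \<le> exp (1/2) * exp (- (norm y)\<^sup>2 / 2)" by (simp only: exp_add)
      from mult_left_mono[OF this nonneg[of y]] show ?thesis by (simp add: mult_ac)
    qed
    thus "ennreal (p y) * indicator {y. norm y \<le> 1} y
        \<le> ennreal (exp (1/2)) * ennreal (p y * exp (- (norm y)\<^sup>2 / 2))"
      by (auto split: split_indicator simp: nonneg simp flip: ennreal_mult)
  qed
  also have "\<dots> = ennreal (exp (1/2)) * (\<integral>\<^sup>+y. ennreal (p y * exp (- (norm y)\<^sup>2 / 2)) \<partial>lborel)"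
    by (rule nn_integral_cmult) simp
  also have "\<dots> < \<infinity>" using fin by (simp add: ennreal_mult_less_top)
  finally obtain K where K: "K \<ge> 0" "emeasure M {..1} = ennreal K"
    by (cases "emeasure M {..1}") auto
  have M_R: "emeasure M {..R} = (if R \<le> 0 then 0 else ennreal (K * R ^ (q + d)))" for R
  proof (cases "R \<le> 0")
    case True
    have "AE y in lborel. y \<noteq> (0::'a)" by (rule AE_lborel_singleton)
    hence "AE y::'a in lborel. ennreal (p y) * indicator {y. norm y \<le> R} y = 0"
    proof eventually_elim
      case (elim y)
      hence "norm y > R" using True by (smt (verit) zero_less_norm_iff)
      thus ?case by simp
    qed
    thus ?thesis using True unfolding M by (subst nn_integral_cong_AE) auto
  next
    case False
    hence R: "R > 0" by simp
    have "emeasure M {..R}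
       = ennreal (R ^ d) * (\<integral>\<^sup>+y. ennreal (p (R *\<^sub>R y)) * indicator {y. norm y \<le> R} (R *\<^sub>R y) \<partial>lborel)"
      using nn_integral_affine[of "\<lambda>y. ennreal (p y) * indicator {y. norm y \<le> R} y" R 0] R
      unfolding M d_def by simp
    also have "(\<integral>\<^sup>+y. ennreal (p (R *\<^sub>R y)) * indicator {y. norm y \<le> R} (R *\<^sub>R y) \<partial>lborel)
       = (\<integral>\<^sup>+y. ennreal (R ^ q) * (ennreal (p y) * indicator {y. norm y \<le> 1} y) \<partial>lborel)"
      using R by (intro nn_integral_cong)
        (auto simp: homog nonneg ennreal_mult split: split_indicator)
    also have "\<dots> = ennreal (R ^ q) * emeasure M {..1}"
      unfolding M by (rule nn_integral_cmult) measurable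
    finally show ?thesis using R K by (simp add: power_add mult_ac flip: ennreal_mult)
  qed
  define N where "N = density lborel
     (\<lambda>s. ennreal (K * real (q + d) * s ^ (q + d - 1)) * indicator {0<..} s)"
  have N_R: "emeasure N {..R} = (if R \<le> 0 then 0 else ennreal (K * R ^ (q + d)))" for R
  proof -
    have eq: "emeasure N {..R} = (\<integral>\<^sup>+s. ennreal (K * real (q + d) * s ^ (q + d - 1)) * indicator {0<..R} s \<partial>lborel)"
      unfolding N_def by (subst emeasure_density)
         (auto intro!: nn_integral_cong split: split_indicator)
    show ?thesis
    proof (cases "R \<le> 0")
      case False
      have "emeasure N {..R} = (\<integral>\<^sup>+s. ennreal (K * real (q + d) * s ^ (q + d - 1)) * indicator {0..R} s \<partial>lborel)"
        unfolding eq using AE_lborel_singleton[of 0] 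
        by (intro nn_integral_cong_AE, eventually_elim) (auto split: split_indicator)
      also have "\<dots> = ennreal (K * R ^ (q + d) - K * 0 ^ (q + d))"
        using False K d
        by (intro nn_integral_FTC_Icc) (auto intro!: derivative_eq_intros)
      finally show ?thesis using False d by (simp add: power_0_left)
    qed (simp add: eq)
  qed
  have "M = N"
  proof (rule measure_eqI_generator_eq[where E="range atMost" and \<Omega>=UNIV and A="\<lambda>i. {..real i}"])
    show "Int_stable (range atMost :: real set set)"
      by (auto simp: Int_stable_def)
    show "emeasure M X = emeasure N X" if "X \<in> range atMost" for X
      using that by (auto simp: M_R N_R)
    show "sets M = sigma_sets UNIV (range atMost)" "sets N = sigma_sets UNIV (range atMost)"
      by (simp_all add: M_def N_def borel_eq_atMost)
    show "(\<Union>i. {..real i}) = UNIV" by (auto simp: real_arch_simple)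
    show "emeasure M {..real i} \<noteq> \<infinity>" for i by (simp add: M_R)
  qed auto
  thus ?thesis using K by (intro that[of "K * real (q + d)"]) (auto simp: M_def N_def d_def)
qed

lemma Gamma_half_nat: "Gamma (real k + 1/2) = sqrt pi * fact (2 * k) / (4 ^ k * fact k)"
proof (induction k)
  case 0
  then show ?case by (simp add: Gamma_one_half_real)
next
  case (Suc k)
  have "Gamma (real (Suc k) + 1/2) = (real k + 1/2) * Gamma (real k + 1/2)"
    using Gamma_plus1[of "real k + 1/2"] by (simp add: add_ac nonpos_Ints_def)
  also have "\<dots> = sqrt pi * fact (2 * Suc k) / (4 ^ Suc k * fact (Suc k))"
    unfolding Suc by (simp add: divide_simps) (simp add: algebra_simps)
  finally show ?case .
qed

text \<open>The normal distribution has different moment formulas for even and for odd \<open>N\<close>; the Gamma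
  function at integers and at half-integers unifies them.\<close>

lemma half_gauss_moment:
  "(\<integral>\<^sup>+s. ennreal (s ^ N * exp (- s\<^sup>2 / 2)) * indicator {0<..} s \<partial>lborel)
     = ennreal (2 powr ((real N - 1) / 2) * Gamma ((real N + 1) / 2))" (is "?I = _")
proof -
  define h where "h = (\<lambda>s::real. \<bar>s\<bar> ^ N * exp (- s\<^sup>2 / 2))"
  have [measurable]: "h \<in> borel_measurable borel" unfolding h_def by measurable
  define mom where "mom = (LBINT s. std_normal_density s * \<bar>s\<bar> ^ N)"
  have mom_int: "integrable lborel (\<lambda>s. std_normal_density s * \<bar>s\<bar> ^ N)"
    by (rule integrable_std_normal_moment_abs)
  have I: "?I = (\<integral>\<^sup>+s. ennreal (h s) * indicator {0<..} s \<partial>lborel)"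
    by (intro nn_integral_cong) (auto simp: h_def split: split_indicator)
  have "(\<integral>\<^sup>+s. ennreal (h s) \<partial>lborel)
     = (\<integral>\<^sup>+s. ennreal (h s) * indicator {0<..} s + ennreal (h s) * indicator {..<0} s \<partial>lborel)"
    using AE_lborel_singleton[of 0] 
    by (intro nn_integral_cong_AE, eventually_elim) (auto split: split_indicator)
  also have "\<dots> = ?I + (\<integral>\<^sup>+s. ennreal (h s) * indicator {..<0} s \<partial>lborel)"
    unfolding I by (rule nn_integral_add) auto
  also have "(\<integral>\<^sup>+s. ennreal (h s) * indicator {..<0} s \<partial>lborel) = ?I"
    unfolding I by (subst nn_integral_real_affine[where c="-1" and t=0])
      (auto intro!: nn_integral_cong simp: h_def split: split_indicator)
  finally have "(\<integral>\<^sup>+s. ennreal (h s) \<partial>lborel) = 2 * ?I" by (simp add: mult_2)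
  moreover have "(\<integral>\<^sup>+s. ennreal (h s) \<partial>lborel) = ennreal (sqrt (2 * pi) * mom)"
  proof -
    have "(\<integral>\<^sup>+s. ennreal (h s) \<partial>lborel)
        = (\<integral>\<^sup>+s. ennreal (sqrt (2 * pi)) * ennreal (std_normal_density s * \<bar>s\<bar> ^ N) \<partial>lborel)"
      by (intro nn_integral_cong)
        (simp add: h_def std_normal_density_def mult_ac flip: ennreal_mult)
    also have "\<dots> = ennreal (sqrt (2 * pi)) * (\<integral>\<^sup>+s. ennreal (std_normal_density s * \<bar>s\<bar> ^ N) \<partial>lborel)"
      by (rule nn_integral_cmult) simp
    also have "(\<integral>\<^sup>+s. ennreal (std_normal_density s * \<bar>s\<bar> ^ N) \<partial>lborel) = ennreal mom"
      unfolding mom_def by (rule nn_integral_eq_integral[OF mom_int]) simp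
    finally show ?thesis by (simp add: mom_def flip: ennreal_mult)
  qed
  ultimately have two_I: "2 * ?I = ennreal (sqrt (2 * pi) * mom)" by simp
  have val: "sqrt (2 * pi) * mom = 2 * (2 powr ((real N - 1) / 2) * Gamma ((real N + 1) / 2))"
  proof (cases "even N")
    case True
    then obtain k where N: "N = 2 * k" by blast
    have "mom = fact (2 * k) / (2 ^ k * fact k)"
      unfolding mom_def N using integral_std_normal_moment_even[of k] by (simp add: power_even_abs)
    moreover have "2 powr ((real N - 1) / 2) = 2 ^ k / sqrt 2"
      by (simp add: N diff_divide_distrib powr_diff powr_half_sqrt powr_realpow)
    moreover have "(4::real) ^ k = 2 ^ k * 2 ^ k" by (simp flip: power_mult_distrib)
    moreover have "(real N + 1) / 2 = real k + 1/2" by (simp add: N)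
    moreover have "r * p * (F / (E * c)) = 2 * (E / r * (p * F / (E * E * c)))"
      if "E > 0" "c > 0" "r * r = 2" "r > 0" for r p F E c :: real
      using that by (simp add: divide_simps)
    from this[of "2 ^ k" "fact k" "sqrt 2" "sqrt pi" "fact (2 * k)"]
    have "sqrt 2 * sqrt pi * (fact (2 * k) / (2 ^ k * fact k)) =
      2 * (2 ^ k / sqrt 2 * (sqrt pi * fact (2 * k) / (2 ^ k * 2 ^ k * fact k)))" by simp
    ultimately show ?thesis
      using Gamma_half_nat[of k] by (simp only: real_sqrt_mult)
  next
    case False
    then obtain k where N: "N = 2 * k + 1" by (auto elim!: oddE)
    have "mom = sqrt (2 / pi) * 2 ^ k * fact k"
      unfolding mom_def N using integral_std_normal_moment_abs_odd[of k] by simp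
    moreover have "2 powr ((real N - 1) / 2) = 2 ^ k"
      by (simp add: N powr_realpow)
    moreover have "Gamma ((real N + 1) / 2) = fact k"
      using Gamma_fact[of k, where 'a=real] by (simp add: N add_ac add_divide_distrib)
    moreover have "sqrt (2 * pi) * sqrt (2 / pi) = 2"
      by (simp flip: real_sqrt_mult)
    ultimately show ?thesis
      by (simp add: mult_ac)
  qed
  have "2 * ?I = 2 * ennreal (2 powr ((real N - 1) / 2) * Gamma ((real N + 1) / 2))"
    unfolding two_I val by (simp add: ennreal_mult' )
  thus ?thesis by (simp add: ennreal_mult_cancel_left)
qed

text \<open>The integral of \<open>(u \<bullet> \<omega>)^(2m)\<close> over the unit sphere of dimension \<open>d - 1\<close>, for a unit vector \<open>u\<close>,
  in the form in which it comes out of a quotient of Gaussian moments.\<close>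

definition radial_const :: "nat \<Rightarrow> nat \<Rightarrow> real" where
  "radial_const d m = (2 * pi) powr (real d / 2) * fact (2 * m) /
     (2 ^ m * fact m * (2 powr (real m + real d / 2 - 1) * Gamma (real m + real d / 2)))"

lemma radial_const_nonneg: "radial_const d m \<ge> 0"
proof (cases "real m + real d / 2 > 0")
  case True
  thus ?thesis
    unfolding radial_const_def by (intro divide_nonneg_nonneg mult_nonneg_nonneg) (auto intro: Gamma_real_nonneg)
next
  case False
  hence "m = 0" "d = 0" by auto
  thus ?thesis by (simp add: radial_const_def Gamma_eq_zero_iff[THEN iffD2])
qed

text \<open>The function \<open>k \<mapsto> (x \<bullet> k)^(2m)\<close> is homogeneous, and integrating \<open>exp(-s^2/2)\<close> against both
  measures determines the constant: on the left it gives a Gaussian moment in the direction \<open>x\<close>, on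
  the right a moment on the half line.\<close>

lemma distr_norm_inner_power:
  fixes x :: "'a::euclidean_space"
  shows "distr (density lborel (\<lambda>k. ennreal ((x \<bullet> k) ^ (2 * m)))) borel norm =
     density lborel (\<lambda>s. ennreal (radial_const DIM('a) m * norm x ^ (2 * m) * s ^ (2 * m + DIM('a) - 1))
        * indicator {0<..} s)"
proof -
  define d where "d = DIM('a)"
  have d: "d > 0" by (simp add: d_def)
  have mom: "(\<integral>\<^sup>+y. ennreal ((x \<bullet> y) ^ (2 * m) * exp (- (norm y)\<^sup>2 / 2)) \<partial>lborel)
     = ennreal ((2 * pi) powr (d / 2) * (norm x ^ (2 * m) * (fact (2 * m) / (2 ^ m * fact m))))"
  proof -
    have "(\<integral>\<^sup>+y. ennreal ((x \<bullet> y) ^ (2 * m) * exp (- (norm y)\<^sup>2 / 2)) \<partial>lborel)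
      = (\<integral>\<^sup>+y. ennreal ((2 * pi) powr (d / 2)) * ennreal ((x \<bullet> y) ^ (2 * m) * gauss y) \<partial>lborel)"
      by (intro nn_integral_cong)
        (simp add: gauss_def d_def zero_le_even_power flip: ennreal_mult)
    also have "\<dots> = ennreal ((2 * pi) powr (d / 2)) * (\<integral>\<^sup>+y. ennreal ((x \<bullet> y) ^ (2 * m) * gauss y) \<partial>lborel)"
      by (rule nn_integral_cmult) simp
    finally show ?thesis
      by (simp add: gauss_even_moment flip: ennreal_mult)
  qed
  obtain C where C: "C \<ge> 0"
    "distr (density lborel (\<lambda>k. ennreal ((x \<bullet> k) ^ (2 * m)))) borel norm =
     density lborel (\<lambda>s. ennreal (C * s ^ (2 * m + d - 1)) * indicator {0<..} s)"
  proof (rule distr_norm_homogeneous[where p="\<lambda>k. (x \<bullet> k) ^ (2 * m)" and q="2 * m"])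
    show "(\<integral>\<^sup>+ y. ennreal ((x \<bullet> y) ^ (2 * m) * exp (- (norm y)\<^sup>2 / 2)) \<partial>lborel) < \<infinity>"
      unfolding mom by simp
  qed (auto simp: power_mult_distrib d_def zero_le_even_power)
  define A where "A = 2 powr (real m + d / 2 - 1) * Gamma (real m + d / 2)"
  have A: "A > 0" using d by (auto simp: A_def intro!: mult_pos_pos Gamma_real_pos)
  have "ennreal ((2 * pi) powr (d / 2) * (norm x ^ (2 * m) * (fact (2 * m) / (2 ^ m * fact m))))
    = (\<integral>\<^sup>+s. ennreal (exp (- s\<^sup>2 / 2)) \<partial>distr (density lborel (\<lambda>k. ennreal ((x \<bullet> k) ^ (2 * m)))) borel norm)"
    unfolding mom[symmetric] 
    by (subst nn_integral_distr, simp, simp, subst nn_integral_density)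
      (auto simp: ennreal_mult zero_le_even_power)
  also have "\<dots> = (\<integral>\<^sup>+s. ennreal C * (ennreal (s ^ (2 * m + d - 1) * exp (- s\<^sup>2 / 2)) * indicator {0<..} s) \<partial>lborel)"
    unfolding C(2) 
    by (subst nn_integral_density)
      (auto intro!: nn_integral_cong split: split_indicator simp: C mult_ac simp flip: ennreal_mult)
  also have "\<dots> = ennreal C * (\<integral>\<^sup>+s. ennreal (s ^ (2 * m + d - 1) * exp (- s\<^sup>2 / 2)) * indicator {0<..} s \<partial>lborel)"
    by (rule nn_integral_cmult) simp
  also have "(\<integral>\<^sup>+s. ennreal (s ^ (2 * m + d - 1) * exp (- s\<^sup>2 / 2)) * indicator {0<..} s \<partial>lborel) = ennreal A"
    unfolding half_gauss_moment A_def using d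
    by (simp add: of_nat_diff add_divide_distrib diff_divide_distrib)
  finally have "ennreal ((2 * pi) powr (d / 2) * (norm x ^ (2 * m) * (fact (2 * m) / (2 ^ m * fact m)))) = ennreal (C * A)"
    using C A by (simp add: ennreal_mult)
  hence "(2 * pi) powr (d / 2) * (norm x ^ (2 * m) * (fact (2 * m) / (2 ^ m * fact m))) = C * A"
    using C A by (subst (asm) ennreal_inj) auto
  hence "C = radial_const d m * norm x ^ (2 * m)"
    unfolding radial_const_def A_def[symmetric] using A by (simp add: field_simps)
  thus ?thesis using C(2) by (simp add: d_def)
qed

lemma radial_const_0: "d > 0 \<Longrightarrow> radial_const d 0 = sphere_area d"
proof -
  have "2 * (2 powr (real d / 2) * pi powr (real d / 2)) / (2 powr (real d / 2) * g)
      = 2 * pi powr (real d / 2) / g" for g :: real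
    by (simp add: field_simps)
  thus ?thesis
    by (simp add: radial_const_def sphere_area_def powr_mult powr_diff mult_ac)
qed

lemma radial_integral_inner_power:
  fixes x :: "'a::euclidean_space" and f :: "real \<Rightarrow> 'b::{banach, second_countable_topology}"
  assumes [measurable]: "f \<in> borel_measurable borel"
  shows "(LBINT k. (x \<bullet> k) ^ (2 * m) *\<^sub>R f (norm k))
     = (LBINT s:{0<..}. (radial_const DIM('a) m * norm x ^ (2 * m) * s ^ (2 * m + DIM('a) - 1)) *\<^sub>R f s)"
proof -
  have "(LBINT k. (x \<bullet> k) ^ (2 * m) *\<^sub>R f (norm k))
    = (\<integral>s. f s \<partial>distr (density lborel (\<lambda>k. ennreal ((x \<bullet> k) ^ (2 * m)))) borel norm)"
    by (subst integral_distr, simp, simp, subst integral_density) (auto simp: zero_le_even_power)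
  also have "\<dots> = (\<integral>s. f s \<partial>density lborel
      (\<lambda>s. ennreal (indicator {0<..} s * (radial_const DIM('a) m * norm x ^ (2 * m) * s ^ (2 * m + DIM('a) - 1)))))"
    unfolding distr_norm_inner_power
    by (intro arg_cong2[where f="integral\<^sup>L"] density_cong AE_I2 refl)
      (auto split: split_indicator)
  also have "\<dots> = (LBINT s. (indicator {0<..} s * (radial_const DIM('a) m * norm x ^ (2 * m) * s ^ (2 * m + DIM('a) - 1))) *\<^sub>R f s)"
    by (subst integral_density)
      (auto split: split_indicator intro!: AE_I2 mult_nonneg_nonneg radial_const_nonneg)
  finally show ?thesis
    by (simp add: set_lebesgue_integral_def)
qed

lemma radial_integral:
  fixes f :: "real \<Rightarrow> 'b::{banach, second_countable_topology}"
  assumes [measurable]: "f \<in> borel_measurable borel"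
  shows "(LBINT k::'a::euclidean_space. f (norm k))
     = sphere_area DIM('a) *\<^sub>R (LBINT s:{0<..}. s ^ (DIM('a) - 1) *\<^sub>R f s)"
  using radial_integral_inner_power[OF assms, of "0::'a" 0]
  by (simp add: radial_const_0 set_lebesgue_integral_def flip: scaleR_scaleR)

lemma radial_nn_integral:
  fixes f :: "real \<Rightarrow> ennreal"
  assumes [measurable]: "f \<in> borel_measurable borel"
  shows "(\<integral>\<^sup>+k. f (norm (k::'a::euclidean_space)) \<partial>lborel)
     = (\<integral>\<^sup>+s. ennreal (sphere_area DIM('a) * s ^ (DIM('a) - 1)) * indicator {0<..} s * f s \<partial>lborel)"
proof -
  have "(\<integral>\<^sup>+k. f (norm (k::'a)) \<partial>lborel) = (\<integral>\<^sup>+s. f s \<partial>distr (density lborel (\<lambda>k. ennreal (((0::'a) \<bullet> k) ^ (2 * 0)))) borel norm)"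
    by (subst nn_integral_distr, simp, simp, subst nn_integral_density) auto
  also have "\<dots> = (\<integral>\<^sup>+s. ennreal (sphere_area DIM('a) * s ^ (DIM('a) - 1)) * indicator {0<..} s * f s \<partial>lborel)"
    unfolding distr_norm_inner_power by (subst nn_integral_density) (auto simp: radial_const_0)
  finally show ?thesis .
qed

lemma sphere_area_pos: "d > 0 \<Longrightarrow> sphere_area d > 0"
  by (auto simp: sphere_area_def intro!: divide_pos_pos Gamma_real_pos)

lemma radial_integrable:
  fixes f :: "real \<Rightarrow> 'b::{banach, second_countable_topology}"
  assumes [measurable]: "f \<in> borel_measurable borel"
  shows "integrable lborel (\<lambda>k::'a::euclidean_space. f (norm k))
     \<longleftrightarrow> set_integrable lborel {0<..} (\<lambda>s. s ^ (DIM('a) - 1) *\<^sub>R f s)"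
proof -
  have "(\<integral>\<^sup>+k. ennreal (norm (f (norm (k::'a)))) \<partial>lborel)
     = (\<integral>\<^sup>+s. ennreal (sphere_area DIM('a)) * ennreal (norm (indicator {0<..} s *\<^sub>R s ^ (DIM('a) - 1) *\<^sub>R f s)) \<partial>lborel)"
    by (subst radial_nn_integral)
      (auto intro!: nn_integral_cong split: split_indicator simp: sphere_area_pos less_imp_le mult_ac simp flip: ennreal_mult)
  also have "\<dots> = ennreal (sphere_area DIM('a)) * (\<integral>\<^sup>+s. ennreal (norm (indicator {0<..} s *\<^sub>R s ^ (DIM('a) - 1) *\<^sub>R f s)) \<partial>lborel)"
    by (rule nn_integral_cmult) simp
  finally show ?thesis
    using sphere_area_pos[of "DIM('a)"]
    by (auto simp: integrable_iff_bounded set_integrable_def ennreal_mult_less_top)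
qed

section \<open>Bessel functions and the Hankel transform\<close>

lemma integral_sums_dominated:
  fixes c :: "nat \<Rightarrow> 'a \<Rightarrow> 'b::{banach, second_countable_topology}"
  assumes [measurable]: "\<And>m. c m \<in> borel_measurable M"
    and bound: "\<And>m x. norm (c m x) \<le> b m * norm (g x)"
    and b: "summable b" and g: "integrable M (g :: 'a \<Rightarrow> 'c::{banach, second_countable_topology})"
  shows "(\<lambda>m. \<integral>x. c m x \<partial>M) sums (\<integral>x. (\<Sum>m. c m x) \<partial>M)"
proof (rule sums_integral)
  show int: "integrable M (c m)" for m
  proof (rule Bochner_Integration.integrable_bound)
    show "integrable M (\<lambda>x. b m * norm (g x))" using g by simp
    show "AE x in M. norm (c m x) \<le> norm (b m * norm (g x))"
      using bound[of m] by (auto intro!: AE_I2 intro: order_trans[OF _ abs_ge_self])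
  qed simp
  show "AE x in M. summable (\<lambda>m. norm (c m x))"
  proof (rule AE_I2)
    fix x
    show "summable (\<lambda>m. norm (c m x))"
      by (rule summable_comparison_test'[OF summable_mult2[OF b, of "norm (g x)"], of 0])
        (use bound[of _ x] in simp)
  qed
  show "summable (\<lambda>m. \<integral>x. norm (c m x) \<partial>M)"
  proof (rule summable_comparison_test'[OF summable_mult2[OF b, of "\<integral>x. norm (g x) \<partial>M"], of 0])
    fix m
    have "(\<integral>x. norm (c m x) \<partial>M) \<le> (\<integral>x. b m * norm (g x) \<partial>M)"
      using int g bound by (intro integral_mono) auto
    thus "norm (\<integral>x. norm (c m x) \<partial>M) \<le> b m * (\<integral>x. norm (g x) \<partial>M)" by simp
  qed
qed

text \<open>The coefficients of \<open>J_\<nu>(s) / s^\<nu>\<close>, for \<open>\<nu> = d/2 - 1\<close>, as a power series in \<open>s^2\<close>.\<close>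

definition bessel_coeff :: "nat \<Rightarrow> nat \<Rightarrow> real" where
  "bessel_coeff d m = (-1) ^ m / (fact m * Gamma (real m + real d / 2) * 2 powr (real d / 2 - 1) * 4 ^ m)"

text \<open>Multiplication by the coefficients of the cosine series turns the integrals over the sphere into
  the coefficients of the Bessel series.\<close>

lemma bessel_coeff_radial_const:
  "(-1) ^ m / fact (2 * m) * radial_const d m = (2 * pi) powr (real d / 2) * bessel_coeff d m"
proof -
  have "(2::real) powr (real m + real d / 2 - 1) = 2 ^ m * 2 powr (real d / 2 - 1)"
    using powr_add[of 2 "real m" "real d / 2 - 1"] by (simp add: powr_realpow algebra_simps)
  moreover have "(4::real) ^ m = 2 ^ m * 2 ^ m" by (simp flip: power_mult_distrib)
  ultimately show ?thesis
    unfolding radial_const_def bessel_coeff_def by (simp add: mult_ac)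
qed

text \<open>Each step from \<open>\<Gamma>(m + d/2)\<close> to \<open>\<Gamma>(m + 1 + d/2)\<close> multiplies by at least \<open>1/2\<close>, so the series is
  dominated by an exponential series.\<close>

lemma bessel_coeff_summable:
  assumes d: "d > 0"
  shows "summable (\<lambda>m. \<bar>bessel_coeff d m * y ^ m\<bar>)" "summable (\<lambda>m. bessel_coeff d m * y ^ m)"
proof -
  define a where "a = real d / 2"
  have a: "a \<ge> 1/2" using d by (simp add: a_def)
  have G: "Gamma (real m + a) \<ge> Gamma a / 2 ^ m \<and> Gamma (real m + a) > 0" for m
  proof (induction m)
    case 0
    then show ?case using a by (simp add: Gamma_real_pos)
  next
    case (Suc m)
    have "Gamma (real (Suc m) + a) = (real m + a) * Gamma (real m + a)"
      using Gamma_plus1[of "real m + a"] a by (simp add: add_ac nonpos_Ints_def)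
    moreover have "(real m + a) * Gamma (real m + a) \<ge> (1/2) * (Gamma a / 2 ^ m)"
      using Suc a by (intro mult_mono) (auto intro: Gamma_real_nonneg)
    ultimately show ?case using Suc a by simp
  qed
  have Ga: "Gamma a > 0" using a by (intro Gamma_real_pos) auto
  define C where "C = 1 / (Gamma a * 2 powr (a - 1))"
  have "\<bar>bessel_coeff d m * y ^ m\<bar> \<le> C * ((\<bar>y\<bar> / 2) ^ m / fact m)" for m
  proof -
    have "\<bar>bessel_coeff d m * y ^ m\<bar> = \<bar>y\<bar> ^ m / (fact m * Gamma (real m + a) * 2 powr (a - 1) * 4 ^ m)"
      using G[of m] by (simp add: bessel_coeff_def abs_mult power_abs a_def)
    also have "\<dots> \<le> \<bar>y\<bar> ^ m / (fact m * (Gamma a / 2 ^ m) * 2 powr (a - 1) * 4 ^ m)"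
      using G[of m] Ga by (intro divide_left_mono mult_right_mono mult_left_mono mult_pos_pos) auto
    also have "\<dots> = C * ((\<bar>y\<bar> / 2) ^ m / fact m)"
    proof -
      have four: "(4::real) ^ m = 2 ^ m * 2 ^ m" by (simp flip: power_mult_distrib)
      have frac: "Y / (F * (g / T) * P * (T * T)) = 1 / (g * P) * (Y / T / F)"
        if "T > 0" for Y F g P T :: real
        using that by (cases "F = 0"; cases "g = 0"; cases "P = 0") (auto simp: divide_simps)
      show ?thesis
        unfolding four C_def power_divide by (rule frac) simp
    qed
    finally show ?thesis .
  qed
  moreover have "summable (\<lambda>m. C * ((\<bar>y\<bar> / 2) ^ m / fact m))"
    using summable_exp[of "\<bar>y\<bar> / 2"] by (intro summable_mult) (simp add: field_simps)
  ultimately show abs: "summable (\<lambda>m. \<bar>bessel_coeff d m * y ^ m\<bar>)"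
    by - (erule summable_comparison_test'[where N=0], simp only: real_norm_def abs_idempotent)
  show "summable (\<lambda>m. bessel_coeff d m * y ^ m)"
    using abs by (rule summable_rabs_cancel)
qed

lemma bessel_J_quot_eq:
  assumes d: "d > 0" and s: "s \<ge> 0"
  shows "bessel_J_quot (real d / 2 - 1) s = (\<Sum>m. bessel_coeff d m * (s\<^sup>2) ^ m)"
proof (cases "s = 0")
  case True
  have "(\<Sum>m. bessel_coeff d m * 0 ^ m) = bessel_coeff d 0"
    using powser_zero[of "bessel_coeff d"] by simp
  thus ?thesis using True by (simp add: bessel_J_quot_def bessel_coeff_def mult.commute)
next
  case False
  define \<nu> where "\<nu> = real d / 2 - 1"
  have s: "s > 0" using s False by simp
  have trm: "(-1) ^ m / fact m * rGamma (real m + \<nu> + 1) * (s / 2) powr (2 * real m + \<nu>)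
     = s powr \<nu> * (bessel_coeff d m * (s\<^sup>2) ^ m)" for m
  proof -
    have e1: "(s / 2) powr (2 * real m + \<nu>) = (s / 2) ^ (2 * m) * (s powr \<nu> / 2 powr \<nu>)"
      using s by (simp add: powr_add powr_divide flip: powr_realpow)
    have e2: "(s / 2) ^ (2 * m) = (s\<^sup>2) ^ m / 4 ^ m"
      by (simp add: power_mult power_divide)
    have e3: "real m + \<nu> + 1 = real m + real d / 2" by (simp add: \<nu>_def)
    have frac: "S / F * inverse g * (Y / T * (X / P)) = X * (S / (F * g * P * T) * Y)"
      for S F g Y T X P :: real
      by (simp add: divide_inverse mult_ac)
    show ?thesis
      unfolding e1 e2 e3 bessel_coeff_def rGamma_inverse_Gamma \<nu>_def[symmetric] by (rule frac)
  qed
  have "bessel_J \<nu> s = s powr \<nu> * (\<Sum>m. bessel_coeff d m * (s\<^sup>2) ^ m)"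
    unfolding bessel_J_def trm by (rule suminf_mult[OF bessel_coeff_summable(2)[OF d]])
  thus ?thesis using s by (simp add: bessel_J_quot_def \<nu>_def[symmetric])
qed

lemma continuous_on_bessel_J_quot:
  assumes d: "d > 0"
  shows "continuous_on {0..} (bessel_J_quot (real d / 2 - 1))"
proof -
  have "isCont (\<lambda>y. \<Sum>m. bessel_coeff d m * y ^ m) y" for y :: real
    by (rule isCont_powser_converges_everywhere) (rule bessel_coeff_summable(2)[OF d])
  hence "continuous_on UNIV (\<lambda>y. \<Sum>m. bessel_coeff d m * y ^ m)"
    by (simp add: continuous_at_imp_continuous_on)
  hence "continuous_on {0..} (\<lambda>s. \<Sum>m. bessel_coeff d m * (s\<^sup>2) ^ m)"
    by (rule continuous_on_compose2) (auto intro!: continuous_intros)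
  thus ?thesis
    by (rule continuous_on_cong[THEN iffD1, rotated -1]) (auto simp: bessel_J_quot_eq[OF d])
qed

lemma bessel_J_quot_measurable:
  assumes d: "d > 0" and c: "c \<ge> 0"
  shows "(\<lambda>s. indicator {0<..} s * bessel_J_quot (real d / 2 - 1) (c * s)) \<in> borel_measurable borel"
proof -
  have "continuous_on {0<..} (\<lambda>s. bessel_J_quot (real d / 2 - 1) (c * s))"
    using c by (intro continuous_on_compose2[OF continuous_on_bessel_J_quot[OF d]])
       (auto intro!: continuous_intros)
  hence "(\<lambda>s. indicator {0<..} s *\<^sub>R bessel_J_quot (real d / 2 - 1) (c * s)) \<in> borel_measurable borel"
    by (intro borel_measurable_continuous_on_indicator) auto
  thus ?thesis by simp
qed

text \<open>The cosine series is integrated term by term. By \<open>radial_integral_inner_power\<close> each term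
  contributes a moment of \<open>f\<close> on the half line, and by \<open>bessel_coeff_radial_const\<close> these moments
  add up to the Bessel series. Bounded support makes both interchanges of sum and integral
  absolutely convergent.\<close>

lemma radial_cos_integral_bounded_support:
  fixes x :: "'a::euclidean_space" and f :: "real \<Rightarrow> real"
  assumes [measurable]: "f \<in> borel_measurable borel"
    and int: "integrable lborel (\<lambda>k::'a. f (norm k))"
    and R: "R \<ge> 0" and supp: "\<And>s. s > R \<Longrightarrow> f s = 0"
  shows "(LBINT k. cos (x \<bullet> k) * f (norm k)) = (2 * pi) powr (DIM('a) / 2) *
     (LBINT s:{0<..}. s ^ (DIM('a) - 1) * bessel_J_quot (DIM('a) / 2 - 1) (norm x * s) * f s)"
proof -
  define d where "d = DIM('a)"
  have d: "d > 0" by (simp add: d_def)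
  define c where "c = (\<lambda>m (k::'a). (-1) ^ m / fact (2 * m) * (x \<bullet> k) ^ (2 * m) * f (norm k))"
  define h where "h = (\<lambda>s. indicator {0<..} s * s ^ (d - 1) * f s :: real)"
  define c' where "c' = (\<lambda>m s. h s * (bessel_coeff d m * ((norm x * s)\<^sup>2) ^ m))"
  have [measurable]: "h \<in> borel_measurable borel" unfolding h_def by measurable
  have [measurable]: "c m \<in> borel_measurable borel" "c' m \<in> borel_measurable borel" for m
    unfolding c_def c'_def by measurable
  have h_int: "integrable lborel h"
    using int unfolding radial_integrable[OF assms(1)] 
    by (simp add: set_integrable_def h_def[abs_def] d_def mult.assoc)
  have "(\<lambda>m. LBINT k. c m k) sums (LBINT k. (\<Sum>m. c m k))"
  proof (rule integral_sums_dominated)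
    show "summable (\<lambda>m. (norm x * R) ^ (2 * m) / fact (2 * m))"
    proof -
      have "summable (\<lambda>n. (norm x * R) ^ n / fact n)"
        using summable_exp[of "norm x * R"] by (simp add: field_simps)
      hence "summable ((\<lambda>n. (norm x * R) ^ n / fact n) \<circ> (\<lambda>m. 2 * m))"
        by (rule summable_reindex) (use R in \<open>auto simp: inj_on_def\<close>)
      thus ?thesis by (simp add: o_def)
    qed
    show "norm (c m k) \<le> (norm x * R) ^ (2 * m) / fact (2 * m) * norm (f (norm k))" for m k
    proof (cases "norm k \<le> R")
      case True
      have "\<bar>x \<bullet> k\<bar> \<le> norm x * norm k" by (rule Cauchy_Schwarz_ineq2)
      also have "\<dots> \<le> norm x * R" using True by (intro mult_left_mono) auto
      finally have "\<bar>x \<bullet> k\<bar> ^ (2 * m) \<le> (norm x * R) ^ (2 * m)" by (intro power_mono) auto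
      thus ?thesis
        by (auto simp: c_def abs_mult power_abs intro!: mult_right_mono divide_right_mono)
    next
      case False
      thus ?thesis using R by (simp add: c_def supp)
    qed
  qed (use int in auto)
  moreover have "(\<Sum>m. c m k) = cos (x \<bullet> k) * f (norm k)" for k
    unfolding c_def using sums_mult2[OF cos_paired[of "x \<bullet> k"]] by (rule sums_unique[symmetric])
  moreover have "(LBINT k. c m k) = (2 * pi) powr (d / 2) * (LBINT s. c' m s)" for m
  proof -
    have "(LBINT k. c m k) = (-1) ^ m / fact (2 * m) * (LBINT k. (x \<bullet> k) ^ (2 * m) *\<^sub>R f (norm k))"
      by (simp add: c_def mult.assoc)
    also have "(LBINT k. (x \<bullet> k) ^ (2 * m) *\<^sub>R f (norm k))
      = (LBINT s. radial_const d m * (norm x ^ (2 * m) * s ^ (2 * m) * h s))"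
    proof -
      have "2 * m + d - 1 = 2 * m + (d - 1)" using d by simp
      thus ?thesis
        unfolding radial_integral_inner_power[OF assms(1)] set_lebesgue_integral_def d_def[symmetric]
        by (intro Bochner_Integration.integral_cong) (auto simp: h_def power_add split: split_indicator)
    qed
    also have "\<dots> = radial_const d m * (LBINT s. norm x ^ (2 * m) * s ^ (2 * m) * h s)" by simp
    finally have "(LBINT k. c m k) = ((-1) ^ m / fact (2 * m) * radial_const d m) *
       (LBINT s. norm x ^ (2 * m) * s ^ (2 * m) * h s)" by simp
    also have "\<dots> = (2 * pi) powr (d / 2) * (bessel_coeff d m * (LBINT s. norm x ^ (2 * m) * s ^ (2 * m) * h s))"
      unfolding bessel_coeff_radial_const by simp
    also have "bessel_coeff d m * (LBINT s. norm x ^ (2 * m) * s ^ (2 * m) * h s) = (LBINT s. c' m s)"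
      unfolding c'_def
      by (subst integral_mult_right_zero[symmetric], intro Bochner_Integration.integral_cong)
         (auto simp: power_mult_distrib mult_ac simp flip: power_mult)
    finally show ?thesis .
  qed
  ultimately have 1: "(\<lambda>m. (2 * pi) powr (d / 2) * (LBINT s. c' m s)) sums (LBINT k. cos (x \<bullet> k) * f (norm k))"
    by simp
  have "(\<lambda>m. LBINT s. c' m s) sums (LBINT s. (\<Sum>m. c' m s))"
  proof (rule integral_sums_dominated)
    show "summable (\<lambda>m. \<bar>bessel_coeff d m * ((norm x * R)\<^sup>2) ^ m\<bar>)"
      by (rule bessel_coeff_summable(1)[OF d])
    show "norm (c' m s) \<le> \<bar>bessel_coeff d m * ((norm x * R)\<^sup>2) ^ m\<bar> * norm (h s)" for m s
    proof (cases "s > 0 \<and> s \<le> R")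
      case True
      hence "((norm x * s)\<^sup>2) ^ m \<le> ((norm x * R)\<^sup>2) ^ m"
        by (intro power_mono mult_left_mono) auto
      hence "\<bar>bessel_coeff d m\<bar> * \<bar>((norm x * s)\<^sup>2) ^ m\<bar> * \<bar>h s\<bar> \<le> \<bar>bessel_coeff d m\<bar> * \<bar>((norm x * R)\<^sup>2) ^ m\<bar> * \<bar>h s\<bar>"
        by (intro mult_right_mono mult_left_mono) auto
      thus ?thesis unfolding c'_def by (simp add: abs_mult mult_ac)
    next
      case False
      hence "h s = 0" by (auto simp: h_def supp split: split_indicator)
      thus ?thesis by (simp add: c'_def)
    qed
  qed (use h_int in auto)
  moreover have "(\<Sum>m. c' m s) = indicator {0<..} s *\<^sub>R (s ^ (d - 1) * bessel_J_quot (d / 2 - 1) (norm x * s) * f s)" for s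
  proof (cases "s > 0")
    case True
    have "(\<Sum>m. c' m s) = h s * (\<Sum>m. bessel_coeff d m * ((norm x * s)\<^sup>2) ^ m)"
      unfolding c'_def by (rule suminf_mult[OF bessel_coeff_summable(2)[OF d]])
    thus ?thesis using True bessel_J_quot_eq[OF d, of "norm x * s"] by (simp add: h_def)
  qed (simp add: c'_def h_def)
  ultimately have "(\<lambda>m. LBINT s. c' m s) sums
     (LBINT s:{0<..}. s ^ (d - 1) * bessel_J_quot (d / 2 - 1) (norm x * s) * f s)"
    by (simp add: set_lebesgue_integral_def)
  from sums_unique2[OF 1 sums_mult[OF this]] show ?thesis by (simp add: d_def)
qed

lemma bessel_J_quot_0_pos: "d > 0 \<Longrightarrow> bessel_J_quot (real d / 2 - 1) 0 > 0"
  by (auto simp: bessel_J_quot_def intro!: divide_pos_pos mult_pos_pos Gamma_real_pos)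

text \<open>Up to a positive factor, the Bessel quotient at \<open>s\<close> is the average of \<open>cos (u \<bullet> k)\<close> over the sphere
  \<open>|k| = s\<close>, and the average of the constant \<open>1\<close> is its value at \<open>0\<close>. The averages are replaced
  by integrals over shells around a radius \<open>t\<close>: if \<open>1 \<plusminus> cos (u \<bullet> k) \<ge> 0\<close> had a negative average at
  \<open>t\<close>, then also on a thin shell, by continuity.\<close>

lemma bessel_J_quot_bound:
  assumes d: "DIM('a::euclidean_space) = d" and s: "s \<ge> 0"
  shows "\<bar>bessel_J_quot (real d / 2 - 1) s\<bar> \<le> bessel_J_quot (real d / 2 - 1) 0"
proof -
  define J where "J = bessel_J_quot (real d / 2 - 1)"
  have d0: "d > 0" using d DIM_positive[where 'a='a] by simp
  have J0: "J 0 > 0" unfolding J_def by (rule bessel_J_quot_0_pos[OF d0])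
  have cont: "continuous_on {0..} J" unfolding J_def by (rule continuous_on_bessel_J_quot[OF d0])
  obtain u :: 'a where u: "norm u = 1" using norm_Basis SOME_Basis by blast
  \<comment> \<open>The sign \<open>\<sigma>\<close> covers the upper and the lower bound at once.\<close>
  have main: "J 0 + \<sigma> * J t \<ge> 0" if \<sigma>: "\<bar>\<sigma>\<bar> = 1" and t: "t > 0" for \<sigma> t
  proof (rule ccontr)
    assume neg: "\<not> J 0 + \<sigma> * J t \<ge> 0"
    define g where "g = (\<lambda>s. s ^ (d - 1) * (J 0 + \<sigma> * J s))"
    have contg: "continuous_on {0..} g"
      unfolding g_def by (intro continuous_intros cont)
    have gt: "g t < 0" using neg t by (auto simp: g_def mult_pos_neg)
    have "isCont g t"
      using contg t by (auto simp: continuous_on_interior)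
    then obtain \<delta>0 where \<delta>0: "\<delta>0 > 0" "\<And>s. dist s t < \<delta>0 \<Longrightarrow> dist (g s) (g t) < - g t / 2"
      using gt by (metis continuous_at_eps_delta divide_pos_pos neg_0_less_iff_less zero_less_numeral)
    define \<delta> where "\<delta> = min (\<delta>0 / 2) (t / 2)"
    have \<delta>: "\<delta> > 0" "\<delta> < \<delta>0" "\<delta> < t" using \<delta>0 t by (auto simp: \<delta>_def)
    have g_less: "g s \<le> g t / 2" if "s \<in> {t-\<delta>..t+\<delta>}" for s
    proof -
      have "dist s t < \<delta>0" using that \<delta> by (auto simp: dist_real_def)
      from \<delta>0(2)[OF this] show ?thesis by (auto simp: dist_real_def abs_if split: if_splits)
    qed
    define f :: "real \<Rightarrow> real" where "f = indicator {t-\<delta>..t+\<delta>}"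
    have [measurable]: "f \<in> borel_measurable borel" by (simp add: f_def)
    have int: "integrable lborel (\<lambda>k::'a. f (norm k))"
    proof (rule Bochner_Integration.integrable_bound)
      show "integrable lborel (indicator (cball 0 (t+\<delta>)) :: 'a \<Rightarrow> real)"
        using emeasure_bounded_finite[of "cball (0::'a) (t+\<delta>)"] by (intro integrable_real_indicator) auto
    qed (auto simp: f_def split: split_indicator)
    have int_cos: "integrable lborel (\<lambda>k::'a. cos (u \<bullet> k) * f (norm k))"
      by (rule Bochner_Integration.integrable_bound[OF int]) (auto simp: abs_mult mult_left_le_one_le)
    have supp: "f s = 0" if "s > t + \<delta>" for s using that by (simp add: f_def)
    have f_int: "integrable lborel (\<lambda>s. h s * f s)" if "continuous_on {0..} h" for h :: "real \<Rightarrow> real"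
    proof -
      have "set_integrable lborel {t-\<delta>..t+\<delta>} h"
        unfolding set_integrable_def
        using \<delta> by (intro borel_integrable_compact continuous_on_subset[OF that] compact_Icc) auto
      thus ?thesis by (simp add: set_integrable_def f_def mult.commute)
    qed
    have ind: "(LBINT s:{0<..}. h s * f s) = (LBINT s. h s * f s)" for h :: "real \<Rightarrow> real"
      unfolding set_lebesgue_integral_def f_def using \<delta>
      by (intro Bochner_Integration.integral_cong) (auto split: split_indicator)
    have "0 \<le> (LBINT k::'a. cos (0 \<bullet> k) * f (norm k) + \<sigma> * (cos (u \<bullet> k) * f (norm k)))"
    proof (intro Bochner_Integration.integral_nonneg)
      fix k :: 'a
      have "-1 \<le> \<sigma> * cos (u \<bullet> k)"
        using \<sigma> abs_cos_le_one[of "u \<bullet> k"] by (auto simp: abs_if split: if_splits)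
      hence "0 \<le> (1 + \<sigma> * cos (u \<bullet> k)) * f (norm k)"
        by (intro mult_nonneg_nonneg) (auto simp: f_def)
      thus "0 \<le> cos (0 \<bullet> k) * f (norm k) + \<sigma> * (cos (u \<bullet> k) * f (norm k))"
        by (simp add: algebra_simps)
    qed
    also have "\<dots> = (LBINT k::'a. cos (0 \<bullet> k) * f (norm k)) + \<sigma> * (LBINT k::'a. cos (u \<bullet> k) * f (norm k))"
      using int int_cos by simp
    also have "\<dots> = (2 * pi) powr (d / 2) * ((LBINT s. s ^ (d - 1) * J 0 * f s) + \<sigma> * (LBINT s. s ^ (d - 1) * J s * f s))"
    proof -
      have "(LBINT k::'a. cos (w \<bullet> k) * f (norm k)) = (2 * pi) powr (d / 2) * (LBINT s. s ^ (d - 1) * J (norm w * s) * f s)" for w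
        using radial_cos_integral_bounded_support[OF _ int _ supp, of "t + \<delta>" w] t \<delta>
          ind[of "\<lambda>s. s ^ (d - 1) * J (norm w * s)"]
        by (simp add: d J_def)
      thus ?thesis using u by (simp only: distrib_left) simp
    qed
    also have "(LBINT s. s ^ (d - 1) * J 0 * f s) + \<sigma> * (LBINT s. s ^ (d - 1) * J s * f s) = (LBINT s. g s * f s)"
    proof -
      have i: "integrable lborel (\<lambda>s. s ^ (d - 1) * J 0 * f s)" "integrable lborel (\<lambda>s. s ^ (d - 1) * J s * f s)"
        by (intro f_int continuous_intros cont)+
      have "(LBINT s. s ^ (d - 1) * J 0 * f s) + \<sigma> * (LBINT s. s ^ (d - 1) * J s * f s)
         = (LBINT s. s ^ (d - 1) * J 0 * f s + \<sigma> * (s ^ (d - 1) * J s * f s))"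
        using i by simp
      thus ?thesis by (simp add: g_def algebra_simps)
    qed
    finally have "0 \<le> (LBINT s. g s * f s)" by (simp add: zero_le_mult_iff)
    also have "(LBINT s. g s * f s) \<le> (LBINT s. g t / 2 * f s)"
      using g_less by (intro integral_mono f_int contg continuous_intros)
         (auto simp: f_def split: split_indicator)
    also have "\<dots> = g t / 2 * (2 * \<delta>)"
      using \<delta> by (simp add: f_def)
    also have "\<dots> < 0" using gt \<delta> by (simp add: mult_neg_pos)
    finally show False by simp
  qed
  show ?thesis
  proof (cases "s = 0")
    case True
    thus ?thesis using J0 by (simp add: J_def)
  next
    case False
    thus ?thesis using main[of 1 s] main[of "-1" s] s by (auto simp: J_def abs_if)
  qed
qed

text \<open>The uniform bound on the Bessel quotient allows passage to the limit in truncations of \<open>f\<close>.\<close>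

lemma radial_cos_integral:
  fixes x :: "'a::euclidean_space" and f :: "real \<Rightarrow> real"
  assumes [measurable]: "f \<in> borel_measurable borel"
    and int: "integrable lborel (\<lambda>k::'a. f (norm k))"
  shows "(LBINT k. cos (x \<bullet> k) * f (norm k)) = (2 * pi) powr (DIM('a) / 2) *
     (LBINT s:{0<..}. s ^ (DIM('a) - 1) * bessel_J_quot (DIM('a) / 2 - 1) (norm x * s) * f s)"
proof (rule LIMSEQ_unique)
  define d where "d = DIM('a)"
  have d: "d > 0" by (simp add: d_def)
  define J where "J = (\<lambda>s. indicator {0<..} s * bessel_J_quot (real d / 2 - 1) (norm x * s))"
  have [measurable]: "J \<in> borel_measurable borel"
    unfolding J_def by (rule bessel_J_quot_measurable[OF d]) simp
  have J_le: "\<bar>J s\<bar> \<le> bessel_J_quot (real d / 2 - 1) 0" for s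
    using bessel_J_quot_bound[where 'a='a, OF d_def[symmetric], of "norm x * s"] bessel_J_quot_0_pos[OF d]
    by (auto simp: J_def split: split_indicator)
  define h where "h = (\<lambda>s. indicator {0<..} s * s ^ (d - 1) * f s :: real)"
  have [measurable]: "h \<in> borel_measurable borel" unfolding h_def by measurable
  have h_int: "integrable lborel h"
    using int unfolding radial_integrable[OF assms(1)] 
    by (simp add: set_integrable_def h_def[abs_def] d_def mult.assoc)
  define F where "F = (\<lambda>(i::nat) s. f s * indicator {..real i} s)"
  have [measurable]: "F i \<in> borel_measurable borel" for i unfolding F_def by measurable
  have lim: "(\<lambda>i. F i s) \<longlonglongrightarrow> f s" for s
  proof (rule tendsto_eventually)
    obtain n where "s \<le> real n" using real_arch_simple by blast
    thus "\<forall>\<^sub>F i in sequentially. F i s = f s"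
      by (intro eventually_sequentiallyI[of n]) (auto simp: F_def)
  qed
  have F_le: "\<bar>F i s\<bar> \<le> \<bar>f s\<bar>" for i s by (auto simp: F_def split: split_indicator)
  have F_int: "integrable lborel (\<lambda>k::'a. F i (norm k))" for i
    by (rule Bochner_Integration.integrable_bound[OF int]) (use F_le in auto)
  show "(\<lambda>i. LBINT k. cos (x \<bullet> k) * F i (norm k)) \<longlonglongrightarrow> (LBINT k. cos (x \<bullet> k) * f (norm k))"
  proof (rule integral_dominated_convergence[where w="\<lambda>k. \<bar>f (norm k)\<bar>"])
    show "AE k in lborel. norm (cos (x \<bullet> k) * F i (norm k)) \<le> \<bar>f (norm k)\<bar>" for i
    proof (rule AE_I2)
      fix k
      show "norm (cos (x \<bullet> k) * F i (norm k)) \<le> \<bar>f (norm k)\<bar>"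
        using mult_mono[OF abs_cos_le_one[of "x \<bullet> k"] F_le[of i "norm k"]] by (simp add: abs_mult)
    qed
  qed (use int in \<open>auto intro!: tendsto_intros lim\<close>)
  have "(\<lambda>i. LBINT s. h s * J s * indicator {..real i} s) \<longlonglongrightarrow> (LBINT s. h s * J s)"
  proof (rule integral_dominated_convergence[where w="\<lambda>s. \<bar>h s\<bar> * bessel_J_quot (real d / 2 - 1) 0"])
    show "AE s in lborel. (\<lambda>i. h s * J s * indicator {..real i} s) \<longlonglongrightarrow> h s * J s"
    proof (intro AE_I2 tendsto_eventually)
      fix s
      obtain n where "s \<le> real n" using real_arch_simple by blast
      thus "\<forall>\<^sub>F i in sequentially. h s * J s * indicator {..real i} s = h s * J s"
        by (intro eventually_sequentiallyI[of n]) auto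
    qed
    show "AE s in lborel. norm (h s * J s * indicator {..real i} s) \<le> \<bar>h s\<bar> * bessel_J_quot (real d / 2 - 1) 0" for i
      using J_le bessel_J_quot_0_pos[OF d]
      by (auto intro!: AE_I2 mult_left_mono split: split_indicator simp: abs_mult)
  qed (use h_int in auto)
  moreover have "(LBINT s:{0<..}. s ^ (d - 1) * bessel_J_quot (d / 2 - 1) (norm x * s) * F i s) = (LBINT s. h s * J s * indicator {..real i} s)" for i
    unfolding set_lebesgue_integral_def
    by (intro Bochner_Integration.integral_cong) (auto simp: h_def J_def F_def split: split_indicator)
  moreover have "(LBINT s:{0<..}. s ^ (d - 1) * bessel_J_quot (d / 2 - 1) (norm x * s) * f s) = (LBINT s. h s * J s)"
    unfolding set_lebesgue_integral_def
    by (intro Bochner_Integration.integral_cong) (auto simp: h_def J_def split: split_indicator)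
  moreover have "(LBINT k. cos (x \<bullet> k) * F i (norm k)) = (2 * pi) powr (d / 2) *
     (LBINT s:{0<..}. s ^ (d - 1) * bessel_J_quot (d / 2 - 1) (norm x * s) * F i s)" for i
    unfolding d_def by (rule radial_cos_integral_bounded_support[where R="real i"])
      (use F_int[of i] in \<open>auto simp: F_def\<close>)
  ultimately show "(\<lambda>i. LBINT k. cos (x \<bullet> k) * F i (norm k)) \<longlonglongrightarrow> (2 * pi) powr (DIM('a) / 2) *
     (LBINT s:{0<..}. s ^ (DIM('a) - 1) * bessel_J_quot (DIM('a) / 2 - 1) (norm x * s) * f s)"
    by (auto simp: d_def intro!: tendsto_intros)
qed

section \<open>Schwartz functions and functions flat at the origin\<close>

lemma monomial_Nil [simp]: "monomial [] x = 1"
  and monomial_Cons [simp]: "monomial (i # ms) x = x $ i * monomial ms x"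
  by (simp_all add: monomial_def)

lemma partials_Nil [simp]: "partials [] f = f"
  and partials_Cons [simp]: "partials (i # js) f = partial i (partials js f)"
  and partials_append: "partials (js @ js') f = partials js (partials js' f)"
  by (simp_all add: partials_def)

lemma abs_monomial_le: "\<bar>monomial ms x\<bar> \<le> norm x ^ length ms"
proof (induction ms)
  case (Cons i ms)
  have "\<bar>x $ i\<bar> * \<bar>monomial ms x\<bar> \<le> norm x * norm x ^ length ms"
    using Cons by (intro mult_mono) (auto simp: component_le_norm_cart)
  thus ?case by (simp add: abs_mult)
qed simp

text \<open>Partial derivatives are defined along coordinate lines, the Schwartz space by
  Frechet differentiability; this connects the two.\<close>

lemma partial_has_derivative:
  assumes "(f has_derivative f') (at x)"
  shows "partial i f x = f' (axis i 1)"
proof -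
  have "((\<lambda>t. x + t *\<^sub>R axis i 1) has_derivative (\<lambda>t. t *\<^sub>R axis i 1)) (at (0::real))"
    by (auto intro!: derivative_eq_intros)
  moreover have "(f has_derivative f') (at (x + 0 *\<^sub>R axis i 1))" using assms by simp
  ultimately have "((\<lambda>t. f (x + t *\<^sub>R axis i 1)) has_derivative (\<lambda>t. f' (t *\<^sub>R axis i 1))) (at (0::real))"
    by (rule has_derivative_compose)
  moreover have "f' (t *\<^sub>R axis i 1) = t *\<^sub>R f' (axis i 1)" for t
    using assms by (simp add: has_derivative_def bounded_linear.linear linear_cmul)
  ultimately have "((\<lambda>t. f (x + t *\<^sub>R axis i 1)) has_vector_derivative f' (axis i 1)) (at 0)"
    by (simp add: has_vector_derivative_def)
  thus ?thesis unfolding partial_def by (rule vector_derivative_at)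
qed

lemma has_derivative_partial:
  fixes f :: "real^'d::finite \<Rightarrow> complex"
  assumes "f differentiable (at x)"
  shows "(f has_derivative (\<lambda>h. \<Sum>i\<in>UNIV. h $ i *\<^sub>R partial i f x)) (at x)"
proof -
  obtain f' where f': "(f has_derivative f') (at x)" using assms by (auto simp: differentiable_def)
  have lin: "linear f'" using f' by (simp add: has_derivative_def bounded_linear.linear)
  have "f' h = (\<Sum>i\<in>UNIV. h $ i *\<^sub>R partial i f x)" for h
  proof -
    have "f' h = f' (\<Sum>i\<in>UNIV. h $ i *\<^sub>R axis i 1)"
      using basis_expansion[of h] by (simp add: scalar_mult_eq_scaleR)
    thus ?thesis
      by (simp add: linear_sum[OF lin] linear_cmul[OF lin] partial_has_derivative[OF f'])
  qed
  with f' show ?thesis by (metis (no_types, lifting) ext)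
qed

lemma sum_axis_scaleR:
  fixes c :: "'d::finite \<Rightarrow> 'a::real_vector"
  shows "(\<Sum>i\<in>UNIV. axis j (1::real) $ i *\<^sub>R c i) = c j"
proof -
  have "axis j (1::real) $ i *\<^sub>R c i = (if i = j then c i else 0)" for i
    by (simp add: axis_def)
  thus ?thesis by simp
qed

lemma schwartzD:
  assumes "f \<in> schwartz"
  shows "f differentiable (at x)" "partial i f \<in> schwartz" "bounded (range (\<lambda>x. monomial ms x *\<^sub>R f x))"
proof -
  show "f differentiable (at x)"
    using assms by (auto simp: schwartz_def smooth_def dest: spec[of _ "[]"])
  have "partials js (partial i f) = partials (js @ [i]) f" for js
    by (simp add: partials_append)
  thus "partial i f \<in> schwartz" using assms by (simp add: schwartz_def smooth_def)
  show "bounded (range (\<lambda>x. monomial ms x *\<^sub>R f x))"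
    using assms by (force simp: schwartz_def dest: spec[of _ "[]"])
qed

text \<open>Membership in the Schwartz space is a statement about all iterated derivatives. For a class of
  functions that is closed under partial derivatives, it is enough to look at the functions
  themselves.\<close>

lemma schwartz_coinduct:
  assumes f: "f \<in> X"
    and diff: "\<And>f x. f \<in> X \<Longrightarrow> f differentiable (at x)"
    and part: "\<And>f i. f \<in> X \<Longrightarrow> partial i f \<in> X"
    and bdd: "\<And>f ms. f \<in> X \<Longrightarrow> bounded (range (\<lambda>x. monomial ms x *\<^sub>R f x))"
  shows "f \<in> schwartz"
proof -
  have "partials js f \<in> X" for js by (induction js) (auto simp: f part)
  thus ?thesis using diff bdd by (auto simp: schwartz_def smooth_def)
qed

lemma Psi_coinduct:
  assumes f: "f \<in> X"
    and "\<And>f x. f \<in> X \<Longrightarrow> f differentiable (at x)"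
    and part: "\<And>f i. f \<in> X \<Longrightarrow> partial i f \<in> X"
    and "\<And>f ms. f \<in> X \<Longrightarrow> bounded (range (\<lambda>x. monomial ms x *\<^sub>R f x))"
    and zero: "\<And>f. f \<in> X \<Longrightarrow> f 0 = 0"
  shows "f \<in> Psi_space"
proof -
  have "partials js f \<in> X" for js by (induction js) (auto simp: f part)
  thus ?thesis using zero schwartz_coinduct[OF assms(1-4)] by (auto simp: Psi_space_def)
qed

lemma PsiD:
  assumes "f \<in> Psi_space"
  shows "f \<in> schwartz" "partial i f \<in> Psi_space" "f 0 = 0"
proof -
  show f: "f \<in> schwartz" using assms by (simp add: Psi_space_def)
  have "partials js (partial i f) = partials (js @ [i]) f" for js
    by (simp add: partials_append)
  thus "partial i f \<in> Psi_space" using assms schwartzD(2)[OF f] by (simp add: Psi_space_def)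
  show "f 0 = 0" using assms by (auto simp: Psi_space_def dest: spec[of _ "[]"])
qed

text \<open>The module over the polynomials that is generated by \<open>B\<close>. By the product rule it is closed under
  partial derivatives as soon as it contains those of the elements of \<open>B\<close>. If moreover the elements
  of \<open>B\<close> are differentiable and bounded against monomials, then so are all others, and the module
  satisfies the hypotheses of \<open>schwartz_coinduct\<close>.\<close>

inductive_set poly_span :: "(real^'d::finite \<Rightarrow> complex) set \<Rightarrow> (real^'d \<Rightarrow> complex) set"
  for B where
  base: "f \<in> B \<Longrightarrow> f \<in> poly_span B"
| add: "f \<in> poly_span B \<Longrightarrow> g \<in> poly_span B \<Longrightarrow> (\<lambda>x. f x + g x) \<in> poly_span B"
| scale: "f \<in> poly_span B \<Longrightarrow> (\<lambda>x. c * f x) \<in> poly_span B"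
| coord: "f \<in> poly_span B \<Longrightarrow> (\<lambda>x. x $ i *\<^sub>R f x) \<in> poly_span B"

lemma poly_span_regular:
  fixes B :: "(real^'d::finite \<Rightarrow> complex) set"
  assumes diff: "\<And>f x. f \<in> B \<Longrightarrow> f differentiable (at x)"
    and part: "\<And>f i. f \<in> B \<Longrightarrow> partial i f \<in> poly_span B"
    and bdd: "\<And>f ms. f \<in> B \<Longrightarrow> bounded (range (\<lambda>x. monomial ms x *\<^sub>R f x))"
    and "f \<in> poly_span B"
  shows "(\<forall>x. f differentiable (at x)) \<and> (\<forall>i. partial i f \<in> poly_span B) \<and>
    (\<forall>ms. bounded (range (\<lambda>x. monomial ms x *\<^sub>R f x)))"
  using assms(4)
proof induction
  case (base f)
  then show ?case using diff part bdd by blast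
next
  case (add f g)
  have "partial i (\<lambda>x. f x + g x) = (\<lambda>x. partial i f x + partial i g x)" for i
  proof
    fix x
    show "partial i (\<lambda>x. f x + g x) x = partial i f x + partial i g x"
      using add.IH
      by (subst partial_has_derivative[OF has_derivative_add[OF has_derivative_partial has_derivative_partial]])
        (auto simp: sum_axis_scaleR)
  qed
  moreover have "bounded (range (\<lambda>x. monomial ms x *\<^sub>R (f x + g x)))" for ms
    using add.IH bounded_plus_comp[of "\<lambda>x. monomial ms x *\<^sub>R f x" UNIV "\<lambda>x. monomial ms x *\<^sub>R g x"]
    by (simp add: scaleR_add_right)
  ultimately show ?case using add.IH by (auto intro: poly_span.add)
next
  case (scale f c)
  have "partial i (\<lambda>x. c * f x) = (\<lambda>x. c * partial i f x)" for i
  proof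
    fix x
    show "partial i (\<lambda>x. c * f x) x = c * partial i f x"
      using scale.IH
      by (subst partial_has_derivative[OF has_derivative_mult_right[OF has_derivative_partial]])
        (auto simp: sum_axis_scaleR)
  qed
  moreover have "bounded (range (\<lambda>x. monomial ms x *\<^sub>R (c * f x)))" for ms
  proof -
    obtain K where "\<And>x. norm (monomial ms x *\<^sub>R f x) \<le> K"
      using scale.IH[THEN conjunct2, THEN conjunct2, THEN spec, of ms] unfolding bounded_iff by auto
    hence "norm (monomial ms x *\<^sub>R (c * f x)) \<le> norm c * K" for x
      using mult_left_mono[of "norm (monomial ms x *\<^sub>R f x)" K "norm c"] by (simp add: norm_mult mult_ac)
    thus ?thesis by (auto simp: bounded_iff)
  qed
  ultimately show ?case using scale.IH by (auto intro: poly_span.scale)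
next
  case (coord f i)
  have "partial j (\<lambda>x. x $ i *\<^sub>R f x) = (\<lambda>x. (if i = j then 1 else 0) * f x + x $ i *\<^sub>R partial j f x)" for j
  proof
    fix x :: "real^'d"
    have "((\<lambda>x. x $ i) has_derivative (\<lambda>h. h $ i)) (at x)"
      by (intro bounded_linear_imp_has_derivative bounded_linear_vec_nth)
    from has_derivative_scaleR[OF this has_derivative_partial]
    have "((\<lambda>x. x $ i *\<^sub>R f x) has_derivative (\<lambda>h. x $ i *\<^sub>R (\<Sum>j\<in>UNIV. h $ j *\<^sub>R partial j f x) + h $ i *\<^sub>R f x)) (at x)"
      using coord.IH by blast
    thus "partial j (\<lambda>x. x $ i *\<^sub>R f x) x = (if i = j then 1 else 0) * f x + x $ i *\<^sub>R partial j f x"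
      by (subst partial_has_derivative, assumption)
        (auto simp: sum_axis_scaleR, auto simp: axis_def)
  qed
  moreover have "bounded (range (\<lambda>x. monomial ms x *\<^sub>R (x $ i *\<^sub>R f x)))" for ms
    using coord.IH[THEN conjunct2, THEN conjunct2, rule_format, of "i # ms"] by (simp add: mult.commute)
  moreover have "(\<lambda>x. x $ i *\<^sub>R f x) differentiable (at x)" for x
    using coord.IH by (intro differentiable_scaleR) 
      (auto intro!: bounded_linear_imp_differentiable bounded_linear_vec_nth)
  moreover have "(\<lambda>x. (if i = j then 1 else 0) * f x + x $ i *\<^sub>R partial j f x) \<in> poly_span B" for j
    using coord by (intro poly_span.add poly_span.scale poly_span.coord) auto
  ultimately show ?case by presburger
qed

lemma poly_span_schwartz:
  assumes "\<And>f x. f \<in> B \<Longrightarrow> f differentiable (at x)"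
    and "\<And>f i. f \<in> B \<Longrightarrow> partial i f \<in> poly_span B"
    and "\<And>f ms. f \<in> B \<Longrightarrow> bounded (range (\<lambda>x. monomial ms x *\<^sub>R f x))"
    and "f \<in> poly_span B"
  shows "f \<in> schwartz"
  by (rule schwartz_coinduct[where X="poly_span B"]) (use poly_span_regular[OF assms(1-3)] assms(4) in auto)

lemma poly_span_Psi:
  assumes "\<And>f x. f \<in> B \<Longrightarrow> f differentiable (at x)"
    and "\<And>f i. f \<in> B \<Longrightarrow> partial i f \<in> poly_span B"
    and "\<And>f ms. f \<in> B \<Longrightarrow> bounded (range (\<lambda>x. monomial ms x *\<^sub>R f x))"
    and zero: "\<And>f. f \<in> B \<Longrightarrow> f 0 = 0"
    and "f \<in> poly_span B"
  shows "f \<in> Psi_space"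
proof (rule Psi_coinduct[where X="poly_span B"])
  show "f 0 = 0" if "f \<in> poly_span B" for f
    using that by induction (auto simp: zero)
qed (use poly_span_regular[OF assms(1-3)] assms(5) in auto)

lemma poly_span_schwartz_self: "f \<in> poly_span schwartz \<Longrightarrow> f \<in> schwartz"
  by (rule poly_span_schwartz[where B=schwartz]) (auto intro: schwartzD poly_span.base)

lemma schwartz_scale: "f \<in> schwartz \<Longrightarrow> (\<lambda>x. c * f x) \<in> schwartz"
  and schwartz_add: "f \<in> schwartz \<Longrightarrow> g \<in> schwartz \<Longrightarrow> (\<lambda>x. f x + g x) \<in> schwartz"
  and schwartz_coord: "f \<in> schwartz \<Longrightarrow> (\<lambda>x. x $ i *\<^sub>R f x) \<in> schwartz"
  by (rule poly_span_schwartz_self, intro poly_span.intros, assumption+)+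

lemma schwartz_monomial: "f \<in> schwartz \<Longrightarrow> (\<lambda>x. monomial ms x *\<^sub>R f x) \<in> schwartz"
proof (induction ms)
  case (Cons i ms)
  from schwartz_coord[OF Cons.IH[OF Cons.prems], of i] show ?case by simp
qed simp

lemma partial_reflect:
  assumes "f differentiable (at (- x))"
  shows "partial i (\<lambda>x. f (- x)) x = - partial i f (- x)"
proof -
  have "((\<lambda>x. - x) has_derivative (\<lambda>h. - h)) (at x)" by (auto intro!: derivative_eq_intros)
  from has_derivative_compose[OF this has_derivative_partial[OF assms]]
  show ?thesis
    by (subst partial_has_derivative, assumption)
      (simp add: sum_axis_scaleR sum_negf)
qed

lemma differentiable_reflect:
  fixes f :: "'a::real_normed_vector \<Rightarrow> 'b::real_normed_vector"
  assumes "\<And>x. f differentiable (at x)"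
  shows "(\<lambda>x. f (- x)) differentiable (at x)"
  using differentiable_chain_at[of uminus x f] assms by (simp add: o_def)

lemma monomial_uminus: "monomial ms (- x) = (-1) ^ length ms * monomial ms x"
  by (induction ms) auto

lemma bounded_reflect:
  fixes f :: "real^'d::finite \<Rightarrow> complex"
  assumes "bounded (range (\<lambda>x. monomial ms x *\<^sub>R f x))"
  shows "bounded (range (\<lambda>x. monomial ms x *\<^sub>R f (- x)))"
proof -
  obtain K where K: "\<And>x. norm (monomial ms x *\<^sub>R f x) \<le> K"
    using assms by (auto simp: bounded_iff)
  have "norm (monomial ms x *\<^sub>R f (- x)) \<le> K" for x
    using K[of "- x"] by (simp add: monomial_uminus abs_mult)
  thus ?thesis by (auto simp: bounded_iff)
qed

lemma Psi_reflect: "f \<in> Psi_space \<Longrightarrow> (\<lambda>x. f (- x)) \<in> Psi_space"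
proof (rule poly_span_Psi[where B="{\<lambda>x. g (- x) |g. g \<in> Psi_space}"])
  fix f i ms assume "f \<in> {\<lambda>x. g (- x) |g. g \<in> Psi_space}"
  then obtain g where g: "f = (\<lambda>x. g (- x))" "g \<in> Psi_space" by blast
  show "f differentiable (at x)" for x
    unfolding g by (rule differentiable_reflect, rule schwartzD(1), rule PsiD(1), rule g)
  have "partial i f = (\<lambda>x. -1 * (\<lambda>x. partial i g (- x)) x)"
    unfolding g by (intro ext, subst partial_reflect) (simp_all add: schwartzD(1)[OF PsiD(1)[OF g(2)]])
  moreover have "\<dots> \<in> poly_span {\<lambda>x. g (- x) |g. g \<in> Psi_space}"
    using PsiD(2)[OF g(2), of i] by (intro poly_span.scale poly_span.base) blast
  ultimately show "partial i f \<in> poly_span {\<lambda>x. g (- x) |g. g \<in> Psi_space}" by simp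
  show "bounded (range (\<lambda>x. monomial ms x *\<^sub>R f x))"
    unfolding g by (rule bounded_reflect, rule schwartzD(3), rule PsiD(1), rule g)
  show "f 0 = 0" using g PsiD(3)[OF g(2)] by simp
qed (auto intro: poly_span.base)

text \<open>In absolute value the largest coordinate is at least \<open>|x| / d\<close>, so finitely many monomials control a power of the
  norm. The Schwartz seminorms see only monomials.\<close>

lemma norm_power_le_coords:
  fixes x :: "real^'d::finite"
  shows "norm x ^ N \<le> real CARD('d) ^ N * (\<Sum>i\<in>UNIV. \<bar>monomial (replicate N i) x\<bar>)"
proof -
  obtain i where i: "\<And>j. \<bar>x $ j\<bar> \<le> \<bar>x $ i\<bar>"
  proof -
    have "Max (range (\<lambda>j. \<bar>x $ j\<bar>)) \<in> range (\<lambda>j. \<bar>x $ j\<bar>)" by (rule Max_in) auto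
    then obtain i where "Max (range (\<lambda>j. \<bar>x $ j\<bar>)) = \<bar>x $ i\<bar>" "i \<in> UNIV" by (rule imageE)
    thus ?thesis using that by (metis Max_ge finite finite_imageI rangeI)
  qed
  have mon: "monomial (replicate N i) x = (x $ i) ^ N" for i
    by (induction N) auto
  have "norm x \<le> (\<Sum>j\<in>UNIV. \<bar>x $ j\<bar>)" by (rule norm_le_l1_cart)
  also have "\<dots> \<le> (\<Sum>j\<in>(UNIV::'d set). \<bar>x $ i\<bar>)" using i by (intro sum_mono) auto
  finally have "norm x \<le> real CARD('d) * \<bar>x $ i\<bar>" by simp
  hence "norm x ^ N \<le> (real CARD('d) * \<bar>x $ i\<bar>) ^ N" by (intro power_mono) auto
  also have "\<dots> = real CARD('d) ^ N * \<bar>monomial (replicate N i) x\<bar>"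
    by (simp add: power_mult_distrib mon power_abs)
  also have "\<dots> \<le> real CARD('d) ^ N * (\<Sum>i\<in>UNIV. \<bar>monomial (replicate N i) x\<bar>)"
    by (intro mult_left_mono member_le_sum) auto
  finally show ?thesis .
qed

lemma schwartz_seminorm_ge:
  assumes "f \<in> schwartz"
  shows "norm (monomial ms x *\<^sub>R f x) \<le> schwartz_seminorm ms [] f"
proof -
  have "bounded (range (\<lambda>x. monomial ms x *\<^sub>R f x))" by (rule schwartzD(3)[OF assms])
  hence "bdd_above (range (\<lambda>x. norm (monomial ms x *\<^sub>R f x)))"
    by (auto simp: bounded_iff bdd_above_def)
  thus ?thesis unfolding schwartz_seminorm_def partials_Nil by (intro cSUP_upper) auto
qed

lemma schwartz_weight_le:
  fixes f :: "real^'d::finite \<Rightarrow> complex"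
  assumes "f \<in> schwartz"
  shows "norm x ^ N * norm (f x) \<le> real CARD('d) ^ N * (\<Sum>i\<in>UNIV. schwartz_seminorm (replicate N i) [] f)"
proof -
  have "norm x ^ N * norm (f x) \<le> (real CARD('d) ^ N * (\<Sum>i\<in>UNIV. \<bar>monomial (replicate N i) x\<bar>)) * norm (f x)"
    by (intro mult_right_mono norm_power_le_coords) auto
  also have "\<dots> = real CARD('d) ^ N * (\<Sum>i\<in>UNIV. norm (monomial (replicate N i) x *\<^sub>R f x))"
    by (simp add: sum_distrib_right mult.assoc)
  also have "\<dots> \<le> real CARD('d) ^ N * (\<Sum>i\<in>UNIV. schwartz_seminorm (replicate N i) [] f)"
    by (intro mult_left_mono sum_mono schwartz_seminorm_ge assms) auto
  finally show ?thesis .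
qed

lemma schwartz_decay:
  assumes "f \<in> schwartz"
  obtains C where "C \<ge> 0" "\<And>x. norm x ^ N * norm (f x) \<le> C"
proof -
  let ?C = "real CARD('a) ^ N * (\<Sum>i\<in>UNIV. schwartz_seminorm (replicate N i) [] f)"
  have "0 \<le> norm (0::real^'a) ^ N * norm (f 0)" by simp
  also have "\<dots> \<le> ?C" by (rule schwartz_weight_le[OF assms])
  finally show ?thesis using that[of ?C] schwartz_weight_le[OF assms] by blast
qed

text \<open>The derivatives of \<open>f\<close> are again flat at the origin, so the mean value inequality on the ball of
  radius \<open>|x|\<close> gains one power of \<open>|x|\<close> in each step.\<close>

lemma Psi_flat:
  fixes f :: "real^'d::finite \<Rightarrow> complex"
  assumes "f \<in> Psi_space"
  shows "\<exists>C\<ge>0. \<forall>x. norm (f x) \<le> C * norm x ^ N"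
  using assms
proof (induction N arbitrary: f)
  case 0
  obtain C where "C \<ge> 0" "\<And>x. norm x ^ 0 * norm (f x) \<le> C"
    using schwartz_decay[OF PsiD(1)[OF 0]] by blast
  thus ?case by auto
next
  case (Suc N)
  have "\<forall>i. \<exists>C\<ge>0. \<forall>x. norm (partial i f x) \<le> C * norm x ^ N"
    using Suc.IH[OF PsiD(2)[OF Suc.prems]] by blast
  then obtain C where C: "\<And>i. C i \<ge> 0" "\<And>i x. norm (partial i f x) \<le> C i * norm x ^ N" by metis
  have "norm (f x) \<le> (\<Sum>i\<in>UNIV. C i) * norm x ^ Suc N" for x
  proof -
    have "norm (f x - f 0) \<le> ((\<Sum>i\<in>UNIV. C i) * norm x ^ N) * norm (x - 0)"
    proof (rule differentiable_bound)
      show "convex (cball (0::real^'d) (norm x))" by (rule convex_cball)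
      fix y :: "real^'d" assume y: "y \<in> cball 0 (norm x)"
      show "(f has_derivative (\<lambda>h. \<Sum>i\<in>UNIV. h $ i *\<^sub>R partial i f y)) (at y within cball 0 (norm x))"
        by (rule has_derivative_at_withinI, rule has_derivative_partial, rule schwartzD(1), rule PsiD(1), rule Suc.prems)
      show "onorm (\<lambda>h. \<Sum>i\<in>UNIV. h $ i *\<^sub>R partial i f y) \<le> (\<Sum>i\<in>UNIV. C i) * norm x ^ N"
      proof (rule onorm_le)
        fix h :: "real^'d"
        have "norm (\<Sum>i\<in>UNIV. h $ i *\<^sub>R partial i f y) \<le> (\<Sum>i\<in>UNIV. norm (h $ i *\<^sub>R partial i f y))"
          by (rule norm_sum)
        also have "\<dots> \<le> (\<Sum>i\<in>UNIV. norm h * (C i * norm x ^ N))"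
        proof (intro sum_mono)
          fix i
          have "norm (partial i f y) \<le> C i * norm y ^ N" by (rule C(2))
          also have "\<dots> \<le> C i * norm x ^ N" using y by (intro mult_left_mono power_mono C) auto
          finally show "norm (h $ i *\<^sub>R partial i f y) \<le> norm h * (C i * norm x ^ N)"
            by (auto intro!: mult_mono simp: component_le_norm_cart C(1))
        qed
        finally show "norm (\<Sum>i\<in>UNIV. h $ i *\<^sub>R partial i f y) \<le> (\<Sum>i\<in>UNIV. C i) * norm x ^ N * norm h"
          by (simp add: sum_distrib_left sum_distrib_right mult_ac)
      qed
    qed auto
    thus ?thesis by (simp add: PsiD(3)[OF Suc.prems] mult_ac)
  qed
  thus ?case using C(1) by (intro exI[of _ "\<Sum>i\<in>UNIV. C i"]) (auto intro: sum_nonneg)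
qed

lemma norm_powr_has_derivative:
  fixes x :: "'a::real_inner"
  assumes x: "x \<noteq> 0"
  shows "((\<lambda>k. norm k powr s) has_derivative (\<lambda>h. s * norm x powr (s - 2) * (x \<bullet> h))) (at x)"
proof -
  have eq: "(\<lambda>k::'a. norm k powr s) = (\<lambda>k. (k \<bullet> k) powr (s / 2))"
  proof
    fix k :: 'a
    have "norm k powr s = (norm k)\<^sup>2 powr (s / 2)"
      by (cases "k = 0") (simp_all add: powr_powr flip: powr_numeral)
    thus "norm k powr s = (k \<bullet> k) powr (s / 2)"
      by (simp add: power2_norm_eq_inner[symmetric])
  qed
  have "((\<lambda>k. (k \<bullet> k) powr (s / 2)) has_derivative
      (\<lambda>h. (x \<bullet> x) powr (s / 2) * (0 * ln (x \<bullet> x) + (x \<bullet> h + h \<bullet> x) * (s / 2) / (x \<bullet> x)))) (at x)"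
    using x by (intro has_derivative_powr) (auto intro!: derivative_eq_intros)
  moreover have "(x \<bullet> x) powr (s / 2) * (0 * ln (x \<bullet> x) + (x \<bullet> h + h \<bullet> x) * (s / 2) / (x \<bullet> x))
      = s * norm x powr (s - 2) * (x \<bullet> h)" for h
  proof -
    have "norm x powr (s - 2) = norm x powr s / (x \<bullet> x)"
      using x by (simp add: powr_diff power2_norm_eq_inner)
    moreover have "(x \<bullet> x) powr (s / 2) = norm x powr s" using eq by metis
    ultimately show ?thesis by (simp add: inner_commute)
  qed
  ultimately show ?thesis unfolding eq by simp
qed

text \<open>Flatness controls negative powers near the origin, rapid decay controls positive powers at
  infinity.\<close>

lemma Psi_norm_powr_bounded:
  assumes f: "f \<in> Psi_space"
  obtains C where "C \<ge> 0" "\<And>x. norm x powr s * norm (f x) \<le> C"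
proof -
  \<comment> \<open>One natural exponent that dominates both \<open>s\<close> and \<open>-s\<close>.\<close>
  define N where "N = nat \<lceil>\<bar>s\<bar>\<rceil>"
  have N: "real N \<ge> \<bar>s\<bar>" by (simp add: N_def)
  obtain C1 where C1: "C1 \<ge> 0" "\<And>x. norm (f x) \<le> C1 * norm x ^ N" using Psi_flat[OF f] by metis
  obtain C2 where C2: "C2 \<ge> 0" "\<And>x. norm x ^ N * norm (f x) \<le> C2"
    using schwartz_decay[OF PsiD(1)[OF f]] by metis
  have "norm x powr s * norm (f x) \<le> C1 + C2" for x
  proof (cases "x = 0")
    case False
    hence x: "norm x > 0" by simp
    show ?thesis
    proof (cases "norm x \<le> 1")
      case True
      have "norm x powr s * norm (f x) \<le> norm x powr s * (C1 * norm x ^ N)"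
        by (intro mult_left_mono C1) auto
      also have "\<dots> = C1 * norm x powr (s + N)" using x by (simp add: powr_add powr_realpow)
      also have "\<dots> \<le> C1 * 1" using x True N by (intro mult_left_mono powr_le1 C1) auto
      finally show ?thesis using C2(1) by simp
    next
      case False
      have "norm x powr s * norm (f x) \<le> norm x powr N * norm (f x)"
        using False N by (intro mult_right_mono powr_mono) auto
      also have "\<dots> = norm x ^ N * norm (f x)" using x by (simp add: powr_realpow)
      finally show ?thesis using C2(2)[of x] C1(1) by simp
    qed
  qed (use C1(1) C2(1) in simp)
  thus ?thesis using that[of "C1 + C2"] C1(1) C2(1) by auto
qed

text \<open>At the origin the product is of second order in \<open>|k|\<close>, so that its derivative vanishes there;
  elsewhere this is the product rule.\<close>

lemma Psi_norm_powr_derivative: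
  fixes f :: "real^'d::finite \<Rightarrow> complex"
  assumes f: "f \<in> Psi_space"
  shows "((\<lambda>k. norm k powr s *\<^sub>R f k) has_derivative
     (\<lambda>h. norm x powr s *\<^sub>R (\<Sum>i\<in>UNIV. h $ i *\<^sub>R partial i f x) + (s * norm x powr (s - 2) * (x \<bullet> h)) *\<^sub>R f x)) (at x)"
proof (cases "x = 0")
  case False
  from has_derivative_scaleR[OF norm_powr_has_derivative[OF False] has_derivative_partial[OF schwartzD(1)[OF PsiD(1)[OF f]]]]
  show ?thesis .
next
  case True
  obtain C where C: "C \<ge> 0" "\<And>x. norm x powr (s - 2) * norm (f x) \<le> C"
    using Psi_norm_powr_bounded[OF f] by metis
  have bound: "norm (norm k powr s *\<^sub>R f k) / norm k \<le> C * norm k" for k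
  proof (cases "k = 0")
    case False
    have "norm (norm k powr s *\<^sub>R f k) = norm k * norm k * (norm k powr (s - 2) * norm (f k))"
      using False by (simp add: powr_diff power2_eq_square)
    also have "\<dots> \<le> norm k * norm k * C" by (intro mult_left_mono C) auto
    finally show ?thesis using False by (simp add: field_simps)
  qed simp
  have "((\<lambda>k. norm (norm k powr s *\<^sub>R f k) / norm k) \<longlongrightarrow> 0) (at 0)"
  proof (rule Lim_null_comparison)
    show "((\<lambda>k::real^'d. C * norm k) \<longlongrightarrow> 0) (at 0)"
      by (auto intro!: tendsto_eq_intros)
    show "\<forall>\<^sub>F k in at 0. norm (norm (norm k powr s *\<^sub>R f k) / norm k) \<le> C * norm k"
      using bound by (auto intro!: always_eventually)
  qed
  hence "((\<lambda>k. norm k powr s *\<^sub>R f k) has_derivative (\<lambda>h. 0)) (at 0)"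
    by (simp add: has_derivative_at PsiD(3)[OF f])
  thus ?thesis using True by (simp add: PsiD(3)[OF f])
qed

text \<open>A derivative of \<open>|k|^s g\<close> is a combination of \<open>|k|^s \<partial>_i g\<close> and \<open>k_i |k|^(s-2) g\<close>. Such products, with all
  real exponents at once, therefore generate a module that is closed under partial derivatives.\<close>

lemma Psi_norm_powr:
  fixes f :: "real^'d::finite \<Rightarrow> complex"
  assumes "f \<in> Psi_space"
  shows "(\<lambda>k. norm k powr s *\<^sub>R f k) \<in> Psi_space"
proof -
  define B :: "(real^'d \<Rightarrow> complex) set" where "B = {\<lambda>k. norm k powr s *\<^sub>R g k |s g. g \<in> Psi_space}"
  show ?thesis
  proof (rule poly_span_Psi[where B=B])
    show "(\<lambda>k. norm k powr s *\<^sub>R f k) \<in> poly_span B"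
      using assms by (intro poly_span.base) (auto simp: B_def)
    fix h i ms assume "h \<in> B"
    then obtain g s where g: "h = (\<lambda>k. norm k powr s *\<^sub>R g k)" "g \<in> Psi_space" by (auto simp: B_def)
    show "h differentiable (at x)" for x
      unfolding g differentiable_def using Psi_norm_powr_derivative[OF g(2)] by blast
    have "partial i h = (\<lambda>k. norm k powr s *\<^sub>R partial i g k + complex_of_real s * (k $ i *\<^sub>R (norm k powr (s - 2) *\<^sub>R g k)))"
      unfolding g
      by (intro ext, subst partial_has_derivative[OF Psi_norm_powr_derivative[OF g(2)]])
        (simp add: sum_axis_scaleR inner_axis, simp add: scaleR_conv_of_real mult_ac)
    also have "\<dots> \<in> poly_span B"
      using g(2) PsiD(2)[OF g(2), of i]
      by (intro poly_span.add poly_span.scale poly_span.coord poly_span.base) (auto simp: B_def)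
    finally show "partial i h \<in> poly_span B" .
    show "bounded (range (\<lambda>x. monomial ms x *\<^sub>R h x))"
    proof -
      obtain C where C: "C \<ge> 0" "\<And>x. norm x powr (s + length ms) * norm (g x) \<le> C"
        using Psi_norm_powr_bounded[OF g(2)] by metis
      have "norm (monomial ms x *\<^sub>R h x) \<le> C" for x
      proof (cases "x = 0")
        case False
        have "norm (monomial ms x *\<^sub>R h x) \<le> norm x ^ length ms * (norm x powr s * norm (g x))"
          unfolding g by (simp add: abs_mult mult.assoc mult_right_mono abs_monomial_le)
        also have "\<dots> = norm x powr (s + length ms) * norm (g x)"
          using False by (simp add: powr_add powr_realpow)
        finally show ?thesis using C(2)[of x] by simp
      qed (simp add: g C(1))
      thus ?thesis by (auto simp: bounded_iff)
    qed
    show "h 0 = 0" by (simp add: g)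
  qed
qed

section \<open>The Fourier transform of Schwartz functions\<close>

lemma polynomial_weight_integrable:
  "integrable lborel (\<lambda>x::'a::euclidean_space. 1 / (1 + norm x ^ (DIM('a) + 1)))"
proof -
  define d where "d = DIM('a)"
  have d: "d > 0" by (simp add: d_def)
  have base: "integrable lborel (\<lambda>s::real. 2 * inverse (1 + s\<^sup>2))"
    using integrable_inverse_1_plus_square by (simp add: set_integrable_def)
  have "set_integrable lborel {0<..} (\<lambda>s::real. s ^ (d - 1) *\<^sub>R (1 / (1 + s ^ (d + 1))))"
    unfolding set_integrable_def
  proof (rule Bochner_Integration.integrable_bound[OF base])
    show "AE s in lborel. norm (indicator {0<..} s *\<^sub>R s ^ (d - 1) *\<^sub>R (1 / (1 + s ^ (d + 1)))) \<le> norm (2 * inverse (1 + s\<^sup>2) :: real)"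
      (is "AE s in _. ?P s")
    proof (rule AE_I2)
      fix s :: real
      show "?P s"
      proof (cases "s > 0")
        case True
        have e: "s ^ (d - 1) * s\<^sup>2 = s ^ (d + 1)" using d by (simp flip: power_add)
        have le: "s ^ (d - 1) \<le> 1 + s ^ (d + 1)"
        proof (cases "s \<le> 1")
          case True
          have "s ^ (d - 1) \<le> 1" using True \<open>s > 0\<close> by (simp add: power_le_one)
          thus ?thesis using \<open>s > 0\<close> by (simp add: add_increasing2)
        next
          case False
          have "s ^ (d - 1) \<le> s ^ (d + 1)" using False by (intro power_increasing) auto
          thus ?thesis by simp
        qed
        have "s ^ (d - 1) * (1 + s\<^sup>2) = s ^ (d - 1) + s ^ (d + 1)"
          by (simp only: distrib_left mult_1_right e)
        also have "b + a \<le> 2 * (1 + a)" if "b \<le> 1 + a" for a b :: real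
          using that by simp
        note this[OF le]
        finally have "s ^ (d - 1) * (1 + s\<^sup>2) \<le> 2 * (1 + s ^ (d + 1))" .
        moreover have "1 + s\<^sup>2 > 0" "1 + s ^ (d + 1) > 0" using True by (auto intro: add_pos_pos)
        ultimately have "s ^ (d - 1) / (1 + s ^ (d + 1)) \<le> 2 / (1 + s\<^sup>2)"
          by (simp add: divide_simps)
        thus ?thesis using True by (simp add: divide_inverse)
      qed simp
    qed
  qed measurable
  thus ?thesis
    by (subst radial_integrable[where f="\<lambda>s. 1 / (1 + s ^ (DIM('a) + 1))"]) (simp_all add: d_def)
qed

text \<open>A finite sum of seminorms that dominates \<open>f\<close> by an integrable weight. It is the quantity in which
  pairings with bounded functions are continuous.\<close>

definition decay_seminorm :: "(real^'d::finite \<Rightarrow> complex) \<Rightarrow> real" where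
  "decay_seminorm f = schwartz_seminorm [] [] f +
     real CARD('d) ^ (CARD('d) + 1) * (\<Sum>i\<in>UNIV. schwartz_seminorm (replicate (CARD('d) + 1) i) [] f)"

lemma schwartz_le_decay_seminorm:
  fixes f :: "real^'d::finite \<Rightarrow> complex"
  assumes "f \<in> schwartz"
  shows "norm (f x) \<le> decay_seminorm f * (1 / (1 + norm x ^ (CARD('d) + 1)))"
proof -
  have pos: "1 + norm x ^ (CARD('d) + 1) > 0" by (auto intro: add_pos_nonneg)
  have "norm (f x) * (1 + norm x ^ (CARD('d) + 1)) \<le> decay_seminorm f"
    using schwartz_seminorm_ge[OF assms, of "[]" x] schwartz_weight_le[OF assms, of x "CARD('d) + 1"]
    by (simp add: decay_seminorm_def algebra_simps)
  thus ?thesis using pos by (simp add: pos_le_divide_eq)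
qed

lemma decay_seminorm_nonneg: "f \<in> schwartz \<Longrightarrow> decay_seminorm f \<ge> 0"
  using schwartz_le_decay_seminorm[of f 0] by (intro order_trans[OF norm_ge_zero[of "f 0"]]) simp

lemma schwartz_continuous: "f \<in> schwartz \<Longrightarrow> continuous_on UNIV f"
  by (meson continuous_at_imp_continuous_on differentiable_imp_continuous_within schwartzD(1))

lemma schwartz_measurable: "f \<in> schwartz \<Longrightarrow> f \<in> borel_measurable borel"
  by (intro borel_measurable_continuous_onI schwartz_continuous)

lemma schwartz_integrable:
  fixes f :: "real^'d::finite \<Rightarrow> complex"
  assumes f: "f \<in> schwartz"
  shows "integrable lborel f"
proof (rule Bochner_Integration.integrable_bound)
  show "integrable lborel (\<lambda>x::real^'d. decay_seminorm f * (1 / (1 + norm x ^ (CARD('d) + 1))))"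
    using polynomial_weight_integrable[where 'a="real^'d"] by (intro integrable_mult_right) simp
  show "AE x in lborel. norm (f x) \<le> norm (decay_seminorm f * (1 / (1 + norm x ^ (CARD('d) + 1))))"
    unfolding real_norm_def
    by (rule AE_I2, rule order_trans[OF schwartz_le_decay_seminorm[OF f] abs_ge_self])
qed (use schwartz_measurable[OF f] in simp)

lemma schwartz_norm_power_integrable:
  fixes f :: "real^'d::finite \<Rightarrow> complex"
  assumes f: "f \<in> schwartz"
  shows "integrable lborel (\<lambda>x. norm x ^ N * norm (f x))"
proof (rule Bochner_Integration.integrable_bound)
  show "integrable lborel (\<lambda>x. real CARD('d) ^ N * (\<Sum>i\<in>UNIV. norm (monomial (replicate N i) x *\<^sub>R f x)))"
    by (intro integrable_mult_right Bochner_Integration.integrable_sum integrable_norm schwartz_integrable schwartz_monomial f)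
  show "AE x in lborel. norm (norm x ^ N * norm (f x)) \<le> norm (real CARD('d) ^ N * (\<Sum>i\<in>UNIV. norm (monomial (replicate N i) x *\<^sub>R f x)))"
    (is "AE x in _. ?P x")
  proof (rule AE_I2)
    fix x
    have "norm x ^ N * norm (f x) \<le> (real CARD('d) ^ N * (\<Sum>i\<in>UNIV. \<bar>monomial (replicate N i) x\<bar>)) * norm (f x)"
      by (intro mult_right_mono norm_power_le_coords) auto
    also have "\<dots> = real CARD('d) ^ N * (\<Sum>i\<in>UNIV. norm (monomial (replicate N i) x *\<^sub>R f x))"
      by (simp add: sum_distrib_right mult.assoc)
    finally have *: "norm x ^ N * norm (f x) \<le> real CARD('d) ^ N * (\<Sum>i\<in>UNIV. norm (monomial (replicate N i) x *\<^sub>R f x))" .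
    have "norm (norm x ^ N * norm (f x)) = norm x ^ N * norm (f x)" by simp
    also note *
    also note abs_ge_self
    finally show "?P x"
      unfolding real_norm_def[symmetric] .
  qed
qed (use schwartz_measurable[OF f] in simp)

abbreviation plane_wave :: "'a::euclidean_space \<Rightarrow> 'a \<Rightarrow> complex" where
  "plane_wave k x \<equiv> exp (- (\<i> * complex_of_real (k \<bullet> x)))"

lemma fourier_lborel:
  fixes f :: "real^'d::finite \<Rightarrow> complex"
  assumes "f \<in> borel_measurable borel"
  shows "fourier f k = complex_of_real ((2 * pi) powr (- real CARD('d) / 2)) *
     (LBINT x. plane_wave k x * f x)"
  using assms unfolding fourier_def by (subst integral_completion) simp_all

lemma fourier_integrand_integrable:
  assumes "integrable lborel (f :: 'a::euclidean_space \<Rightarrow> complex)"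
  shows "integrable lborel (\<lambda>x. plane_wave k x * f x)"
  by (rule Bochner_Integration.integrable_bound[OF assms])
    (use borel_measurable_integrable[OF assms] in \<open>auto simp: norm_mult\<close>)

lemma norm_fourier_le:
  fixes f :: "real^'d::finite \<Rightarrow> complex"
  assumes "integrable lborel f"
  shows "norm (fourier f k) \<le> (2 * pi) powr (- real CARD('d) / 2) * (LBINT x. norm (f x))"
proof -
  have [measurable]: "f \<in> borel_measurable borel" using assms by simp
  have "norm (LBINT x. plane_wave k x * f x) \<le> (LBINT x. norm (f x))"
    by (rule order_trans[OF integral_norm_bound]) (simp add: norm_mult)
  thus ?thesis by (simp add: fourier_lborel norm_mult mult_left_mono)
qed

lemma continuous_on_fourier:
  fixes f :: "real^'d::finite \<Rightarrow> complex"
  assumes f: "integrable lborel f"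
  shows "continuous_on UNIV (fourier f)"
proof -
  have [measurable]: "f \<in> borel_measurable borel" using f by simp
  have "continuous (at k within UNIV) (\<lambda>k. LBINT x. plane_wave k x * f x)" for k
  proof (rule continuous_within_sequentiallyI)
    fix u :: "nat \<Rightarrow> real^'d" assume u: "u \<longlonglongrightarrow> k"
    show "(\<lambda>n. LBINT x. plane_wave (u n) x * f x) \<longlonglongrightarrow> (LBINT x. plane_wave k x * f x)"
      by (rule integral_dominated_convergence[where w="\<lambda>x. norm (f x)"])
         (use f in \<open>auto intro!: tendsto_intros u simp: norm_mult\<close>)
  qed
  hence "continuous_on UNIV (\<lambda>k. LBINT x. plane_wave k x * f x)"
    by (simp add: continuous_on_eq_continuous_within)
  moreover have "fourier f = (\<lambda>k. complex_of_real ((2 * pi) powr (- real CARD('d) / 2)) *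
     (LBINT x. plane_wave k x * f x))"
    by (intro ext fourier_lborel) simp
  ultimately show ?thesis by (simp only: continuous_on_mult_left)
qed

lemma fourier_measurable:
  fixes f :: "real^'d::finite \<Rightarrow> complex"
  assumes "integrable lborel f"
  shows "fourier f \<in> borel_measurable borel"
  by (intro borel_measurable_continuous_onI continuous_on_fourier assms)

lemma fourier_scale:
  fixes f :: "real^'d::finite \<Rightarrow> complex"
  assumes [measurable]: "f \<in> borel_measurable borel"
  shows "fourier (\<lambda>x. c * f x) k = c * fourier f k"
proof -
  have "(LBINT x. plane_wave k x * (c * f x)) = c * (LBINT x. plane_wave k x * f x)"
    by (subst integral_mult_right_zero[symmetric]) (simp add: mult_ac)
  thus ?thesis by (simp add: fourier_lborel)
qed

text \<open>The remainder of the first-order expansion of the plane wave is at most \<open>|h|^2 |x|^2\<close>, and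
  \<open>|x|^2 f(x)\<close> is integrable.\<close>

lemma fourier_has_derivative:
  fixes f :: "real^'d::finite \<Rightarrow> complex"
  assumes f: "f \<in> schwartz"
  shows "(fourier f has_derivative (\<lambda>h. \<Sum>i\<in>UNIV. h $ i *\<^sub>R fourier (\<lambda>x. - \<i> * (x $ i *\<^sub>R f x)) k)) (at k)"
proof -
  note [measurable] = schwartz_measurable[OF f]
  define E where "E = (\<lambda>(k::real^'d) x. plane_wave k x)"
  have [measurable]: "E k \<in> borel_measurable borel" for k unfolding E_def by measurable
  have nE: "norm (E k x) = 1" for k x by (simp add: E_def)
  define I where "I = (\<lambda>k. LBINT x. E k x * f x)"
  define D where "D = (\<lambda>i. LBINT x. E k x * (- \<i> * (x $ i *\<^sub>R f x)))"
  define K where "K = (LBINT x. norm x ^ 2 * norm (f x))"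
  have int: "integrable lborel (\<lambda>x. E k x * f x)" for k
    unfolding E_def by (rule fourier_integrand_integrable) (rule schwartz_integrable[OF f])
  have intD: "integrable lborel (\<lambda>x. E k x * (- \<i> * (x $ i *\<^sub>R f x)))" for i
    unfolding E_def by (intro fourier_integrand_integrable schwartz_integrable schwartz_scale schwartz_coord f)
  let ?d = "\<lambda>i x. E k x * (- \<i> * (x $ i *\<^sub>R f x))"
  let ?l = "\<lambda>h x. E k x * (- \<i> * complex_of_real (h \<bullet> x)) * f x"
  let ?S = "\<lambda>h::real^'d. \<Sum>i\<in>UNIV. h $ i *\<^sub>R D i"
  have est: "norm (I (k + h) - I k - ?S h) \<le> norm h * norm h * K" for h
  proof -
    have "?S h = (LBINT x. (\<Sum>i\<in>UNIV. h $ i *\<^sub>R (?d i x)))"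
    proof -
      have A: "(LBINT x. (\<Sum>i\<in>UNIV. h $ i *\<^sub>R (?d i x))) =
         (\<Sum>i\<in>UNIV. LBINT x. h $ i *\<^sub>R (?d i x))"
        by (rule Bochner_Integration.integral_sum) (rule integrable_scaleR_right, rule intD)
      show ?thesis
        unfolding A D_def by (intro sum.cong refl) (rule Bochner_Integration.integral_scaleR_right[symmetric])
    qed
    also have "\<dots> = (LBINT x. ?l h x)"
      by (intro Bochner_Integration.integral_cong refl)
        (simp add: inner_vec_def scaleR_conv_of_real sum_distrib_left sum_distrib_right mult_ac)
    finally have S: "?S h = (LBINT x. ?l h x)" .
    have bnd: "norm (E (k + h) x * f x - E k x * f x - ?l h x) \<le> norm h * norm h * (norm x ^ 2 * norm (f x))" for x
    proof -
      have "E (k + h) x = E k x * E h x"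
        by (simp add: E_def inner_add_left distrib_left flip: exp_add)
      hence eq: "E (k + h) x * f x - E k x * f x - ?l h x
        = E k x * (E h x - 1 - (- \<i> * complex_of_real (h \<bullet> x))) * f x"
        by (simp add: algebra_simps)
      have "norm (E h x - 1 - (- \<i> * complex_of_real (h \<bullet> x))) \<le> \<bar>h \<bullet> x\<bar> ^ 2 / 2"
        using iexp_approx1[of "- (h \<bullet> x)" 1] by (simp add: E_def numeral_2_eq_2 algebra_simps)
      also have "\<bar>h \<bullet> x\<bar> ^ 2 / 2 \<le> (norm h * norm x) ^ 2"
        using power_mono[OF Cauchy_Schwarz_ineq2[of h x], of 2] zero_le_power2[of "norm h * norm x"] by linarith
      finally have "norm (E h x - 1 - (- \<i> * complex_of_real (h \<bullet> x))) * norm (f x) \<le> (norm h * norm x) ^ 2 * norm (f x)"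
        by (rule mult_right_mono) simp
      thus ?thesis
        unfolding eq by (simp add: norm_mult nE power2_eq_square mult_ac)
    qed
    have i3: "integrable lborel (\<lambda>x. ?l h x)"
    proof -
      have "integrable lborel (\<lambda>x. (\<Sum>i\<in>UNIV. h $ i *\<^sub>R (?d i x)))"
        using intD by (intro Bochner_Integration.integrable_sum integrable_scaleR_right)
      also have "(\<lambda>x. (\<Sum>i\<in>UNIV. h $ i *\<^sub>R (?d i x))) = (\<lambda>x. ?l h x)"
        by (intro ext) (simp add: inner_vec_def scaleR_conv_of_real sum_distrib_left sum_distrib_right mult_ac)
      finally show ?thesis .
    qed
    have IE: "I (k + h) - I k - ?S h
      = (LBINT x. E (k + h) x * f x - E k x * f x - ?l h x)"
      unfolding S I_def using int i3 by simp
    have "norm (I (k + h) - I k - ?S h) \<le> (LBINT x. norm (E (k + h) x * f x - E k x * f x - ?l h x))"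
      unfolding IE by (rule integral_norm_bound)
    also have "\<dots> \<le> (LBINT x. norm h * norm h * (norm x ^ 2 * norm (f x)))"
      using int i3 schwartz_norm_power_integrable[OF f, of 2] bnd by (intro integral_mono) auto
    finally show ?thesis by (simp add: K_def)
  qed
  have "(I has_derivative ?S) (at k)"
    unfolding has_derivative_at
  proof
    show "bounded_linear ?S"
      by (intro bounded_linear_sum bounded_linear_scaleR_const bounded_linear_vec_nth)
    show "(\<lambda>h. norm (I (k + h) - I k - ?S h) / norm h) \<midarrow>0\<rightarrow> 0"
    proof (rule Lim_null_comparison)
      show "((\<lambda>h::real^'d. norm h * K) \<longlongrightarrow> 0) (at 0)" by (auto intro!: tendsto_eq_intros)
      show "\<forall>\<^sub>F h in at 0. norm (norm (I (k + h) - I k - ?S h) / norm h) \<le> norm h * K"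
      proof (rule always_eventually, rule allI)
        fix h :: "real^'d"
        show "norm (norm (I (k + h) - I k - ?S h) / norm h) \<le> norm h * K"
          using est[of h] by (cases "h = 0") (auto simp: field_simps)
      qed
    qed
  qed
  from has_derivative_mult_right[OF this, of "complex_of_real ((2 * pi) powr (- real CARD('d) / 2))"]
  moreover have "fourier f = (\<lambda>k. complex_of_real ((2 * pi) powr (- real CARD('d) / 2)) * I k)"
    unfolding I_def E_def by (intro ext fourier_lborel) simp
  moreover have "fourier (\<lambda>x. - \<i> * (x $ i *\<^sub>R f x)) k = complex_of_real ((2 * pi) powr (- real CARD('d) / 2)) * D i" for i
    unfolding D_def E_def by (rule fourier_lborel) measurable
  ultimately show ?thesis by (simp add: sum_distrib_left)
qed

lemma partial_fourier:
  assumes f: "f \<in> schwartz"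
  shows "partial i (fourier f) = fourier (\<lambda>x. - \<i> * (x $ i *\<^sub>R f x))"
  by (intro ext, subst partial_has_derivative[OF fourier_has_derivative[OF f]]) (rule sum_axis_scaleR)

lemma partial_line_derivative:
  assumes "f \<in> schwartz"
  shows "((\<lambda>s. f (x + s *\<^sub>R axis i 1)) has_vector_derivative partial i f (x + s *\<^sub>R axis i 1)) (at s)"
proof -
  have "((\<lambda>s. x + s *\<^sub>R axis i 1) has_derivative (\<lambda>h. h *\<^sub>R axis i 1)) (at s)"
    by (auto intro!: derivative_eq_intros)
  from has_derivative_compose[OF this has_derivative_partial[OF schwartzD(1)[OF assms]]]
  show ?thesis
    by (simp add: has_vector_derivative_def sum_axis_scaleR flip: scaleR_scaleR scaleR_sum_right)
qed

lemma has_vector_derivative_quotient: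
  assumes "(f has_vector_derivative D) (at 0)"
  shows "((\<lambda>h. (f h - f 0) /\<^sub>R h) \<longlongrightarrow> D) (at (0::real))"
proof -
  have "((\<lambda>h. norm (f h - f 0 - h *\<^sub>R D) / norm h) \<longlongrightarrow> 0) (at 0)"
    using assms by (simp add: has_vector_derivative_def has_derivative_at)
  moreover have "norm (f h - f 0 - h *\<^sub>R D) / norm h = norm ((f h - f 0) /\<^sub>R h - D)" if "h \<noteq> 0" for h
  proof -
    have "(f h - f 0) /\<^sub>R h - D = (f h - f 0 - h *\<^sub>R D) /\<^sub>R h"
      using that by (simp add: scaleR_diff_right)
    thus ?thesis by (simp add: divide_inverse mult.commute)
  qed
  hence "\<forall>\<^sub>F h in at 0. norm (f h - f 0 - h *\<^sub>R D) / norm h = norm ((f h - f 0) /\<^sub>R h - D)"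
    by (auto simp: eventually_at_filter)
  ultimately have "((\<lambda>h. norm ((f h - f 0) /\<^sub>R h - D)) \<longlongrightarrow> 0) (at 0)"
    by (rule Lim_transform_eventually)
  from tendsto_norm_zero_cancel[OF this] show ?thesis by (simp add: LIM_zero_iff)
qed

text \<open>The difference quotient of \<open>f\<close> with step \<open>t\<close> in the direction of the \<open>i\<close>-th axis has the Fourier
  transform \<open>(exp(i t k_i) - 1) / t\<close> times that of \<open>f\<close>. As \<open>t\<close> tends to zero the quotients converge
  dominatedly, since \<open>\<partial>_i f\<close> decays uniformly over segments of length one.\<close>

lemma fourier_partial:
  fixes f :: "real^'d::finite \<Rightarrow> complex"
  assumes f: "f \<in> schwartz"
  shows "fourier (partial i f) k = \<i> * (k $ i *\<^sub>R fourier f k)"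
proof -
  note [measurable] = schwartz_measurable[OF f] schwartz_measurable[OF schwartzD(2)[OF f]]
  define N where "N = CARD('d) + 1"
  define e :: "real^'d" where "e = axis i 1"
  define E where "E = (\<lambda>x. plane_wave k x)"
  have [measurable]: "E \<in> borel_measurable borel" unfolding E_def by measurable
  define t where "t = (\<lambda>n. 1 / (real n + 1))"
  have t: "t n > 0" "t n \<le> 1" for n by (auto simp: t_def)
  have t0: "t \<longlonglongrightarrow> 0" unfolding t_def using LIMSEQ_Suc[OF lim_1_over_n] by (simp add: add.commute)
  define q where "q = (\<lambda>n x. (f (x + t n *\<^sub>R e) - f x) /\<^sub>R t n)"
  have [measurable]: "q n \<in> borel_measurable borel" for n unfolding q_def by measurable
  define C where "C = decay_seminorm (partial i f) * (1 + 2 ^ N)"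
  have C: "decay_seminorm (partial i f) \<ge> 0" by (rule decay_seminorm_nonneg[OF schwartzD(2)[OF f]])
  have q_lim: "(\<lambda>n. q n x) \<longlonglongrightarrow> partial i f x" for x
  proof -
    have "((\<lambda>h. (f (x + h *\<^sub>R e) - f x) /\<^sub>R h) \<longlongrightarrow> partial i f x) (at 0)"
      using has_vector_derivative_quotient[OF partial_line_derivative[OF f, of x i 0]] by (simp add: e_def)
    moreover have "filterlim t (at 0) sequentially"
      using t0 t by (auto simp: filterlim_at intro!: always_eventually) (metis less_irrefl t(1))
    ultimately show ?thesis unfolding q_def by (rule filterlim_compose)
  qed
  have q_le: "norm (q n x) \<le> C * (1 / (1 + norm x ^ N))" for n x
  proof -
    have "norm (f (x + t n *\<^sub>R e) - f (x + 0 *\<^sub>R e)) \<le> C * (1 / (1 + norm x ^ N)) * norm (t n - 0)"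
    proof (rule differentiable_bound[where S="{0..t n}" and f'="\<lambda>s h. h *\<^sub>R partial i f (x + s *\<^sub>R e)"])
      fix s assume s: "s \<in> {0..t n}"
      show "((\<lambda>s. f (x + s *\<^sub>R e)) has_derivative (\<lambda>h. h *\<^sub>R partial i f (x + s *\<^sub>R e))) (at s within {0..t n})"
        using partial_line_derivative[OF f, of x i s] unfolding has_vector_derivative_def e_def
        by (rule has_derivative_at_withinI)
      define y where "y = x + s *\<^sub>R e"
      have "norm x \<le> norm y + norm (s *\<^sub>R e)" unfolding y_def by (metis add_diff_cancel norm_triangle_sub norm_minus_commute norm_triangle_ineq4)
      also have "norm (s *\<^sub>R e) \<le> 1" using s t[of n] by (auto simp: e_def)
      finally have "norm x \<le> norm y + 1" by simp
      hence "norm x ^ N \<le> (norm y + 1) ^ N" by (intro power_mono) auto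
      also have "\<dots> \<le> 2 ^ N * (1 + norm y ^ N)"
      proof (cases "norm y \<le> 1")
        case True
        hence "(norm y + 1) ^ N \<le> 2 ^ N" by (intro power_mono) auto
        thus ?thesis by (simp add: distrib_left add_increasing2)
      next
        case False
        hence "(norm y + 1) ^ N \<le> (2 * norm y) ^ N" by (intro power_mono) auto
        thus ?thesis by (simp add: distrib_left power_mult_distrib add_increasing)
      qed
      finally have "1 + norm x ^ N \<le> (1 + 2 ^ N) * (1 + norm y ^ N)"
        by (simp only: distrib_right mult_1_left) (rule add_mono, auto intro: add_increasing)
      moreover have "1 + norm x ^ N > 0" "1 + norm y ^ N > 0" by (auto intro: add_pos_nonneg)
      ultimately have w: "1 / (1 + norm y ^ N) \<le> (1 + 2 ^ N) * (1 / (1 + norm x ^ N))"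
        by (simp add: divide_simps mult_ac)
      have "norm (partial i f y) \<le> decay_seminorm (partial i f) * (1 / (1 + norm y ^ N))"
        unfolding N_def by (rule schwartz_le_decay_seminorm[OF schwartzD(2)[OF f]])
      also have "\<dots> \<le> decay_seminorm (partial i f) * ((1 + 2 ^ N) * (1 / (1 + norm x ^ N)))"
        by (intro mult_left_mono w C)
      finally have "norm (partial i f y) \<le> C * (1 / (1 + norm x ^ N))" by (simp add: C_def)
      note p = this
      show "onorm (\<lambda>h. h *\<^sub>R partial i f (x + s *\<^sub>R e)) \<le> C * (1 / (1 + norm x ^ N))"
      proof (rule onorm_le)
        fix h :: real
        show "norm (h *\<^sub>R partial i f (x + s *\<^sub>R e)) \<le> C * (1 / (1 + norm x ^ N)) * norm h"
          using mult_right_mono[OF p norm_ge_zero[of h]] unfolding norm_scaleR y_def real_norm_def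
          by (simp only: mult.commute)
      qed
    qed (use t(1)[of n] in auto)
    hence "norm (f (x + t n *\<^sub>R e) - f x) / t n \<le> C * (1 / (1 + norm x ^ N))"
      using t(1)[of n] by (simp only: pos_divide_le_eq) simp
    moreover have "norm (q n x) = norm (f (x + t n *\<^sub>R e) - f x) / t n"
      using t(1)[of n] by (simp add: q_def divide_inverse mult.commute)
    ultimately show ?thesis by simp
  qed
  have "(\<lambda>n. LBINT x. E x * q n x) \<longlonglongrightarrow> (LBINT x. E x * partial i f x)"
  proof (rule integral_dominated_convergence[where w="\<lambda>x. C * (1 / (1 + norm x ^ N))"])
    show "integrable lborel (\<lambda>x::real^'d. C * (1 / (1 + norm x ^ N)))"
      using polynomial_weight_integrable[where 'a="real^'d"] unfolding N_def by (intro integrable_mult_right) simp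
    show "AE x in lborel. (\<lambda>n. E x * q n x) \<longlonglongrightarrow> E x * partial i f x"
      by (intro AE_I2 tendsto_intros q_lim)
    show "AE x in lborel. norm (E x * q n x) \<le> C * (1 / (1 + norm x ^ N))" for n
      using q_le[of n] by (auto simp: norm_mult E_def)
  qed auto
  moreover have "(LBINT x. E x * q n x) = (iexp (t n * k $ i) - 1) /\<^sub>R t n * (LBINT x. E x * f x)" for n
  proof -
    have int: "integrable lborel (\<lambda>x. E x * f x)"
      unfolding E_def by (rule fourier_integrand_integrable[OF schwartz_integrable[OF f]])
    have shift: "E x = iexp (t n * k $ i) * E (x + t n *\<^sub>R e)" for x
      by (simp add: E_def inner_add_right e_def inner_axis exp_add[symmetric] algebra_simps)
    have int2: "integrable lborel (\<lambda>x. E (x + t n *\<^sub>R e) * f (x + t n *\<^sub>R e))"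
      using integrable_affine[OF int, of 1 "t n *\<^sub>R e"] by (simp add: add.commute)
    have "(LBINT x. E x * q n x) = (LBINT x. (iexp (t n * k $ i) * (E (x + t n *\<^sub>R e) * f (x + t n *\<^sub>R e)) - E x * f x) /\<^sub>R t n)"
      by (intro Bochner_Integration.integral_cong refl)
        (subst (1 2) shift, simp add: q_def algebra_simps)
    also have "\<dots> = (iexp (t n * k $ i) * (LBINT x. E (x + t n *\<^sub>R e) * f (x + t n *\<^sub>R e)) - (LBINT x. E x * f x)) /\<^sub>R t n"
      using int int2 by simp
    also have "(LBINT x. E (x + t n *\<^sub>R e) * f (x + t n *\<^sub>R e)) = (LBINT x. E x * f x)"
      using integral_affine[of "\<lambda>x. E x * f x" 1 "t n *\<^sub>R e"] by (simp add: add.commute)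
    finally show ?thesis by (simp add: algebra_simps)
  qed
  moreover have "(\<lambda>n. (iexp (t n * k $ i) - 1) /\<^sub>R t n * (LBINT x. E x * f x)) \<longlonglongrightarrow> \<i> * k $ i * (LBINT x. E x * f x)"
  proof -
    have "((\<lambda>s. iexp (s * k $ i)) has_vector_derivative (\<i> * k $ i)) (at 0)"
      by (auto intro!: derivative_eq_intros has_vector_derivative_real_field)
    from has_vector_derivative_quotient[OF this]
    have "((\<lambda>h. (iexp (h * k $ i) - 1) /\<^sub>R h) \<longlongrightarrow> \<i> * k $ i) (at 0)" by simp
    moreover have "filterlim t (at 0) sequentially"
      using t0 t by (auto simp: filterlim_at intro!: always_eventually) (metis less_irrefl t(1))
    ultimately have "(\<lambda>n. (iexp (t n * k $ i) - 1) /\<^sub>R t n) \<longlonglongrightarrow> \<i> * k $ i" by (rule filterlim_compose)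
    thus ?thesis by (intro tendsto_intros)
  qed
  ultimately have "(LBINT x. E x * partial i f x) = \<i> * k $ i * (LBINT x. E x * f x)"
    using LIMSEQ_unique by auto
  thus ?thesis by (simp add: fourier_lborel E_def scaleR_conv_of_real)
qed

text \<open>The image of the Schwartz space is closed under partial derivatives and under multiplication by
  monomials, because the Fourier transform exchanges the two operations; and its elements are
  bounded.\<close>

lemma fourier_schwartz:
  assumes f: "f \<in> schwartz"
  shows "fourier f \<in> schwartz"
proof (rule schwartz_coinduct[where X="fourier ` schwartz"])
  fix h i ms assume "h \<in> fourier ` schwartz"
  then obtain g where g: "h = fourier g" "g \<in> schwartz" by blast
  show "h differentiable (at x)" for x
    unfolding g differentiable_def using fourier_has_derivative[OF g(2)] by blast
  show "partial i h \<in> fourier ` schwartz"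
    unfolding g partial_fourier[OF g(2)] by (intro imageI schwartz_scale schwartz_coord g)
  have "\<exists>g'\<in>schwartz. (\<lambda>k. monomial ms k *\<^sub>R fourier g k) = fourier g'"
    using g(2)
  proof (induction ms arbitrary: g)
    case (Cons i ms)
    have p: "(\<lambda>x. - \<i> * partial i g x) \<in> schwartz" by (intro schwartz_scale schwartzD Cons.prems)
    have "fourier (\<lambda>x. - \<i> * partial i g x) k = k $ i *\<^sub>R fourier g k" for k
      by (subst fourier_scale[OF schwartz_measurable[OF schwartzD(2)[OF Cons.prems]]], subst fourier_partial[OF Cons.prems]) simp
    hence "(\<lambda>k. monomial (i # ms) k *\<^sub>R fourier g k) = (\<lambda>k. monomial ms k *\<^sub>R fourier (\<lambda>x. - \<i> * partial i g x) k)"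
      by (simp add: mult.commute)
    thus ?case using Cons.IH[OF p] by simp
  qed auto
  then obtain g' where g': "g' \<in> schwartz" "\<And>k. monomial ms k *\<^sub>R fourier g k = fourier g' k" by metis
  show "bounded (range (\<lambda>k. monomial ms k *\<^sub>R h k))"
    unfolding g g'(2) using norm_fourier_le[OF schwartz_integrable[OF g'(1)]] by (auto simp: bounded_iff)
qed (use f in auto)

section \<open>Inversion, square integrability and decay at infinity\<close>

lemma fourier_multiplication:
  fixes f g :: "real^'d::finite \<Rightarrow> complex"
  assumes f: "integrable lborel f" and g: "integrable lborel g"
  shows "(LBINT x. fourier f x * g x) = (LBINT y. f y * fourier g y)"
proof -
  have [measurable]: "f \<in> borel_measurable borel" "g \<in> borel_measurable borel" using f g by auto
  define c where "c = complex_of_real ((2 * pi) powr (- real CARD('d) / 2))"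
  define H where "H = (\<lambda>x y. plane_wave x y * f y * g x)"
  have nH: "norm (H x y) = norm (f y) * norm (g x)" for x y by (simp add: H_def norm_mult)
  have "integrable (lborel \<Otimes>\<^sub>M lborel) (case_prod H)"
  proof (rule lborel_pair.Fubini_integrable)
    show "case_prod H \<in> borel_measurable (lborel \<Otimes>\<^sub>M lborel)"
      unfolding H_def by measurable
    show "integrable lborel (\<lambda>x. LBINT y. norm (case_prod H (x, y)))"
      using g by (simp add: nH)
    show "AE x in lborel. integrable lborel (\<lambda>y. case_prod H (x, y))"
      (is "AE x in _. ?P x")
    proof (rule AE_I2)
      fix x
      show "?P x"
        using fourier_integrand_integrable[OF f, of x] by (simp add: H_def)
    qed
  qed
  hence "(LBINT y. LBINT x. H x y) = (LBINT x. LBINT y. H x y)"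
    by (rule lborel_pair.Fubini_integral)
  moreover have "c * (LBINT x. LBINT y. H x y) = (LBINT x. fourier f x * g x)"
  proof -
    have "(LBINT y. H x y) = (LBINT y. plane_wave x y * f y) * g x" for x
      unfolding H_def by simp
    thus ?thesis
      by (subst integral_mult_right_zero[symmetric]) (simp add: fourier_lborel c_def mult.assoc)
  qed
  moreover have "c * (LBINT y. LBINT x. H x y) = (LBINT y. f y * fourier g y)"
  proof -
    have "(LBINT x. H x y) = f y * (LBINT x. plane_wave y x * g x)" for y
      by (subst integral_mult_right_zero[symmetric])
        (simp add: H_def inner_commute mult_ac)
    thus ?thesis
      by (subst integral_mult_right_zero[symmetric]) (simp add: fourier_lborel c_def mult_ac)
  qed
  ultimately show ?thesis by simp
qed

text \<open>The Gaussian density with standard deviation \<open>t\<close> in each coordinate, that is, the heat kernel at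
  time \<open>t^2/2\<close>.\<close>

definition heat_kernel :: "real \<Rightarrow> 'a::euclidean_space \<Rightarrow> real" where
  "heat_kernel t w = gauss (w /\<^sub>R t) / t ^ DIM('a)"

lemma heat_kernel_nonneg: "t > 0 \<Longrightarrow> heat_kernel t w \<ge> 0"
  using gauss_pos[of "w /\<^sub>R t"] by (simp add: heat_kernel_def)

lemma heat_kernel_measurable [measurable]: "heat_kernel t \<in> borel_measurable borel"
  unfolding heat_kernel_def[abs_def] by measurable

lemma nn_integral_heat_kernel:
  fixes x :: "'a::euclidean_space"
  assumes "t > 0"
  shows "(\<integral>\<^sup>+z. ennreal (heat_kernel t (z + x)) \<partial>lborel) = 1"
proof -
  have "(\<integral>\<^sup>+z. ennreal (heat_kernel t (z + x)) \<partial>lborel)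
     = ennreal (\<bar>t\<bar> ^ DIM('a)) * (\<integral>\<^sup>+z. ennreal (heat_kernel t (- x + t *\<^sub>R z + x)) \<partial>lborel)"
    by (rule nn_integral_affine) (use assms in auto)
  also have "\<dots> = (\<integral>\<^sup>+z. ennreal (\<bar>t\<bar> ^ DIM('a)) * ennreal (heat_kernel t (- x + t *\<^sub>R z + x)) \<partial>lborel)"
    by (rule nn_integral_cmult[symmetric]) simp
  also have "\<dots> = (\<integral>\<^sup>+z. ennreal (gauss (z::'a)) \<partial>lborel)"
    using assms by (intro nn_integral_cong)
      (simp add: heat_kernel_def gauss_pos less_imp_le flip: ennreal_mult)
  also have "\<dots> = 1"
    by (simp add: nn_integral_eq_integral gauss_integrable gauss_integral gauss_pos less_imp_le)
  finally show ?thesis .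
qed

text \<open>With \<open>t \<rightarrow> 0\<close>, the damping \<open>exp(-(t |y|)^2/2)\<close> tends to one, while its Fourier transform becomes an
  approximate identity.\<close>

lemma fourier_damped_exp:
  fixes x :: "real^'d::finite"
  assumes t: "t > 0"
  defines "h \<equiv> (\<lambda>y. plane_wave x y * complex_of_real (exp (- (t * norm y)\<^sup>2 / 2)))"
  shows "integrable lborel h"
    and "fourier h z = complex_of_real ((2 * pi) powr (real CARD('d) / 2) * heat_kernel t (z + x))"
proof -
  define K where "K = (2 * pi) powr (real CARD('d) / 2)"
  have K: "K > 0" by (simp add: K_def)
  have [measurable]: "h \<in> borel_measurable borel" unfolding h_def by measurable
  have eq: "plane_wave z y * h y
      = complex_of_real K * (iexp ((- (z + x) /\<^sub>R t) \<bullet> (t *\<^sub>R y)) * complex_of_real (gauss (t *\<^sub>R y)))" for z y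
  proof -
    have "complex_of_real K * complex_of_real (gauss (t *\<^sub>R y)) = complex_of_real (exp (- (t * norm y)\<^sup>2 / 2))"
      using K t by (simp add: gauss_def K_def power_mult_distrib)
    moreover have "iexp ((- (z + x) /\<^sub>R t) \<bullet> (t *\<^sub>R y))
       = plane_wave z y * plane_wave x y"
    proof -
      have "(- (z + x) /\<^sub>R t) \<bullet> (t *\<^sub>R y) = - (z \<bullet> y) - (x \<bullet> y)"
        using t by (simp add: inner_diff_left field_simps)
      hence "\<i> * complex_of_real ((- (z + x) /\<^sub>R t) \<bullet> (t *\<^sub>R y))
          = - (\<i> * complex_of_real (z \<bullet> y)) + - (\<i> * complex_of_real (x \<bullet> y))"
        by (simp only:) (simp add: algebra_simps)
      thus ?thesis by (simp only: exp_add)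
    qed
    ultimately show ?thesis unfolding h_def by (simp add: mult_ac)
  qed
  have base: "integrable lborel (\<lambda>y. iexp ((- (z + x) /\<^sub>R t) \<bullet> (t *\<^sub>R y)) * complex_of_real (gauss (t *\<^sub>R y)))" for z :: "real^'d"
    using integrable_affine[OF gauss_fourier(1)[of "- (z + x) /\<^sub>R t"], of t 0] t by simp
  have "integrable lborel (\<lambda>y. plane_wave 0 y * h y)"
    unfolding eq by (intro integrable_mult_right base)
  thus "integrable lborel h" by simp
  have "(LBINT y. plane_wave z y * h y)
     = complex_of_real K * (LBINT y. iexp ((- (z + x) /\<^sub>R t) \<bullet> (t *\<^sub>R y)) * complex_of_real (gauss (t *\<^sub>R y)))"
    unfolding eq by simp
  also have "(LBINT y. iexp ((- (z + x) /\<^sub>R t) \<bullet> (t *\<^sub>R y)) * complex_of_real (gauss (t *\<^sub>R y)))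
     = complex_of_real (exp (- (norm (- (z + x) /\<^sub>R t))\<^sup>2 / 2)) / complex_of_real (t ^ CARD('d))"
  proof -
    define v where "v = - (z + x) /\<^sub>R t"
    have e: "complex_of_real (exp (- (norm v)\<^sup>2 / 2)) =
        complex_of_real (t ^ CARD('d)) * (LBINT y. iexp (v \<bullet> (t *\<^sub>R y)) * complex_of_real (gauss (t *\<^sub>R y)))"
      using integral_affine[of "\<lambda>y. iexp (v \<bullet> y) * complex_of_real (gauss y)" t 0] t
      by (simp add: gauss_fourier(2) scaleR_conv_of_real)
    have nz: "complex_of_real (t ^ CARD('d)) \<noteq> 0" using t by simp
    have "c = a / b" if "a = b * c" "b \<noteq> 0" for a b c :: complex
      using that by simp
    from this[OF e nz] show ?thesis unfolding v_def .
  qed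
  also have "complex_of_real (exp (- (norm (- (z + x) /\<^sub>R t))\<^sup>2 / 2)) = complex_of_real K * complex_of_real (gauss ((z + x) /\<^sub>R t))"
  proof -
    have "norm (- (z + x) /\<^sub>R t) = norm ((z + x) /\<^sub>R t)" by (metis norm_minus_cancel scaleR_minus_right)
    thus ?thesis using K by (simp add: gauss_def K_def)
  qed
  finally have "(LBINT y. plane_wave z y * h y)
     = complex_of_real (K * K * heat_kernel t (z + x))"
    by (simp add: heat_kernel_def mult_ac)
  moreover have "(2 * pi) powr (- real CARD('d) / 2) = 1 / K"
    by (simp add: K_def powr_minus_divide)
  moreover have "1 / K * (K * K * a) = K * a" for a using K by simp
  ultimately show "fourier h z = complex_of_real ((2 * pi) powr (real CARD('d) / 2) * heat_kernel t (z + x))"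
    by (simp only: fourier_lborel[OF \<open>h \<in> borel_measurable borel\<close>] K_def[symmetric] flip: of_real_mult)
qed

text \<open>A double Fourier transform need not converge for integrable \<open>f\<close>; with Gaussian damping it does and
  it is a convolution with the heat kernel. Both the inversion formula and the bound on \<open>L^2\<close> norms
  are limits of this identity.\<close>

lemma fourier_fourier_damped:
  fixes f :: "real^'d::finite \<Rightarrow> complex"
  assumes f: "integrable lborel f" and t: "t > 0"
  shows "fourier (\<lambda>y. fourier f y * complex_of_real (exp (- (t * norm y)\<^sup>2 / 2))) x
     = (LBINT z. f z * complex_of_real (heat_kernel t (z + x)))"
proof -
  note [measurable] = fourier_measurable[OF f]
  define h where "h = (\<lambda>y. plane_wave x y * complex_of_real (exp (- (t * norm y)\<^sup>2 / 2)))"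
  define K where "K = (2 * pi) powr (real CARD('d) / 2)"
  have K: "K > 0" by (simp add: K_def)
  have cK: "(2 * pi) powr (- real CARD('d) / 2) = 1 / K"
    by (simp add: K_def powr_minus_divide)
  have "fourier (\<lambda>y. fourier f y * complex_of_real (exp (- (t * norm y)\<^sup>2 / 2))) x
     = complex_of_real (1 / K) * (LBINT y. fourier f y * h y)"
    by (subst fourier_lborel[of "\<lambda>y. fourier f y * complex_of_real (exp (- (t * norm y)\<^sup>2 / 2))"], measurable)
      (simp only: cK, simp add: h_def mult_ac)
  also have "(LBINT y. fourier f y * h y) = (LBINT z. f z * fourier h z)"
    unfolding h_def by (rule fourier_multiplication[OF f fourier_damped_exp(1)[OF t]])
  also have "\<dots> = (LBINT z. complex_of_real K * (f z * complex_of_real (heat_kernel t (z + x))))"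
    unfolding h_def fourier_damped_exp(2)[OF t] K_def by (simp add: mult_ac)
  also have "\<dots> = complex_of_real K * (LBINT z. f z * complex_of_real (heat_kernel t (z + x)))"
    by simp
  finally show ?thesis using K by simp
qed

lemma damping_tendsto:
  "(\<lambda>n. exp (- (1 / (real n + 1) * norm y)\<^sup>2 / 2)) \<longlonglongrightarrow> 1"
proof -
  have "(\<lambda>n. 1 / (real n + 1)) \<longlonglongrightarrow> 0" using LIMSEQ_Suc[OF lim_1_over_n] by (simp add: add.commute)
  hence "(\<lambda>n. exp (- (1 / (real n + 1) * norm y)\<^sup>2 / 2)) \<longlonglongrightarrow> exp (- (0 * norm y)\<^sup>2 / 2)"
    by (intro tendsto_intros) auto
  thus ?thesis by simp
qed

text \<open>This is the limit \<open>t \<rightarrow> 0\<close> of \<open>fourier_fourier_damped\<close>: dominated convergence gives the double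
  transform on the left, and on the right the heat kernel concentrates at \<open>z = -x\<close>.\<close>

theorem fourier_inversion:
  fixes f :: "real^'d::finite \<Rightarrow> complex"
  assumes f: "f \<in> schwartz"
  shows "fourier (fourier f) x = f (- x)"
proof -
  note [measurable] = schwartz_measurable[OF f] schwartz_measurable[OF fourier_schwartz[OF f]]
  have int: "integrable lborel f" "integrable lborel (fourier f)"
    by (intro schwartz_integrable fourier_schwartz f)+
  define t where "t = (\<lambda>n. 1 / (real n + 1))"
  have t: "t n > 0" for n by (simp add: t_def)
  have t0: "t \<longlonglongrightarrow> 0" unfolding t_def using LIMSEQ_Suc[OF lim_1_over_n] by (simp add: add.commute)
  define c where "c = complex_of_real ((2 * pi) powr (- real CARD('d) / 2))"
  have lim1: "(\<lambda>n. fourier (\<lambda>y. fourier f y * complex_of_real (exp (- (t n * norm y)\<^sup>2 / 2))) x) \<longlonglongrightarrow> fourier (fourier f) x"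
  proof -
    have "(\<lambda>n. LBINT y. plane_wave x y * (fourier f y * complex_of_real (exp (- (t n * norm y)\<^sup>2 / 2))))
       \<longlonglongrightarrow> (LBINT y. plane_wave x y * fourier f y)"
    proof (rule integral_dominated_convergence[where w="\<lambda>y. norm (fourier f y)"])
      show "AE y in lborel. (\<lambda>n. plane_wave x y * (fourier f y * complex_of_real (exp (- (t n * norm y)\<^sup>2 / 2))))
         \<longlonglongrightarrow> plane_wave x y * fourier f y"
        (is "AE y in _. ?P y")
      proof (rule AE_I2)
        fix y
        have "(\<lambda>n. plane_wave x y * (fourier f y * complex_of_real (exp (- (t n * norm y)\<^sup>2 / 2))))
         \<longlonglongrightarrow> plane_wave x y * (fourier f y * complex_of_real 1)"
          unfolding t_def by (intro tendsto_intros damping_tendsto)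
        thus "?P y" by simp
      qed
    qed (use int in \<open>auto simp: norm_mult mult_left_le\<close>)
    thus ?thesis
      by (subst (1 2) fourier_lborel) (auto intro: tendsto_mult_left)
  qed
  have lim2: "(\<lambda>n. LBINT z. f z * complex_of_real (heat_kernel (t n) (z + x))) \<longlonglongrightarrow> f (- x)"
  proof -
    have eq: "(LBINT z. f z * complex_of_real (heat_kernel (t n) (z + x)))
        = (LBINT z. f (- x + t n *\<^sub>R z) * complex_of_real (gauss z))" for n
    proof -
      have "(LBINT z. f z * complex_of_real (heat_kernel (t n) (z + x)))
        = \<bar>t n\<bar> ^ DIM(real^'d) *\<^sub>R (LBINT z. f (- x + t n *\<^sub>R z) * complex_of_real (heat_kernel (t n) (- x + t n *\<^sub>R z + x)))"
        using t[of n] by (intro integral_affine) auto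
      also have "\<dots> = (LBINT z. \<bar>t n\<bar> ^ DIM(real^'d) *\<^sub>R (f (- x + t n *\<^sub>R z) * complex_of_real (heat_kernel (t n) (- x + t n *\<^sub>R z + x))))"
        by (rule Bochner_Integration.integral_scaleR_right[symmetric])
      also have "\<dots> = (LBINT z. f (- x + t n *\<^sub>R z) * complex_of_real (gauss z))"
      proof (intro Bochner_Integration.integral_cong refl)
        fix z
        have "heat_kernel (t n) (- x + t n *\<^sub>R z + x) = gauss z / t n ^ CARD('d)"
          using t[of n] by (simp add: heat_kernel_def)
        thus "\<bar>t n\<bar> ^ DIM(real^'d) *\<^sub>R (f (- x + t n *\<^sub>R z) * complex_of_real (heat_kernel (t n) (- x + t n *\<^sub>R z + x)))
           = f (- x + t n *\<^sub>R z) * complex_of_real (gauss z)"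
          using t[of n] by (simp only:) (simp add: scaleR_conv_of_real)
      qed
      finally show ?thesis .
    qed
    obtain C where C: "C \<ge> 0" "\<And>x. norm x ^ 0 * norm (f x) \<le> C" using schwartz_decay[OF f] by metis
    have "(\<lambda>n. LBINT z. f (- x + t n *\<^sub>R z) * complex_of_real (gauss z)) \<longlonglongrightarrow> (LBINT z::real^'d. f (- x) * complex_of_real (gauss z))"
    proof (rule integral_dominated_convergence[where w="\<lambda>z::real^'d. C * gauss z"])
      show "AE z in lborel. (\<lambda>n. f (- x + t n *\<^sub>R z) * complex_of_real (gauss z)) \<longlonglongrightarrow> f (- x) * complex_of_real (gauss z)"
      proof (intro AE_I2 tendsto_intros)
        fix z :: "real^'d"
        have "(\<lambda>n. - x + t n *\<^sub>R z) \<longlonglongrightarrow> - x + 0 *\<^sub>R z" by (intro tendsto_intros t0)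
        moreover have "isCont f (- x)" using schwartz_continuous[OF f] by (simp add: continuous_on_eq_continuous_at)
        ultimately show "(\<lambda>n. f (- x + t n *\<^sub>R z)) \<longlonglongrightarrow> f (- x)"
          by (intro isCont_tendsto_compose[of _ f]) auto
      qed
      show "AE z in lborel. norm (f (- x + t n *\<^sub>R z) * complex_of_real (gauss z)) \<le> C * gauss z" for n
        using C gauss_pos[THEN less_imp_le, of "_ :: real^'d"] by (auto intro!: AE_I2 mult_mono simp: norm_mult abs_of_nonneg)
    qed (use gauss_integrable in auto)
    moreover have "(LBINT z::real^'d. complex_of_real (gauss z)) = 1"
      using gauss_integral[where 'a="real^'d"] by simp
    ultimately show ?thesis unfolding eq by simp
  qed
  show ?thesis
    using lim1 lim2 unfolding fourier_fourier_damped[OF int(1) t] by (rule LIMSEQ_unique)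
qed

lemma norm_integral_le_nn_integral:
  fixes h :: "'a \<Rightarrow> 'b::{banach, second_countable_topology}"
  shows "ennreal (norm (\<integral>x. h x \<partial>M)) \<le> (\<integral>\<^sup>+x. ennreal (norm (h x)) \<partial>M)"
  by (cases "integrable M h") (auto simp: integral_norm_bound_ennreal not_integrable_integral_eq)

text \<open>The damped integral of \<open>|F f|^2\<close> is a double integral of \<open>f(k)\<close>, the conjugate of \<open>f(-z)\<close> and the
  heat kernel at \<open>z + k\<close>. As \<open>ab \<le> (a^2 + b^2)/2\<close> and the heat kernel has mass one in each variable, it
  is at most the integral of \<open>|f|^2\<close>. Fatou's lemma removes the damping.\<close>

theorem fourier_L2_le:
  fixes f :: "real^'d::finite \<Rightarrow> complex"
  assumes f: "integrable lborel f"
  shows "(\<integral>\<^sup>+x. ennreal ((norm (fourier f x))\<^sup>2) \<partial>lborel) \<le> (\<integral>\<^sup>+x. ennreal ((norm (f x))\<^sup>2) \<partial>lborel)"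
    (is "_ \<le> ?A")
proof -
  have [measurable]: "f \<in> borel_measurable borel" using f by simp
  note [measurable] = fourier_measurable[OF f]
  \<comment> \<open>The Fourier transform of \<open>f'\<close> is the conjugate of that of \<open>f\<close>.\<close>
  define f' where "f' = (\<lambda>z. cnj (f (- z)))"
  have f': "integrable lborel f'"
    using integrable_affine[OF f, of "-1" 0] by (simp add: f'_def)
  have [measurable]: "f' \<in> borel_measurable borel" using f' by simp
  have Ff': "fourier f' x = cnj (fourier f x)" for x
  proof -
    have "(LBINT y. plane_wave x y * f' y)
      = (LBINT y. plane_wave x ((0 + (-1) *\<^sub>R y)) * f' (0 + (-1) *\<^sub>R y))"
      by (subst integral_affine[where c="-1" and t=0]) auto
    also have "\<dots> = cnj (LBINT y. plane_wave x y * f y)"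
      by (subst Bochner_Integration.integral_cnj[symmetric]) (simp add: f'_def exp_cnj)
    finally show ?thesis by (simp add: fourier_lborel)
  qed
  have damped: "(\<integral>\<^sup>+x. ennreal ((norm (fourier f x))\<^sup>2 * exp (- (t * norm x)\<^sup>2 / 2)) \<partial>lborel) \<le> ?A"
    if t: "t > 0" for t
  proof -
    let ?e = "\<lambda>x::real^'d. exp (- (t * norm x)\<^sup>2 / 2)"
    let ?H = "\<lambda>z k::real^'d. ennreal (heat_kernel t (z + k))"
    let ?a = "\<lambda>k. ennreal ((norm (f k))\<^sup>2 / 2)" and ?b = "\<lambda>z. ennreal ((norm (f' z))\<^sup>2 / 2)"
    let ?c = "\<lambda>k. LBINT z. f' z * complex_of_real (heat_kernel t (z + k))"
    define g where "g = (\<lambda>x. fourier f' x * complex_of_real (?e x))"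
    have gau: "integrable lborel (\<lambda>x::real^'d. complex_of_real (?e x))"
      using fourier_damped_exp(1)[OF t, of "0::real^'d"] by simp
    define C where "C = (2 * pi) powr (- real CARD('d) / 2) * (LBINT x. norm (f x))"
    have C: "norm (fourier f x) \<le> C" for x unfolding C_def by (rule norm_fourier_le[OF f])
    have C0: "C \<ge> 0" using C[of 0] norm_ge_zero order_trans by blast
    have g: "integrable lborel g"
    proof (rule Bochner_Integration.integrable_bound)
      show "integrable lborel (\<lambda>x::real^'d. complex_of_real C * complex_of_real (?e x))"
        using gau by (rule integrable_mult_right)
      show "g \<in> borel_measurable lborel" unfolding g_def using fourier_measurable[OF f'] by simp
      show "AE x in lborel. norm (g x) \<le> norm (complex_of_real C * complex_of_real (?e x))"
        using C C0 by (auto simp: g_def Ff' norm_mult intro!: mult_right_mono)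
    qed
    have sq: "fourier f x * g x = complex_of_real ((norm (fourier f x))\<^sup>2 * ?e x)" for x
      by (simp add: g_def Ff' complex_norm_square del: of_real_power flip: mult.assoc)
    have int: "integrable lborel (\<lambda>x. fourier f x * g x)"
    proof (rule Bochner_Integration.integrable_bound)
      show "integrable lborel (\<lambda>x. complex_of_real C * g x)" using g by (rule integrable_mult_right)
      show "(\<lambda>x. fourier f x * g x) \<in> borel_measurable lborel" using g by measurable
      show "AE x in lborel. norm (fourier f x * g x) \<le> norm (complex_of_real C * g x)"
        using C C0 by (auto simp: norm_mult intro!: mult_right_mono)
    qed
    hence intr: "integrable lborel (\<lambda>x. (norm (fourier f x))\<^sup>2 * ?e x)"
      unfolding sq by (simp only: complex_of_real_integrable_eq)
    have "(\<integral>\<^sup>+x. ennreal ((norm (fourier f x))\<^sup>2 * ?e x) \<partial>lborel)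
       = ennreal (norm (LBINT x. fourier f x * g x))"
      unfolding sq using intr by (subst nn_integral_eq_integral) (auto intro!: integral_nonneg simp del: of_real_mult of_real_exp of_real_power)
    also have "(LBINT x. fourier f x * g x) = (LBINT k. f k * fourier g k)"
      by (rule fourier_multiplication[OF f g])
    also have "\<dots> = (LBINT k. f k * ?c k)"
      unfolding g_def fourier_fourier_damped[OF f' t] ..
    also have "ennreal (norm \<dots>) \<le> (\<integral>\<^sup>+k. ennreal (norm (f k * ?c k)) \<partial>lborel)"
      by (rule norm_integral_le_nn_integral)
    also have "\<dots> \<le> (\<integral>\<^sup>+k. \<integral>\<^sup>+z. (?a k + ?b z) * ?H z k \<partial>lborel \<partial>lborel)"
    proof (rule nn_integral_mono)
      fix k
      have "ennreal (norm (f k * ?c k))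
         = ennreal (norm (LBINT z. f k * (f' z * complex_of_real (heat_kernel t (z + k)))))"
        by simp
      also have "\<dots> \<le> (\<integral>\<^sup>+z. ennreal (norm (f k * (f' z * complex_of_real (heat_kernel t (z + k))))) \<partial>lborel)"
        by (rule norm_integral_le_nn_integral)
      also have "\<dots> \<le> (\<integral>\<^sup>+z. (?a k + ?b z) * ?H z k \<partial>lborel)"
      proof (rule nn_integral_mono)
        fix z
        have "norm (f k) * norm (f' z) \<le> (norm (f k))\<^sup>2 / 2 + (norm (f' z))\<^sup>2 / 2"
          using sum_squares_bound[of "norm (f k)" "norm (f' z)"] by (simp add: field_simps)
        from mult_right_mono[OF this heat_kernel_nonneg[OF t, of "z + k"]]
        show "ennreal (norm (f k * (f' z * complex_of_real (heat_kernel t (z + k)))))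
           \<le> (?a k + ?b z) * ?H z k"
          using heat_kernel_nonneg[OF t, of "z + k"]
          by (simp add: norm_mult mult_ac flip: ennreal_plus ennreal_mult)
      qed
      finally show "ennreal (norm (f k * ?c k))
         \<le> (\<integral>\<^sup>+z. (?a k + ?b z) * ?H z k \<partial>lborel)" .
    qed
    also have "\<dots> = (\<integral>\<^sup>+k. \<integral>\<^sup>+z. ?a k * ?H z k \<partial>lborel \<partial>lborel)
        + (\<integral>\<^sup>+k. \<integral>\<^sup>+z. ?b z * ?H z k \<partial>lborel \<partial>lborel)"
      by (subst nn_integral_add[symmetric]) (auto simp: nn_integral_add distrib_right)
    also have "(\<integral>\<^sup>+k. \<integral>\<^sup>+z. ?a k * ?H z k \<partial>lborel \<partial>lborel)
        = (\<integral>\<^sup>+k. ?a k \<partial>lborel)"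
      by (simp add: nn_integral_cmult nn_integral_heat_kernel[OF t])
    also have "(\<integral>\<^sup>+k. \<integral>\<^sup>+z. ?b z * ?H z k \<partial>lborel \<partial>lborel)
        = (\<integral>\<^sup>+z. \<integral>\<^sup>+k. ?b z * ?H k z \<partial>lborel \<partial>lborel)"
      by (subst lborel_pair.Fubini') (auto simp: add.commute)
    also have "\<dots> = (\<integral>\<^sup>+z. ?b z \<partial>lborel)"
      by (simp add: nn_integral_cmult nn_integral_heat_kernel[OF t])
    also have "\<dots> = (\<integral>\<^sup>+z. ?a z \<partial>lborel)"
      by (subst nn_integral_affine[where c="-1" and t=0]) (auto simp: f'_def)
    also have "(\<integral>\<^sup>+z. ?a z \<partial>lborel) + (\<integral>\<^sup>+z. ?a z \<partial>lborel) = ?A"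
      by (subst nn_integral_add[symmetric]) (auto simp flip: ennreal_plus)
    finally show ?thesis .
  qed
  have "(\<integral>\<^sup>+x. ennreal ((norm (fourier f x))\<^sup>2) \<partial>lborel)
     = (\<integral>\<^sup>+x. liminf (\<lambda>n. ennreal ((norm (fourier f x))\<^sup>2 * exp (- (1 / (real n + 1) * norm x)\<^sup>2 / 2))) \<partial>lborel)"
  proof (rule nn_integral_cong)
    fix x :: "real^'d"
    have "(\<lambda>n. ennreal ((norm (fourier f x))\<^sup>2 * exp (- (1 / (real n + 1) * norm x)\<^sup>2 / 2))) \<longlonglongrightarrow> ennreal ((norm (fourier f x))\<^sup>2 * 1)"
      by (intro tendsto_ennrealI tendsto_intros damping_tendsto)
    from lim_imp_Liminf[OF _ this]
    show "ennreal ((norm (fourier f x))\<^sup>2) = liminf (\<lambda>n. ennreal ((norm (fourier f x))\<^sup>2 * exp (- (1 / (real n + 1) * norm x)\<^sup>2 / 2)))"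
      by simp
  qed
  also have "\<dots> \<le> liminf (\<lambda>n. \<integral>\<^sup>+x. ennreal ((norm (fourier f x))\<^sup>2 * exp (- (1 / (real n + 1) * norm x)\<^sup>2 / 2)) \<partial>lborel)"
    by (rule nn_integral_liminf) measurable
  also have "\<dots> \<le> liminf (\<lambda>n::nat. ?A)"
    by (intro Liminf_mono always_eventually allI damped) simp
  also have "\<dots> = ?A" by (simp add: Liminf_const)
  finally show ?thesis .
qed

text \<open>The translates converge pointwise almost everywhere and have constant \<open>L^1\<close> norm, so Scheffe's
  lemma applies. A singularity at the origin is allowed because that of the trial functions lies
  there.\<close>

lemma translation_L1_continuous:
  fixes f :: "'a::euclidean_space \<Rightarrow> 'b::{banach, second_countable_topology}"
  assumes f: "integrable lborel f" and cont: "\<And>k. k \<noteq> 0 \<Longrightarrow> isCont f k"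
  shows "((\<lambda>a. \<integral>\<^sup>+k. ennreal (norm (f (k - a) - f k)) \<partial>lborel) \<longlongrightarrow> 0) (at 0)"
  unfolding tendsto_at_iff_sequentially comp_def
proof (intro allI impI)
  have [measurable]: "f \<in> borel_measurable borel" using f by simp
  fix X :: "nat \<Rightarrow> 'a" assume X: "X \<longlonglongrightarrow> 0"
  show "(\<lambda>n. \<integral>\<^sup>+k. ennreal (norm (f (k - X n) - f k)) \<partial>lborel) \<longlonglongrightarrow> 0"
  proof (rule Scheffe_lemma2)
    show "AE k in lborel. (\<lambda>n. f (k - X n)) \<longlonglongrightarrow> f k"
      using AE_lborel_singleton[of "0::'a"]
    proof eventually_elim
      case (elim k)
      have "(\<lambda>n. k - X n) \<longlonglongrightarrow> k - 0" by (intro tendsto_intros X)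
      thus ?case using cont[OF elim] by (intro isCont_tendsto_compose[of _ f]) auto
    qed
    show "(\<integral>\<^sup>+k. ennreal (norm (f (k - X n))) \<partial>lborel) \<le> (\<integral>\<^sup>+k. ennreal (norm (f k)) \<partial>lborel)" for n
      by (subst nn_integral_affine[where c=1 and t="- X n" and f="\<lambda>k. ennreal (norm (f k))"]) auto
  qed (use f in auto)
qed

text \<open>Translation by \<open>a = \<pi> x / |x|^2\<close> changes the sign of the plane wave, so twice the Fourier transform
  at \<open>x\<close> is that of \<open>f(k) - f(k - a)\<close>, where \<open>|a| = \<pi> / |x|\<close> tends to zero.\<close>

theorem riemann_lebesgue:
  fixes f :: "real^'d::finite \<Rightarrow> complex"
  assumes f: "integrable lborel f" and cont: "\<And>k. k \<noteq> 0 \<Longrightarrow> isCont f k"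
  shows "(fourier f \<longlongrightarrow> 0) at_infinity"
proof -
  have [measurable]: "f \<in> borel_measurable borel" using f by simp
  define c where "c = (2 * pi) powr (- real CARD('d) / 2)"
  define a where "a = (\<lambda>x::real^'d. (pi / (norm x)\<^sup>2) *\<^sub>R x)"
  define \<omega> where "\<omega> = (\<lambda>a. \<integral>\<^sup>+k. ennreal (norm (f (k - a) - f k)) \<partial>lborel)"
  have norm_a: "norm (a x) = pi / norm x" for x
    by (simp add: a_def power2_eq_square)
  have bound: "ennreal (norm (fourier f x)) \<le> ennreal c * \<omega> (a x)" if x: "x \<noteq> 0" for x
  proof -
    define I where "I = (LBINT k. plane_wave x k * f k)"
    have int: "integrable lborel (\<lambda>k. plane_wave x k * f k)"
      by (rule fourier_integrand_integrable[OF f])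
    have ip: "x \<bullet> a x = pi" using x by (simp add: a_def power2_norm_eq_inner)
    have ph: "plane_wave x (- a x + 1 *\<^sub>R k) = - plane_wave x k" for k
    proof -
      have "- (\<i> * complex_of_real (x \<bullet> (- a x + 1 *\<^sub>R k))) = \<i> * complex_of_real pi + - (\<i> * complex_of_real (x \<bullet> k))"
        using ip by (simp add: inner_diff_right algebra_simps)
      thus ?thesis by (simp only: exp_add) simp
    qed
    have "I = (LBINT k. plane_wave x (- a x + 1 *\<^sub>R k) * f (- a x + 1 *\<^sub>R k))"
      unfolding I_def by (subst integral_affine[where c=1 and t="- a x"]) auto
    also have "\<dots> = (LBINT k. - (plane_wave x k * f (k - a x)))"
      unfolding ph by simp
    finally have I2: "I = (LBINT k. - (plane_wave x k * f (k - a x)))" .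
    have fa: "integrable lborel (\<lambda>k. f (k - a x))"
      using integrable_affine[OF f, of 1 "- a x"] by simp
    have int2: "integrable lborel (\<lambda>k. plane_wave x k * f (k - a x))"
      by (rule fourier_integrand_integrable[OF fa])
    have "I + I = (LBINT k. - (plane_wave x k * f (k - a x))) + (LBINT k. plane_wave x k * f k)"
      by (simp only: I2[symmetric] I_def[symmetric])
    also have "\<dots> = (LBINT k. - (plane_wave x k * f (k - a x)) + plane_wave x k * f k)"
      using int int2 by (intro Bochner_Integration.integral_add[symmetric]) auto
    also have "\<dots> = (LBINT k. - plane_wave x k * (f (k - a x) - f k))"
      by (intro Bochner_Integration.integral_cong refl) (simp add: right_diff_distrib)
    finally have "2 * I = (LBINT k. - plane_wave x k * (f (k - a x) - f k))" by simp
    hence "ennreal (norm (2 * I)) \<le> (\<integral>\<^sup>+k. ennreal (norm (- plane_wave x k * (f (k - a x) - f k))) \<partial>lborel)"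
      by (simp only: norm_integral_le_nn_integral)
    also have "\<dots> = \<omega> (a x)" by (simp add: \<omega>_def norm_mult)
    finally have "ennreal (norm (2 * I)) \<le> \<omega> (a x)" .
    moreover have "ennreal (norm I) \<le> ennreal (norm (2 * I))" by (intro ennreal_leI) (simp add: norm_mult)
    ultimately have "ennreal (norm I) \<le> \<omega> (a x)" by (rule order_trans[rotated])
    hence "ennreal c * ennreal (norm I) \<le> ennreal c * \<omega> (a x)" by (intro mult_left_mono) auto
    moreover have "norm (fourier f x) = c * norm I" by (simp add: fourier_lborel c_def I_def norm_mult)
    ultimately show ?thesis by (simp add: ennreal_mult c_def)
  qed
  have "filterlim a (at 0) at_infinity"
    unfolding filterlim_at
  proof
    show "\<forall>\<^sub>F x in at_infinity. a x \<in> UNIV \<and> a x \<noteq> 0"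
      unfolding eventually_at_infinity by (intro exI[of _ 1]) (auto simp: a_def)
    have "((\<lambda>x::real^'d. pi / norm x) \<longlongrightarrow> 0) at_infinity"
      by (intro real_tendsto_divide_at_top[OF tendsto_const] filterlim_norm_at_top)
    hence "((\<lambda>x. norm (a x)) \<longlongrightarrow> 0) at_infinity" by (simp add: norm_a)
    thus "(a \<longlongrightarrow> 0) at_infinity" by (rule tendsto_norm_zero_cancel)
  qed
  hence "((\<lambda>x. \<omega> (a x)) \<longlongrightarrow> 0) at_infinity"
    using translation_L1_continuous[OF f cont] unfolding \<omega>_def by (rule filterlim_compose[rotated])
  hence "((\<lambda>x. ennreal c * \<omega> (a x)) \<longlongrightarrow> ennreal c * 0) at_infinity"
    by (intro ennreal_tendsto_cmult) auto
  hence upper: "((\<lambda>x. ennreal c * \<omega> (a x)) \<longlongrightarrow> 0) at_infinity" by simp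
  have "((\<lambda>x. ennreal (norm (fourier f x))) \<longlongrightarrow> ennreal 0) at_infinity"
    unfolding ennreal_0
  proof (rule tendsto_sandwich[OF _ _ tendsto_const upper])
    show "\<forall>\<^sub>F x in at_infinity. ennreal (norm (fourier f x)) \<le> ennreal c * \<omega> (a x)"
      unfolding eventually_at_infinity by (intro exI[of _ 1]) (auto intro!: bound)
  qed simp
  hence "((\<lambda>x. norm (fourier f x)) \<longlongrightarrow> 0) at_infinity"
    by (rule tendsto_ennrealD) auto
  thus ?thesis by (rule tendsto_norm_zero_cancel)
qed

section \<open>Fractional powers of the Laplacian on Fourier transforms\<close>

lemma fourier_reflect:
  fixes f :: "real^'d::finite \<Rightarrow> complex"
  assumes [measurable]: "f \<in> borel_measurable borel"
  shows "fourier (\<lambda>k. f (- k)) x = fourier f (- x)"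
proof -
  have "(LBINT y. plane_wave (- x) y * f y)
    = (LBINT y. plane_wave x y * f (- y))"
    by (subst integral_affine[where c="-1" and t=0]) auto
  thus ?thesis by (simp add: fourier_lborel)
qed

lemma partials_fourier:
  assumes f: "f \<in> schwartz"
  shows "partials js (fourier f) = fourier (\<lambda>x. (- \<i>) ^ length js * (monomial js x *\<^sub>R f x))"
proof (induction js)
  case Nil
  then show ?case by simp
next
  case (Cons i js)
  have "(\<lambda>x. (- \<i>) ^ length js * (monomial js x *\<^sub>R f x)) \<in> schwartz"
    by (intro schwartz_scale schwartz_monomial f)
  from partial_fourier[OF this, of i] show ?case
    by (simp add: Cons.IH scaleR_conv_of_real mult_ac)
qed

lemma partials_fourier_0:
  fixes f :: "real^'d::finite \<Rightarrow> complex"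
  assumes f: "f \<in> schwartz"
  shows "partials js (fourier f) 0 = complex_of_real ((2 * pi) powr (- real CARD('d) / 2)) *
    ((- \<i>) ^ length js * (\<integral>x. monomial js x *\<^sub>R f x \<partial>lebesgue))"
proof -
  note [measurable] = schwartz_measurable[OF f] schwartz_measurable[OF schwartz_monomial[OF f]]
  have "(\<integral>x. monomial js x *\<^sub>R f x \<partial>lebesgue) = (LBINT x. monomial js x *\<^sub>R f x)"
    by (rule integral_completion) simp
  note lb = this
  have "plane_wave 0 x = 1" for x :: "real^'d" by simp
  thus ?thesis
    unfolding partials_fourier[OF f] lb
    by (subst fourier_lborel, intro schwartz_measurable schwartz_scale schwartz_monomial f)
      (simp only: mult_1_left integral_mult_right_zero)
qed

lemma PhiD: "f \<in> Phi_space \<Longrightarrow> f \<in> schwartz"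
  by (simp add: Phi_space_def)

lemma fourier_Phi:
  assumes "f \<in> Phi_space"
  shows "fourier f \<in> Psi_space"
  using assms fourier_schwartz[OF PhiD[OF assms]] partials_fourier_0[OF PhiD[OF assms]]
  by (simp add: Phi_space_def Psi_space_def)

text \<open>The moments of \<open>F f\<close> are, up to factors, the derivatives at the origin of \<open>F (F f)\<close>, which is the
  reflection of \<open>f\<close>.\<close>

lemma fourier_Psi:
  fixes f :: "real^'d::finite \<Rightarrow> complex"
  assumes f: "f \<in> Psi_space"
  shows "fourier f \<in> Phi_space"
proof -
  have S: "f \<in> schwartz" "fourier f \<in> schwartz" using PsiD(1)[OF f] fourier_schwartz by auto
  have "fourier (fourier f) = (\<lambda>x. f (- x))" using fourier_inversion[OF S(1)] by auto
  hence "partials ms (fourier (fourier f)) 0 = 0" for ms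
    using Psi_reflect[OF f] by (simp add: Psi_space_def)
  hence "(\<integral>x. monomial ms x *\<^sub>R fourier f x \<partial>lebesgue) = 0" for ms
    using partials_fourier_0[OF S(2), of ms] by simp
  thus ?thesis using S by (simp add: Phi_space_def)
qed

lemma inj_on_fourier: "inj_on fourier (schwartz :: (real^'d::finite \<Rightarrow> complex) set)"
proof (rule inj_onI)
  fix f g :: "real^'d \<Rightarrow> complex" assume *: "f \<in> schwartz" "g \<in> schwartz" "fourier f = fourier g"
  have "f x = g x" for x
    using fourier_inversion[OF *(1), of "- x"] fourier_inversion[OF *(2), of "- x"] *(3) by simp
  thus "f = g" by blast
qed

lemma inv_fourier_reflect:
  assumes "f \<in> schwartz"
  shows "inv_fourier (\<lambda>k. f (- k)) = fourier f"
  unfolding inv_fourier_def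
  by (rule inv_into_f_eq[OF inj_on_fourier fourier_schwartz[OF assms]])
    (use fourier_inversion[OF assms] in auto)

text \<open>The reflection in the definition of the dual transform turns the inverse transform back into the
  Fourier transform.\<close>

lemma fourier_dual_eq:
  assumes "\<psi> \<in> Psi_space"
  shows "fourier_dual u \<psi> = u (fourier \<psi>)"
  using assms by (simp add: fourier_dual_def inv_fourier_reflect[OF PsiD(1)])

text \<open>Every \<open>\<phi>\<close> in \<open>\<Phi>\<close> is the Fourier transform of an element of \<open>\<Psi>\<close>. Injectivity makes the inverse in
  the definition of \<open>D^s\<close> a genuine one.\<close>

lemma inj_on_fourier_dual: "inj_on fourier_dual (dual_space (Phi_space :: (real^'d::finite \<Rightarrow> complex) set))"
proof (rule inj_onI)
  fix u v :: "(real^'d \<Rightarrow> complex) \<Rightarrow> complex"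
  assume uv: "u \<in> dual_space Phi_space" "v \<in> dual_space Phi_space" "fourier_dual u = fourier_dual v"
  show "u = v"
  proof (rule extensionalityI[of _ Phi_space])
    show "u \<in> extensional Phi_space" "v \<in> extensional Phi_space" using uv by (auto simp: dual_space_def)
    fix \<phi> :: "real^'d \<Rightarrow> complex" assume \<phi>: "\<phi> \<in> Phi_space"
    \<comment> \<open>The preimage of \<open>\<phi>\<close> under the Fourier transform.\<close>
  define \<psi> where "\<psi> = (\<lambda>k. fourier \<phi> (- k))"
    have \<psi>: "\<psi> \<in> Psi_space" unfolding \<psi>_def by (intro Psi_reflect fourier_Phi \<phi>)
    have "fourier \<psi> = \<phi>"
      unfolding \<psi>_def using fourier_inversion[OF PhiD[OF \<phi>]]
      by (subst fourier_reflect[OF schwartz_measurable[OF fourier_schwartz[OF PhiD[OF \<phi>]]], abs_def]) simp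
    thus "u \<phi> = v \<phi>" using fourier_dual_eq[OF \<psi>, of u] fourier_dual_eq[OF \<psi>, of v] uv(3) by simp
  qed
qed

lemma topspace_schwartz_topology: "topspace schwartz_topology = (schwartz :: (real^'d::finite \<Rightarrow> complex) set)"
proof
  show "topspace schwartz_topology \<subseteq> (schwartz :: (real^'d \<Rightarrow> complex) set)"
    unfolding schwartz_topology_def topology_generated_by_topspace by auto
  show "(schwartz :: (real^'d \<Rightarrow> complex) set) \<subseteq> topspace schwartz_topology"
  proof
    fix f :: "real^'d \<Rightarrow> complex" assume f: "f \<in> schwartz"
    have "f \<in> {g \<in> schwartz. schwartz_seminorm [] [] (\<lambda>x. g x - f x) < 1}"
      using f by (simp add: schwartz_seminorm_def)
    moreover have "{g \<in> schwartz. schwartz_seminorm [] [] (\<lambda>x. g x - f x) < 1} \<in>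
      {{g \<in> schwartz. schwartz_seminorm ms js (\<lambda>x. g x - f x) < e} | ms js f e. f \<in> schwartz \<and> e > 0}"
      using f by (intro CollectI exI[of _ "[]"] exI[of _ f] exI[of _ "1::real"]) auto
    ultimately show "f \<in> topspace schwartz_topology"
      unfolding schwartz_topology_def topology_generated_by_topspace by blast
  qed
qed

lemma Phi_lincomb:
  fixes f g :: "real^'d::finite \<Rightarrow> complex"
  assumes f: "f \<in> Phi_space" and g: "g \<in> Phi_space"
  shows "(\<lambda>x. a * f x + b * g x) \<in> Phi_space"
proof -
  have S: "f \<in> schwartz" "g \<in> schwartz" using f g by (auto dest: PhiD)
  have int: "integrable lebesgue (\<lambda>x. monomial ms x *\<^sub>R h x)" if "h \<in> schwartz" for ms and h :: "real^'d \<Rightarrow> complex"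
    using schwartz_integrable[OF schwartz_monomial[OF that]] schwartz_measurable[OF schwartz_monomial[OF that]]
    by (subst integrable_completion) auto
  have "(\<integral>x. monomial ms x *\<^sub>R (a * f x + b * g x) \<partial>lebesgue) = 0" for ms
  proof -
    have "(\<integral>x. monomial ms x *\<^sub>R (a * f x + b * g x) \<partial>lebesgue)
      = (\<integral>x. a * (monomial ms x *\<^sub>R f x) + b * (monomial ms x *\<^sub>R g x) \<partial>lebesgue)"
      by (intro Bochner_Integration.integral_cong refl) (simp add: scaleR_conv_of_real algebra_simps)
    also have "\<dots> = a * (\<integral>x. monomial ms x *\<^sub>R f x \<partial>lebesgue) + b * (\<integral>x. monomial ms x *\<^sub>R g x \<partial>lebesgue)"
      by (subst Bochner_Integration.integral_add, (intro integrable_mult_right int S)+, simp only: integral_mult_right_zero)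
    finally show ?thesis using f g by (simp add: Phi_space_def)
  qed
  thus ?thesis using schwartz_add[OF schwartz_scale[OF S(1)] schwartz_scale[OF S(2)]] by (simp add: Phi_space_def)
qed

lemma bounded_pairing:
  fixes g f :: "real^'d::finite \<Rightarrow> complex"
  assumes [measurable]: "g \<in> borel_measurable borel" and B: "\<And>x. norm (g x) \<le> B" and f: "f \<in> schwartz"
  shows "integrable lborel (\<lambda>x. g x * f x)"
    and "norm (LBINT x. g x * f x) \<le> B * (LBINT x::real^'d. 1 / (1 + norm x ^ (CARD('d) + 1))) * decay_seminorm f"
proof -
  note [measurable] = schwartz_measurable[OF f]
  have B0: "B \<ge> 0" using B[of 0] norm_ge_zero order_trans by blast
  have le: "norm (g x * f x) \<le> B * norm (f x)" for x
    unfolding norm_mult by (intro mult_right_mono B) simp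
  show int: "integrable lborel (\<lambda>x. g x * f x)"
  proof (rule Bochner_Integration.integrable_bound)
    show "integrable lborel (\<lambda>x. B * norm (f x))" using schwartz_integrable[OF f] by simp
    show "AE x in lborel. norm (g x * f x) \<le> norm (B * norm (f x))"
      using le by (intro AE_I2) (auto intro: order_trans[OF _ abs_ge_self])
  qed simp
  have w: "integrable lborel (\<lambda>x::real^'d. 1 / (1 + norm x ^ (CARD('d) + 1)))"
    using polynomial_weight_integrable[where 'a="real^'d"] by simp
  have "norm (LBINT x. g x * f x) \<le> (LBINT x. norm (g x * f x))" by (rule integral_norm_bound)
  also have "\<dots> \<le> (LBINT x::real^'d. (B * decay_seminorm f) * (1 / (1 + norm x ^ (CARD('d) + 1))))"
  proof (intro integral_mono integrable_norm int integrable_mult_right w)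
    fix x
    have "norm (g x * f x) \<le> B * norm (f x)" by (rule le)
    also have "\<dots> \<le> B * (decay_seminorm f * (1 / (1 + norm x ^ (CARD('d) + 1))))"
      by (intro mult_left_mono schwartz_le_decay_seminorm f B0)
    finally show "norm (g x * f x) \<le> (B * decay_seminorm f) * (1 / (1 + norm x ^ (CARD('d) + 1)))" by simp
  qed
  also have "\<dots> = (B * decay_seminorm f) * (LBINT x::real^'d. 1 / (1 + norm x ^ (CARD('d) + 1)))"
    by (rule integral_mult_right_zero)
  finally show "norm (LBINT x. g x * f x) \<le> B * (LBINT x::real^'d. 1 / (1 + norm x ^ (CARD('d) + 1))) * decay_seminorm f"
    by (simp only: mult_ac)
qed

lemma to_dual_eq:
  fixes g f :: "real^'d::finite \<Rightarrow> complex"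
  assumes "g \<in> borel_measurable borel" "f \<in> Phi_space"
  shows "to_dual g f = (LBINT x. g x * f x)"
  using assms schwartz_measurable[OF PhiD[OF assms(2)]]
  by (simp add: to_dual_def integral_completion)

text \<open>A pairing with a bounded function is at most a multiple of \<open>decay_seminorm\<close>, a combination of
  finitely many seminorms; so a finite intersection of subbasic neighbourhoods of \<open>\<phi>\<close> is mapped
  close to the value at \<open>\<phi>\<close>.\<close>

lemma to_dual_in_dual_space:
  fixes g :: "real^'d::finite \<Rightarrow> complex"
  assumes g: "g \<in> borel_measurable borel" and B: "\<And>x. norm (g x) \<le> B"
  shows "to_dual g \<in> dual_space Phi_space"
  unfolding dual_space_def
proof (intro CollectI conjI ballI allI)
  show "to_dual g \<in> extensional Phi_space" by (simp add: to_dual_def)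
  fix \<phi> \<psi> :: "real^'d \<Rightarrow> complex" and a b assume *: "\<phi> \<in> Phi_space" "\<psi> \<in> Phi_space"
  have "(LBINT x. g x * (a * \<phi> x + b * \<psi> x)) = (LBINT x. a * (g x * \<phi> x) + b * (g x * \<psi> x))"
    by (intro Bochner_Integration.integral_cong refl) (simp add: algebra_simps)
  also have "\<dots> = a * (LBINT x. g x * \<phi> x) + b * (LBINT x. g x * \<psi> x)"
    using bounded_pairing(1)[OF g B PhiD[OF *(1)]] bounded_pairing(1)[OF g B PhiD[OF *(2)]] by simp
  finally show "to_dual g (\<lambda>x. a * \<phi> x + b * \<psi> x) = a * to_dual g \<phi> + b * to_dual g \<psi>"
    using * Phi_lincomb[OF *] by (simp add: to_dual_eq[OF g])
next
  define N where "N = CARD('d) + 1"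
  define Q where "Q = 1 + real CARD('d) ^ N * real CARD('d)"
  define C where "C = B * (LBINT x::real^'d. 1 / (1 + norm x ^ (CARD('d) + 1)))"
  have Q: "Q > 0" by (auto simp: Q_def intro: add_pos_nonneg)
  have B0: "B \<ge> 0" using B[of 0] norm_ge_zero order_trans by blast
  have C: "C \<ge> 0" unfolding C_def by (intro mult_nonneg_nonneg B0 Bochner_Integration.integral_nonneg) auto
  have sub: "(Phi_space :: (real^'d \<Rightarrow> complex) set) \<subseteq> schwartz" by (auto dest: PhiD)
  show "continuous_map (subtopology schwartz_topology Phi_space) euclidean (to_dual g)"
    unfolding continuous_map_def
  proof (intro conjI allI impI)
    fix U :: "complex set" assume "openin euclidean U"
    hence U: "open U" by simp
    let ?T = "subtopology schwartz_topology (Phi_space :: (real^'d \<Rightarrow> complex) set)"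
    have ts: "topspace ?T = Phi_space" using sub by (auto simp: topspace_schwartz_topology)
    show "openin ?T {\<phi> \<in> topspace ?T. to_dual g \<phi> \<in> U}"
      unfolding ts
    proof (subst openin_subopen, intro ballI)
      fix \<phi> assume "\<phi> \<in> {\<phi> \<in> Phi_space. to_dual g \<phi> \<in> U}"
      hence \<phi>: "\<phi> \<in> Phi_space" "to_dual g \<phi> \<in> U" by auto
      obtain e where e: "e > 0" "ball (to_dual g \<phi>) e \<subseteq> U" using U \<phi>(2) open_contains_ball by blast
      define \<delta> where "\<delta> = e / ((C + 1) * Q)"
      have \<delta>: "\<delta> > 0" using e C Q by (simp add: \<delta>_def)
      define S where "S = (\<lambda>ms. {h \<in> schwartz. schwartz_seminorm ms [] (\<lambda>x. h x - \<phi> x) < \<delta>})"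
      have S_open: "openin schwartz_topology (S ms)" for ms
        unfolding schwartz_topology_def S_def
        by (rule topology_generated_by_Basis) (use \<delta> PhiD[OF \<phi>(1)] in blast)
      define W where "W = S [] \<inter> (\<Inter>i\<in>UNIV. S (replicate N i))"
      have W_open: "openin schwartz_topology W"
        unfolding W_def by (intro openin_Int S_open openin_INT2) auto
      have "\<phi> \<in> W" using PhiD[OF \<phi>(1)] \<delta> by (simp add: W_def S_def schwartz_seminorm_def)
      moreover have "openin ?T (Phi_space \<inter> W)"
        by (rule openin_subtopology_Int2[OF W_open])
      moreover have "to_dual g h \<in> U" if h: "h \<in> Phi_space" "h \<in> W" for h
      proof -
        have D: "(\<lambda>x. h x - \<phi> x) \<in> Phi_space" using Phi_lincomb[OF h(1) \<phi>(1), of 1 "-1"] by simp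
        have "(\<Sum>i\<in>UNIV. schwartz_seminorm (replicate N i) [] (\<lambda>x. h x - \<phi> x)) \<le> (\<Sum>i\<in>(UNIV::'d set). \<delta>)"
          using h(2) by (intro sum_mono) (auto simp: W_def S_def intro: less_imp_le)
        hence "real CARD('d) ^ N * (\<Sum>i\<in>UNIV. schwartz_seminorm (replicate N i) [] (\<lambda>x. h x - \<phi> x)) \<le> real CARD('d) ^ N * (real CARD('d) * \<delta>)"
          by (intro mult_left_mono) simp_all
        moreover have "Q * \<delta> = \<delta> + real CARD('d) ^ N * (real CARD('d) * \<delta>)"
          by (simp add: Q_def algebra_simps)
        moreover have "schwartz_seminorm [] [] (\<lambda>x. h x - \<phi> x) \<le> \<delta>"
          using h(2) by (simp add: W_def S_def)
        ultimately have q: "decay_seminorm (\<lambda>x. h x - \<phi> x) \<le> Q * \<delta>"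
          unfolding decay_seminorm_def N_def[symmetric] by linarith
        have "to_dual g h - to_dual g \<phi> = (LBINT x. g x * (h x - \<phi> x))"
          using bounded_pairing(1)[OF g B PhiD[OF h(1)]] bounded_pairing(1)[OF g B PhiD[OF \<phi>(1)]]
          by (simp add: to_dual_eq[OF g] h \<phi> right_diff_distrib)
        hence "norm (to_dual g h - to_dual g \<phi>) \<le> C * decay_seminorm (\<lambda>x. h x - \<phi> x)"
          using bounded_pairing(2)[OF g B PhiD[OF D]] by (simp add: C_def)
        also have "\<dots> \<le> C * (Q * \<delta>)" by (intro mult_left_mono q C)
        also have "\<dots> = C / (C + 1) * e" using C Q by (simp add: \<delta>_def)
        also have "\<dots> < 1 * e" using C e by (intro mult_strict_right_mono) auto
        finally show ?thesis using e(2) by (auto simp: dist_norm norm_minus_commute)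
      qed
      ultimately show "\<exists>T. openin ?T T \<and> \<phi> \<in> T \<and> T \<subseteq> {\<phi> \<in> Phi_space. to_dual g \<phi> \<in> U}"
        using \<phi>(1) by (intro exI[of _ "Phi_space \<inter> W"]) auto
    qed
  qed auto
qed

text \<open>Paired with \<open>\<psi>\<close> in \<open>\<Psi>\<close>, both functionals give the integral of \<open>f(k) |k|^s \<psi>(-k)\<close>: the
  multiplication formula moves the Fourier transform to \<open>\<psi>\<close>, where inversion applies.\<close>

theorem D_pow_fourier:
  fixes f :: "real^'d::finite \<Rightarrow> complex"
  assumes f: "integrable lborel f" and fs: "integrable lborel (\<lambda>k. norm k powr s *\<^sub>R f k)"
  shows "D_pow s (to_dual (fourier f)) = to_dual (fourier (\<lambda>k. norm k powr s *\<^sub>R f k))"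
proof -
  define h where "h = (\<lambda>k. norm k powr s *\<^sub>R f k)"
  have pair: "fourier_dual (to_dual (fourier a)) \<psi> = (LBINT k. a k * \<psi> (- k))"
    if a: "integrable lborel a" and \<psi>: "\<psi> \<in> Psi_space" for a \<psi> :: "real^'d \<Rightarrow> complex"
  proof -
    have S: "\<psi> \<in> schwartz" by (rule PsiD(1)[OF \<psi>])
    have "fourier_dual (to_dual (fourier a)) \<psi> = (LBINT x. fourier a x * fourier \<psi> x)"
      by (simp add: fourier_dual_eq[OF \<psi>] to_dual_eq[OF fourier_measurable[OF a] fourier_Psi[OF \<psi>]])
    also have "\<dots> = (LBINT k. a k * fourier (fourier \<psi>) k)"
      by (rule fourier_multiplication[OF a schwartz_integrable[OF fourier_schwartz[OF S]]])
    finally show ?thesis by (simp add: fourier_inversion[OF S])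
  qed
  have "mult_norm_pow s (fourier_dual (to_dual (fourier f))) = fourier_dual (to_dual (fourier h))"
  proof (rule extensionalityI[of _ Psi_space])
    fix \<psi> :: "real^'d \<Rightarrow> complex" assume \<psi>: "\<psi> \<in> Psi_space"
    have eq: "(\<lambda>k. complex_of_real (rpow (norm k) s) * \<psi> k) = (\<lambda>k. norm k powr s *\<^sub>R \<psi> k)"
    proof
      fix k
      show "complex_of_real (rpow (norm k) s) * \<psi> k = norm k powr s *\<^sub>R \<psi> k"
        by (cases "k = 0") (auto simp: rpow_def scaleR_conv_of_real PsiD(3)[OF \<psi>])
    qed
    have "mult_norm_pow s (fourier_dual (to_dual (fourier f))) \<psi> = (LBINT k. f k * (norm k powr s *\<^sub>R \<psi> (- k)))"
      using \<psi> pair[OF f Psi_norm_powr[OF \<psi>, of s]] by (simp add: mult_norm_pow_def eq)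
    also have "\<dots> = fourier_dual (to_dual (fourier h)) \<psi>"
      using pair[OF fs \<psi>] by (simp add: h_def)
    finally show "mult_norm_pow s (fourier_dual (to_dual (fourier f))) \<psi> = fourier_dual (to_dual (fourier h)) \<psi>" .
  qed (auto simp: mult_norm_pow_def fourier_dual_def)
  moreover have "to_dual (fourier h) \<in> dual_space Phi_space"
    unfolding h_def by (rule to_dual_in_dual_space[OF fourier_measurable[OF fs] norm_fourier_le[OF fs]])
  ultimately show ?thesis
    unfolding D_pow_def inv_fourier_dual_def h_def[symmetric]
    by (simp add: inv_into_f_f[OF inj_on_fourier_dual])
qed

section \<open>The Macdonald function\<close>

lemma powr_exp_integrable:
  fixes p a :: real
  assumes p: "p > -1" and a: "a > 0"
  shows "set_integrable lborel {0<..} (\<lambda>t. t powr p * exp (- (a * t)))"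
proof -
  have "set_integrable lebesgue {0<..} (\<lambda>t. complex_of_real t powr (complex_of_real (p + 1) - 1) / of_real (exp (a * t)))"
    by (rule absolutely_integrable_Gamma_integral) (use p a in auto)
  hence "integrable lebesgue (\<lambda>t. norm (indicator {0<..} t *\<^sub>R (complex_of_real t powr (complex_of_real (p + 1) - 1) / of_real (exp (a * t)))))"
    unfolding set_integrable_def by (rule integrable_norm)
  also have "(\<lambda>t. norm (indicator {0<..} t *\<^sub>R (complex_of_real t powr (complex_of_real (p + 1) - 1) / of_real (exp (a * t)))))
     = (\<lambda>t. indicator {0<..} t *\<^sub>R (t powr p * exp (- (a * t))))"
  proof
    fix t :: real
    show "norm (indicator {0<..} t *\<^sub>R (complex_of_real t powr (complex_of_real (p + 1) - 1) / of_real (exp (a * t))))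
      = indicator {0<..} t *\<^sub>R (t powr p * exp (- (a * t)))"
    proof (cases "t > 0")
      case True
      thus ?thesis by (simp add: norm_mult norm_inverse norm_powr_real_powr exp_minus divide_inverse)
    qed simp
  qed
  finally show ?thesis
    unfolding set_integrable_def by (subst (asm) integrable_completion) auto
qed

text \<open>For a natural exponent this follows from \<open>(y/N)^N \<le> (1 + y/N)^N \<le> exp y\<close>.\<close>

lemma powr_times_exp_bounded:
  fixes a :: real
  assumes "a \<ge> 0"
  obtains C where "C \<ge> 0" "\<And>y. y > 0 \<Longrightarrow> y powr a * exp (- y) \<le> C"
proof -
  define N where "N = nat \<lceil>a\<rceil> + 1"
  have N: "N > 0" "real N \<ge> a" using assms by (auto simp: N_def) linarith
  have "y powr a * exp (- y) \<le> 1 + real N ^ N" if y: "y > 0" for y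
  proof -
    have "y powr a \<le> 1 + y ^ N"
    proof (cases "y \<le> 1")
      case True
      have "y powr a \<le> 1" using True y assms by (intro powr_le1) auto
      thus ?thesis using y by (simp add: add_increasing2)
    next
      case False
      have "y powr a \<le> y powr real N" using False N by (intro powr_mono) auto
      thus ?thesis using y by (simp add: powr_realpow)
    qed
    also have "y ^ N \<le> real N ^ N * exp y"
    proof -
      have "(y / N) ^ N \<le> (1 + y / N) ^ N" using y N by (intro power_mono) auto
      also have "\<dots> \<le> exp y" by (rule exp_ge_one_plus_x_over_n_power_n) (use y N in auto)
      finally show ?thesis using N by (simp add: power_divide field_simps)
    qed
    finally have "y powr a * exp (- y) \<le> (1 + real N ^ N * exp y) * exp (- y)" by simp
    also have "\<dots> = exp (- y) + real N ^ N" by (simp add: distrib_right exp_minus)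
    also have "\<dots> \<le> 1 + real N ^ N" using y by simp
    finally show ?thesis .
  qed
  thus ?thesis by (intro that[of "1 + real N ^ N"]) (auto intro: add_nonneg_nonneg)
qed

lemma borel_measurable_cosh [measurable]: "cosh \<in> borel_measurable (borel :: real measure)"
  by (intro borel_measurable_continuous_onI continuous_intros)

text \<open>Half of the exponent \<open>x cosh t\<close> is at least \<open>x/2\<close> and gives the exponential decay. The other half
  is at least \<open>x exp(t)/4\<close> and is traded for the power \<open>(x exp t)^(-\<mu>-1/4)\<close>. The additional \<open>1/4\<close>
  makes the integral over \<open>t\<close> converge; it is less than \<open>1/2\<close>, which keeps the square of the bound
  on the trial functions integrable at the origin in dimension one.\<close>

lemma bessel_K_integrand_bound:
  fixes \<mu> :: real
  assumes \<mu>: "\<mu> \<ge> 0"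
  obtains C where "C \<ge> 0"
    "\<And>x t. x > 0 \<Longrightarrow> t > 0 \<Longrightarrow> exp (- x * cosh t) * cosh (\<mu> * t)
        \<le> C * (x powr (- \<mu> - 1/4) * exp (- x / 2)) * exp (- (1/4 * t))"
proof -
  define a where "a = \<mu> + 1/4"
  have a: "a \<ge> 0" using \<mu> by (simp add: a_def)
  obtain C where C: "C \<ge> 0" "\<And>y. y > 0 \<Longrightarrow> y powr a * exp (- y) \<le> C"
    using powr_times_exp_bounded[OF a] by metis
  have "exp (- x * cosh t) * cosh (\<mu> * t)
        \<le> (C * 4 powr a) * (x powr (- \<mu> - 1/4) * exp (- x / 2)) * exp (- (1/4 * t))"
    if x: "x > 0" and t: "t > 0" for x t
  proof -
    define y where "y = x * exp t / 4"
    have y: "y > 0" using x by (simp add: y_def)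
    have cosh1: "cosh t \<ge> 1" by (rule cosh_real_ge_1)
    have cosh2: "cosh t \<ge> exp t / 2" by (simp add: cosh_def)
    have "x * cosh t = x / 2 * cosh t + x / 2 * cosh t" by simp
    also have "\<dots> \<ge> x / 2 * 1 + x / 2 * (exp t / 2)"
      using x cosh1 cosh2 by (intro add_mono mult_left_mono) auto
    finally have "- x * cosh t \<le> - x / 2 + - y" by (simp add: y_def)
    hence e1: "exp (- x * cosh t) \<le> exp (- x / 2) * exp (- y)" by (simp only: exp_le_cancel_iff flip: exp_add)
    have ypow: "y powr a = x powr a * exp (a * t) / 4 powr a"
    proof -
      have "exp t powr a = exp (a * t)" by (simp add: powr_def)
      thus ?thesis using x by (simp add: y_def powr_mult powr_divide)
    qed
    have "exp (- y) \<le> C / y powr a" using C(2)[OF y] y by (simp add: field_simps)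
    also have "\<dots> = C * 4 powr a * (x powr (- a) * exp (- (a * t)))"
      using x by (simp add: ypow powr_minus exp_minus field_simps)
    finally have e2: "exp (- y) \<le> C * 4 powr a * (x powr (- a) * exp (- (a * t)))" .
    have e3: "cosh (\<mu> * t) \<le> exp (\<mu> * t)"
      using \<mu> t by (simp add: cosh_def)
    have "exp (- x * cosh t) * cosh (\<mu> * t) \<le> (exp (- x / 2) * (C * 4 powr a * (x powr (- a) * exp (- (a * t))))) * exp (\<mu> * t)"
      using e1 e2 e3 C(1) by (intro mult_mono order_trans[OF e1] mult_left_mono) auto
    also have "\<dots> = (C * 4 powr a) * (x powr (- a) * exp (- x / 2)) * (exp (- (a * t)) * exp (\<mu> * t))"
      by (simp only: mult_ac)
    also have "exp (- (a * t)) * exp (\<mu> * t) = exp (- (1/4 * t))"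
      by (simp add: a_def algebra_simps flip: exp_add)
    also have "- a = - \<mu> - 1/4" by (simp add: a_def)
    finally show ?thesis .
  qed
  thus ?thesis using C(1) by (intro that[of "C * 4 powr a"]) auto
qed

lemma exp_quarter_integrable: "set_integrable lborel {0<..} (\<lambda>t::real. exp (- (1/4 * t)))"
proof -
  have "set_integrable lborel {0<..} (\<lambda>t::real. t powr 0 * exp (- (1/4 * t)))"
    by (rule powr_exp_integrable) auto
  thus ?thesis
    by (rule set_integrable_cong[THEN iffD1, rotated -1]) auto
qed

lemma bessel_K_integrand_integrable:
  fixes \<mu> x :: real
  assumes \<mu>: "\<mu> \<ge> 0" and x: "x > 0"
  shows "set_integrable lborel {0<..} (\<lambda>t::real. exp (- x * cosh t) * cosh (\<mu> * t))"
proof -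
  obtain C where C: "C \<ge> 0" "\<And>x t. x > 0 \<Longrightarrow> t > 0 \<Longrightarrow> exp (- x * cosh t) * cosh (\<mu> * t)
        \<le> C * (x powr (- \<mu> - 1/4) * exp (- x / 2)) * exp (- (1/4 * t))"
    using bessel_K_integrand_bound[OF \<mu>] by metis
  have "set_integrable lborel {0<..} (\<lambda>t. C * (x powr (- \<mu> - 1/4) * exp (- x / 2)) * exp (- (1/4 * t)))"
    by (intro set_integrable_mult_right exp_quarter_integrable)
  thus ?thesis unfolding set_integrable_def
  proof (rule Bochner_Integration.integrable_bound)
    show "AE t in lborel. norm (indicator {0<..} t *\<^sub>R (exp (- x * cosh t) * cosh (\<mu> * t)))
      \<le> norm (indicator {0<..} t *\<^sub>R (C * (x powr (- \<mu> - 1/4) * exp (- x / 2)) * exp (- (1/4 * t))))"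
      using C(2)[OF x] C(1) by (intro AE_I2) (auto simp: abs_mult split: split_indicator)
  qed measurable
qed

lemma bessel_K_nonneg: "bessel_K \<mu> x \<ge> 0"
  unfolding bessel_K_def set_lebesgue_integral_def
  by (intro Bochner_Integration.integral_nonneg) auto

lemma bessel_K_bound:
  assumes \<mu>: "\<mu> \<ge> 0"
  obtains C where "C \<ge> 0" "\<And>x. x > 0 \<Longrightarrow> bessel_K \<mu> x \<le> C * (x powr (- \<mu> - 1/4) * exp (- x / 2))"
proof -
  obtain C where C: "C \<ge> 0" "\<And>x t. x > 0 \<Longrightarrow> t > 0 \<Longrightarrow> exp (- x * cosh t) * cosh (\<mu> * t)
        \<le> C * (x powr (- \<mu> - 1/4) * exp (- x / 2)) * exp (- (1/4 * t))"
    using bessel_K_integrand_bound[OF \<mu>] by metis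
  define I where "I = (LBINT t:{0<..}. exp (- (1/4 * t :: real)))"
  have I: "I \<ge> 0" unfolding I_def set_lebesgue_integral_def
    by (intro Bochner_Integration.integral_nonneg) auto
  have "bessel_K \<mu> x \<le> C * I * (x powr (- \<mu> - 1/4) * exp (- x / 2))" if x: "x > 0" for x
  proof -
    have "bessel_K \<mu> x \<le> (LBINT t:{0<..}. C * (x powr (- \<mu> - 1/4) * exp (- x / 2)) * exp (- (1/4 * t)))"
      unfolding bessel_K_def
      by (intro set_integral_mono bessel_K_integrand_integrable \<mu> x set_integrable_mult_right exp_quarter_integrable C(2)) auto
    also have "\<dots> = C * (x powr (- \<mu> - 1/4) * exp (- x / 2)) * I"
      unfolding I_def by (rule set_integral_mult_right)
    finally show ?thesis by (simp add: mult_ac)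
  qed
  thus ?thesis using C(1) I by (intro that[of "C * I"]) auto
qed

lemma continuous_on_bessel_K:
  assumes \<mu>: "\<mu> \<ge> 0"
  shows "continuous_on {0<..} (bessel_K \<mu>)"
proof (rule continuous_on_sequentiallyI)
  fix X :: "nat \<Rightarrow> real" and a assume X: "\<forall>n. X n \<in> {0<..}" "a \<in> {0<..}" "X \<longlonglongrightarrow> a"
  \<comment> \<open>Keeping the arguments above \<open>a/2\<close> provides an integrable majorant.\<close>
  define Y where "Y = (\<lambda>n. max (X n) (a / 2))"
  have a: "a > 0" using X by simp
  have Y: "Y \<longlonglongrightarrow> max a (a / 2)" unfolding Y_def by (intro tendsto_max X tendsto_const)
  hence Y: "Y \<longlonglongrightarrow> a" using a by (simp add: max_def)
  have "(\<lambda>n. bessel_K \<mu> (Y n)) \<longlonglongrightarrow> bessel_K \<mu> a"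
    unfolding bessel_K_def set_lebesgue_integral_def
  proof (rule integral_dominated_convergence[where w="\<lambda>t. indicator {0<..} t *\<^sub>R (exp (- (a / 2) * cosh t) * cosh (\<mu> * t))"])
    show "integrable lborel (\<lambda>t. indicator {0<..} t *\<^sub>R (exp (- (a / 2) * cosh t) * cosh (\<mu> * t)))"
      using bessel_K_integrand_integrable[OF \<mu>, of "a / 2"] a by (simp add: set_integrable_def)
    show "AE t in lborel. (\<lambda>n. indicator {0<..} t *\<^sub>R (exp (- Y n * cosh t) * cosh (\<mu> * t)))
        \<longlonglongrightarrow> indicator {0<..} t *\<^sub>R (exp (- a * cosh t) * cosh (\<mu> * t))"
      by (intro AE_I2 tendsto_intros Y)
    show "AE t in lborel. norm (indicator {0<..} t *\<^sub>R (exp (- Y n * cosh t) * cosh (\<mu> * t)))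
        \<le> indicator {0<..} t *\<^sub>R (exp (- (a / 2) * cosh t) * cosh (\<mu> * t))" for n
    proof (rule AE_I2)
      fix t :: real
      have "a / 2 * cosh t \<le> Y n * cosh t" by (intro mult_right_mono) (auto simp: Y_def)
      thus "norm (indicator {0<..} t *\<^sub>R (exp (- Y n * cosh t) * cosh (\<mu> * t)))
        \<le> indicator {0<..} t *\<^sub>R (exp (- (a / 2) * cosh t) * cosh (\<mu> * t))"
        by (auto split: split_indicator intro!: mult_right_mono simp: abs_mult)
    qed
  qed auto
  moreover have "\<forall>\<^sub>F n in sequentially. a / 2 < X n"
    using order_tendstoD(1)[OF X(3), of "a / 2"] a by simp
  hence "\<forall>\<^sub>F n in sequentially. bessel_K \<mu> (Y n) = bessel_K \<mu> (X n)"
    by eventually_elim (simp add: Y_def max_def)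
  ultimately show "(\<lambda>n. bessel_K \<mu> (X n)) \<longlonglongrightarrow> bessel_K \<mu> a"
    by (rule Lim_transform_eventually)
qed

section \<open>Radial trial functions\<close>

text \<open>The exponents \<open>p = n - j\<close>, \<open>2n - j\<close> and \<open>n\<close> give the Fourier transforms of the trial function \<open>f\<close>,
  of \<open>D^n f\<close> and of \<open>D^j f\<close>.\<close>

definition trial_profile :: "real \<Rightarrow> real \<Rightarrow> real \<Rightarrow> real \<Rightarrow> real \<Rightarrow> real" where
  "trial_profile j n \<epsilon> p \<xi> =
     (if \<xi> > 0 then \<xi> powr p * bessel_K (n - j) \<xi> / (\<xi>\<^sup>2 + \<epsilon>\<^sup>2) powr (n - j / 2) else 0)"

lemma continuous_on_trial_profile:
  assumes "j \<le> n" "\<epsilon> > 0"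
  shows "continuous_on {0<..} (trial_profile j n \<epsilon> p)"
proof -
  have pos: "\<xi>\<^sup>2 + \<epsilon>\<^sup>2 \<noteq> 0" for \<xi> :: real using assms(2) by (simp add: add_nonneg_eq_0_iff)
  have "continuous_on {0<..} (\<lambda>\<xi>. \<xi> powr p * bessel_K (n - j) \<xi> / (\<xi>\<^sup>2 + \<epsilon>\<^sup>2) powr (n - j / 2))"
    using assms pos by (intro continuous_intros continuous_on_bessel_K) auto
  thus ?thesis
    by (rule continuous_on_cong[THEN iffD1, rotated -1]) (auto simp: trial_profile_def)
qed

lemma trial_profile_measurable:
  assumes "j \<le> n" "\<epsilon> > 0"
  shows "trial_profile j n \<epsilon> p \<in> borel_measurable borel"
proof -
  have "(\<lambda>\<xi>. indicator {0<..} \<xi> *\<^sub>R trial_profile j n \<epsilon> p \<xi>) \<in> borel_measurable borel"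
    by (intro borel_measurable_continuous_on_indicator continuous_on_trial_profile assms) auto
  also have "(\<lambda>\<xi>. indicator {0<..} \<xi> *\<^sub>R trial_profile j n \<epsilon> p \<xi>) = trial_profile j n \<epsilon> p"
    by (auto simp: trial_profile_def split: split_indicator)
  finally show ?thesis .
qed

lemma trial_profile_bound:
  assumes j: "0 \<le> j" "j \<le> n" and \<epsilon>: "\<epsilon> > 0"
  obtains C where "C \<ge> 0" "\<And>\<xi>. \<xi> > 0 \<Longrightarrow> \<bar>trial_profile j n \<epsilon> p \<xi>\<bar> \<le> C * (\<xi> powr (p - (n - j) - 1/4) * exp (- \<xi> / 2))"
proof -
  define q where "q = n - j / 2"
  have q: "q \<ge> 0" using j by (simp add: q_def)
  obtain C where C: "C \<ge> 0" "\<And>x. x > 0 \<Longrightarrow> bessel_K (n - j) x \<le> C * (x powr (- (n - j) - 1/4) * exp (- x / 2))"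
    using bessel_K_bound[of "n - j"] j by auto
  have "\<bar>trial_profile j n \<epsilon> p \<xi>\<bar> \<le> (C / \<epsilon>\<^sup>2 powr q) * (\<xi> powr (p - (n - j) - 1/4) * exp (- \<xi> / 2))" if \<xi>: "\<xi> > 0" for \<xi>
  proof -
    have "(\<epsilon>\<^sup>2) powr q \<le> (\<xi>\<^sup>2 + \<epsilon>\<^sup>2) powr q" using q by (intro powr_mono2) auto
    moreover have "\<epsilon>\<^sup>2 powr q > 0" using \<epsilon> by simp
    ultimately have "\<bar>trial_profile j n \<epsilon> p \<xi>\<bar> \<le> \<xi> powr p * (C * (\<xi> powr (- (n - j) - 1/4) * exp (- \<xi> / 2))) / \<epsilon>\<^sup>2 powr q"
      using \<xi> C(2)[OF \<xi>] bessel_K_nonneg[of "n - j" \<xi>] C(1)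
      by (auto simp: trial_profile_def q_def[symmetric] abs_mult intro!: frac_le mult_left_mono)
    also have "\<xi> powr p * (C * (\<xi> powr (- (n - j) - 1/4) * exp (- \<xi> / 2))) = C * ((\<xi> powr p * \<xi> powr (- (n - j) - 1/4)) * exp (- \<xi> / 2))"
      by simp
    also have "\<xi> powr p * \<xi> powr (- (n - j) - 1/4) = \<xi> powr (p - (n - j) - 1/4)"
      by (simp add: algebra_simps flip: powr_add)
    finally show ?thesis by simp
  qed
  thus ?thesis using C(1) by (intro that[of "C / \<epsilon>\<^sup>2 powr q"]) auto
qed

text \<open>In polar coordinates the integrand is of order \<open>s^(d-1+q)\<close> near the origin, and \<open>d - 1 + q > -1\<close>
  in every dimension.\<close>

lemma radial_decay_integrable:
  fixes G :: "real \<Rightarrow> real"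
  assumes [measurable]: "G \<in> borel_measurable borel" and q: "q > -1" and a: "a > 0"
    and bound: "\<And>\<xi>. \<xi> > 0 \<Longrightarrow> \<bar>G \<xi>\<bar> \<le> C * (\<xi> powr q * exp (- (a * \<xi>)))"
  shows "integrable lborel (\<lambda>k::'a::euclidean_space. G (norm k))"
proof -
  define d where "d = DIM('a)"
  have d: "d > 0" by (simp add: d_def)
  have pw: "s ^ (d - 1) = s powr (real d - 1)" if "s > 0" for s :: real
    using that d by (simp add: of_nat_diff flip: powr_realpow)
  have "set_integrable lborel {0<..} (\<lambda>s. C * (s powr (real d - 1 + q) * exp (- (a * s))))"
    using d q a by (intro set_integrable_mult_right powr_exp_integrable) auto
  hence "set_integrable lborel {0<..} (\<lambda>s. s ^ (d - 1) *\<^sub>R G s)"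
    unfolding set_integrable_def
  proof (rule Bochner_Integration.integrable_bound)
    show "AE s in lborel. norm (indicator {0<..} s *\<^sub>R s ^ (d - 1) *\<^sub>R G s)
        \<le> norm (indicator {0<..} s *\<^sub>R (C * (s powr (real d - 1 + q) * exp (- (a * s)))))"
      (is "AE s in _. ?P s")
    proof (rule AE_I2)
      fix s :: real
      show "?P s"
      proof (cases "s > 0")
        case True
        have "s ^ (d - 1) * \<bar>G s\<bar> \<le> s ^ (d - 1) * (C * (s powr q * exp (- (a * s))))"
          using bound[OF True] True by (intro mult_left_mono) auto
        also have "\<dots> = C * (s powr (real d - 1 + q) * exp (- (a * s)))"
          using True unfolding pw[OF True] by (simp add: powr_add mult_ac)
        also note abs_ge_self
        finally show ?thesis using True by (simp add: abs_mult)
      qed simp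
    qed
  qed measurable
  thus ?thesis
    by (subst radial_integrable) (simp_all add: d_def)
qed

text \<open>The sine part of the plane wave is odd and integrates to zero; the factor \<open>(2\<pi>)^(d/2)\<close> of the Hankel
  formula cancels the normalisation of the Fourier transform.\<close>

lemma fourier_radial:
  fixes G :: "real \<Rightarrow> real" and x :: "real^'d::finite"
  assumes [measurable]: "G \<in> borel_measurable borel"
    and int: "integrable lborel (\<lambda>k::real^'d. G (norm k))"
  shows "fourier (\<lambda>k. complex_of_real (G (norm k))) x = complex_of_real
     (LBINT s:{0<..}. s ^ (CARD('d) - 1) * bessel_J_quot (CARD('d) / 2 - 1) (norm x * s) * G s)"
proof -
  have ic: "integrable lborel (\<lambda>k. cos (x \<bullet> k) * G (norm k))"
    by (rule Bochner_Integration.integrable_bound[OF int]) (auto simp: abs_mult mult_left_le_one_le)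
  have isn: "integrable lborel (\<lambda>k. sin (x \<bullet> k) * G (norm k))"
    by (rule Bochner_Integration.integrable_bound[OF int]) (auto simp: abs_mult mult_left_le_one_le)
  have "(LBINT k. sin (x \<bullet> k) * G (norm k)) = - (LBINT k. sin (x \<bullet> k) * G (norm k))"
    by (subst integral_affine[where c="-1" and t=0]) auto
  hence s0: "(LBINT k. sin (x \<bullet> k) * G (norm k)) = 0" by simp
  have "(LBINT k. plane_wave x k * complex_of_real (G (norm k)))
    = (LBINT k. complex_of_real (cos (x \<bullet> k) * G (norm k)) - \<i> * complex_of_real (sin (x \<bullet> k) * G (norm k)))"
  proof (intro Bochner_Integration.integral_cong refl)
    fix k
    have "plane_wave x k = complex_of_real (cos (x \<bullet> k)) - \<i> * complex_of_real (sin (x \<bullet> k))"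
      using cis_conv_exp[of "- (x \<bullet> k)"] by (simp add: complex_eq_iff cis.ctr)
    thus "plane_wave x k * complex_of_real (G (norm k))
      = complex_of_real (cos (x \<bullet> k) * G (norm k)) - \<i> * complex_of_real (sin (x \<bullet> k) * G (norm k))"
      by (simp only: left_diff_distrib of_real_mult mult.assoc)
  qed
  also have "\<dots> = complex_of_real (LBINT k. cos (x \<bullet> k) * G (norm k)) - \<i> * complex_of_real (LBINT k. sin (x \<bullet> k) * G (norm k))"
    using ic isn by (subst Bochner_Integration.integral_diff)
      (auto simp only: integral_complex_of_real integral_mult_right_zero complex_of_real_integrable_eq intro!: integrable_mult_right)
  also have "\<dots> = complex_of_real ((2 * pi) powr (CARD('d) / 2) *
     (LBINT s:{0<..}. s ^ (CARD('d) - 1) * bessel_J_quot (CARD('d) / 2 - 1) (norm x * s) * G s))"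
    using radial_cos_integral[OF assms] by (simp add: s0)
  finally have "fourier (\<lambda>k. complex_of_real (G (norm k))) x = complex_of_real ((2 * pi) powr (- real CARD('d) / 2) * ((2 * pi) powr (CARD('d) / 2) *
     (LBINT s:{0<..}. s ^ (CARD('d) - 1) * bessel_J_quot (CARD('d) / 2 - 1) (norm x * s) * G s)))"
    by (simp add: fourier_lborel)
  moreover have "(2 * pi) powr (- real CARD('d) / 2) * ((2 * pi) powr (CARD('d) / 2) * a) = a" for a
    by (simp add: powr_minus_divide)
  ultimately show ?thesis by (simp only:)
qed

section \<open>The lower bound\<close>

lemma norm_powr_2: "norm z powr 2 = (norm z)\<^sup>2"
  by (cases "norm z = 0") (simp_all flip: powr_numeral)

lemma fourier_in_L2:
  fixes f :: "real^'d::finite \<Rightarrow> complex"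
  assumes f: "integrable lborel f" and f2: "integrable lborel (\<lambda>x. (norm (f x))\<^sup>2)"
  shows "integrable lborel (\<lambda>x. (norm (fourier f x))\<^sup>2)"
    and "fourier f \<in> L_space 2"
    and "L_norm 2 (fourier f) \<le> sqrt (LBINT x. (norm (f x))\<^sup>2)"
proof -
  note [measurable] = fourier_measurable[OF f]
  have le: "(\<integral>\<^sup>+x. ennreal ((norm (fourier f x))\<^sup>2) \<partial>lborel) \<le> ennreal (LBINT x. (norm (f x))\<^sup>2)"
    using fourier_L2_le[OF f] nn_integral_eq_integral[OF f2] by simp
  show int: "integrable lborel (\<lambda>x. (norm (fourier f x))\<^sup>2)"
    by (rule integrableI_bounded) (use le in \<open>auto intro: le_less_trans\<close>)
  have le': "(LBINT x. (norm (fourier f x))\<^sup>2) \<le> (LBINT x. (norm (f x))\<^sup>2)"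
    using le int by (subst (asm) nn_integral_eq_integral) (auto intro!: Bochner_Integration.integral_nonneg)
  have "integrable lebesgue (\<lambda>x. (norm (fourier f x))\<^sup>2)"
    using int by (subst integrable_completion) simp_all
  thus "fourier f \<in> L_space 2"
    by (simp add: L_space_def norm_powr_2 measurable_completion)
  have "(\<integral>x. (norm (fourier f x))\<^sup>2 \<partial>lebesgue) = (LBINT x. (norm (fourier f x))\<^sup>2)"
    by (rule integral_completion) simp
  hence "L_norm 2 (fourier f) = (LBINT x. (norm (fourier f x))\<^sup>2) powr (1 / 2)"
    by (simp add: L_norm_def norm_powr_2)
  also have "\<dots> \<le> (LBINT x. (norm (f x))\<^sup>2) powr (1 / 2)"
    using le' by (intro powr_mono2) (auto intro!: Bochner_Integration.integral_nonneg)
  finally show "L_norm 2 (fourier f) \<le> sqrt (LBINT x. (norm (f x))\<^sup>2)"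
    by (simp add: powr_half_sqrt Bochner_Integration.integral_nonneg)
qed

text \<open>A bounded square integrable function has all higher integrable powers.\<close>

lemma fourier_in_Lr:
  fixes f :: "real^'d::finite \<Rightarrow> complex"
  assumes f: "integrable lborel f" and f2: "integrable lborel (\<lambda>x. (norm (f x))\<^sup>2)" and r: "r \<ge> 2"
  shows "fourier f \<in> L_space (ereal r)"
proof -
  note [measurable] = fourier_measurable[OF f]
  define C where "C = (2 * pi) powr (- real CARD('d) / 2) * (LBINT x. norm (f x))"
  have C: "norm (fourier f x) \<le> C" for x unfolding C_def by (rule norm_fourier_le[OF f])
  have "integrable lborel (\<lambda>x. norm (fourier f x) powr r)"
  proof (rule Bochner_Integration.integrable_bound)
    show "integrable lborel (\<lambda>x. C powr (r - 2) * (norm (fourier f x))\<^sup>2)"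
      using fourier_in_L2(1)[OF f f2] by (rule integrable_mult_right)
    show "AE x in lborel. norm (norm (fourier f x) powr r) \<le> norm (C powr (r - 2) * (norm (fourier f x))\<^sup>2)"
      (is "AE x in _. ?P x")
    proof (rule AE_I2)
      fix x
      have "norm (fourier f x) powr r = norm (fourier f x) powr (r - 2) * norm (fourier f x) powr 2"
        by (subst powr_add[symmetric]) simp
      also have "\<dots> \<le> C powr (r - 2) * (norm (fourier f x))\<^sup>2"
        unfolding norm_powr_2 using r C by (intro mult_right_mono powr_mono2) auto
      finally show "?P x" by simp
    qed
  qed simp
  hence "integrable lebesgue (\<lambda>x. norm (fourier f x) powr r)"
    by (subst integrable_completion) simp_all
  thus ?thesis by (simp add: L_space_def measurable_completion)
qed

lemma rpow_mono:
  assumes "0 \<le> x" "x \<le> y" "0 \<le> a"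
  shows "rpow x a \<le> rpow y a"
  using assms by (auto simp: rpow_def intro: powr_mono2)

lemma rpow_nonneg: "rpow x a \<ge> 0"
  by (simp add: rpow_def)

context
  fixes j n \<epsilon> :: real
  assumes j: "0 \<le> j" "j \<le> n" and \<epsilon>: "\<epsilon> > 0"
begin

definition trial :: "real \<Rightarrow> real^'d::finite \<Rightarrow> complex" where
  "trial p k = complex_of_real (trial_profile j n \<epsilon> p (norm k))"

text \<open>For \<open>p \<ge> n - j\<close> the profile is of order at most \<open>\<xi>^(-1/4)\<close> at the origin, and its square of order
  at most \<open>\<xi>^(-1/2)\<close>.\<close>

lemma profile_radial_integrable:
  assumes "p \<ge> n - j"
  shows "integrable lborel (\<lambda>k::'a::euclidean_space. trial_profile j n \<epsilon> p (norm k))"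
    and "integrable lborel (\<lambda>k::'a::euclidean_space. (trial_profile j n \<epsilon> p (norm k))\<^sup>2)"
proof -
  obtain C where C: "C \<ge> 0" "\<And>\<xi>. \<xi> > 0 \<Longrightarrow> \<bar>trial_profile j n \<epsilon> p \<xi>\<bar> \<le> C * (\<xi> powr (p - (n - j) - 1/4) * exp (- \<xi> / 2))"
    using trial_profile_bound[OF j \<epsilon>] by metis
  note [measurable] = trial_profile_measurable[OF j(2) \<epsilon>]
  define q where "q = p - (n - j) - 1/4"
  have q: "q \<ge> -1/4" using assms by (simp add: q_def)
  show "integrable lborel (\<lambda>k::'a. trial_profile j n \<epsilon> p (norm k))"
    using q C(2) by (intro radial_decay_integrable[where q=q and a="1/2" and C=C]) (auto simp: q_def)
  have "(trial_profile j n \<epsilon> p \<xi>)\<^sup>2 \<le> C\<^sup>2 * (\<xi> powr (2 * q) * exp (- (1 * \<xi>)))" if \<xi>: "\<xi> > 0" for \<xi>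
  proof -
    have "\<bar>trial_profile j n \<epsilon> p \<xi>\<bar>\<^sup>2 \<le> (C * (\<xi> powr q * exp (- \<xi> / 2)))\<^sup>2"
      using C(2)[OF \<xi>] unfolding q_def by (intro power_mono) auto
    also have "\<dots> = C\<^sup>2 * (\<xi> powr (2 * q) * exp (- \<xi>))"
      by (simp add: power_mult_distrib power2_eq_square mult_ac flip: powr_add exp_add)
    finally show ?thesis by simp
  qed
  thus "integrable lborel (\<lambda>k::'a. (trial_profile j n \<epsilon> p (norm k))\<^sup>2)"
    using q by (intro radial_decay_integrable[where q="2 * q" and a=1 and C="C\<^sup>2" and G="\<lambda>\<xi>. (trial_profile j n \<epsilon> p \<xi>)\<^sup>2"]) auto
qed

lemma trial_integrable:
  assumes "p \<ge> n - j"
  shows "integrable lborel (trial p :: real^'d::finite \<Rightarrow> complex)"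
    and "integrable lborel (\<lambda>k::real^'d::finite. (norm (trial p k))\<^sup>2)"
  using profile_radial_integrable[OF assms] by (auto simp: trial_def[abs_def])

lemma trial_norm_powr: "norm k powr s *\<^sub>R trial p k = trial (p + s) k"
  by (cases "k = 0") (auto simp: trial_def trial_profile_def scaleR_conv_of_real powr_add)

lemma D_pow_trial:
  fixes s :: real
  assumes "s \<ge> 0"
  shows "D_pow s (to_dual (fourier (trial (n - j) :: real^'d::finite \<Rightarrow> complex)))
    = to_dual (fourier (trial (n - j + s)))"
proof -
  have "(\<lambda>k::real^'d. norm k powr s *\<^sub>R trial (n - j) k) = trial (n - j + s)"
    by (intro ext trial_norm_powr)
  thus ?thesis
    using D_pow_fourier[of "trial (n - j) :: real^'d \<Rightarrow> complex" s] trial_integrable(1)[of "n - j + s"] trial_integrable(1)[of "n - j"] assms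
    by simp
qed

lemma trial_isCont:
  fixes k :: "real^'d::finite"
  assumes "k \<noteq> 0"
  shows "isCont (trial p) k"
proof -
  have "continuous_on (- {0::real^'d}) (\<lambda>k. trial_profile j n \<epsilon> p (norm k))"
    by (intro continuous_on_compose2[OF continuous_on_trial_profile[OF j(2) \<epsilon>]] continuous_intros) auto
  hence "continuous_on (- {0::real^'d}) (trial p)"
    unfolding trial_def by (intro continuous_intros)
  thus ?thesis using assms by (simp add: continuous_on_eq_continuous_at open_Compl)
qed

lemma trial_L2_norm:
  assumes "p \<ge> n - j"
  shows "(LBINT k::real^'d::finite. (norm (trial p k))\<^sup>2) = sphere_area CARD('d) *
    (LBINT \<xi>:{0<..}. \<xi> powr (2 * p + real CARD('d) - 1) * (bessel_K (n - j) \<xi>)\<^sup>2 / (\<xi>\<^sup>2 + \<epsilon>\<^sup>2) powr (2 * n - j))"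
proof -
  have m: "(\<lambda>\<xi>. (trial_profile j n \<epsilon> p \<xi>)\<^sup>2) \<in> borel_measurable borel"
    using trial_profile_measurable[OF j(2) \<epsilon>] by simp
  have "(LBINT k::real^'d. (norm (trial p k))\<^sup>2) = (LBINT k::real^'d. (trial_profile j n \<epsilon> p (norm k))\<^sup>2)"
    by (simp add: trial_def)
  also have "\<dots> = sphere_area CARD('d) * (LBINT \<xi>:{0<..}. \<xi> ^ (CARD('d) - 1) * (trial_profile j n \<epsilon> p \<xi>)\<^sup>2)"
    using radial_integral[OF m, where 'a="real^'d"] by simp
  also have "(LBINT \<xi>:{0<..}. \<xi> ^ (CARD('d) - 1) * (trial_profile j n \<epsilon> p \<xi>)\<^sup>2)
     = (LBINT \<xi>:{0<..}. \<xi> powr (2 * p + real CARD('d) - 1) * (bessel_K (n - j) \<xi>)\<^sup>2 / (\<xi>\<^sup>2 + \<epsilon>\<^sup>2) powr (2 * n - j))"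
  proof (rule set_lebesgue_integral_cong)
    show "\<forall>\<xi>. \<xi> \<in> {0<..} \<longrightarrow> \<xi> ^ (CARD('d) - 1) * (trial_profile j n \<epsilon> p \<xi>)\<^sup>2
       = \<xi> powr (2 * p + real CARD('d) - 1) * (bessel_K (n - j) \<xi>)\<^sup>2 / (\<xi>\<^sup>2 + \<epsilon>\<^sup>2) powr (2 * n - j)"
    proof (intro allI impI)
      fix \<xi> :: real assume "\<xi> \<in> {0<..}"
      hence \<xi>: "\<xi> > 0" by simp
      have "\<xi> powr (2 * p + real CARD('d) - 1) = \<xi> powr p * \<xi> powr p * \<xi> powr (real CARD('d) - 1)"
        by (simp only: powr_add[symmetric]) (simp add: algebra_simps)
      also have "\<xi> powr (real CARD('d) - 1) = \<xi> ^ (CARD('d) - 1)"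
        using \<xi> by (simp add: of_nat_diff flip: powr_realpow)
      finally have e1: "\<xi> powr (2 * p + real CARD('d) - 1) = \<xi> powr p * \<xi> powr p * \<xi> ^ (CARD('d) - 1)" .
      have e2: "(\<xi>\<^sup>2 + \<epsilon>\<^sup>2) powr (2 * n - j) = (\<xi>\<^sup>2 + \<epsilon>\<^sup>2) powr (n - j / 2) * (\<xi>\<^sup>2 + \<epsilon>\<^sup>2) powr (n - j / 2)"
        by (simp flip: powr_add)
      show "\<xi> ^ (CARD('d) - 1) * (trial_profile j n \<epsilon> p \<xi>)\<^sup>2
       = \<xi> powr (2 * p + real CARD('d) - 1) * (bessel_K (n - j) \<xi>)\<^sup>2 / (\<xi>\<^sup>2 + \<epsilon>\<^sup>2) powr (2 * n - j)"
        unfolding e1 e2 using \<xi> by (simp add: trial_profile_def power2_eq_square)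
    qed
  qed simp
  finally show ?thesis .
qed

lemma trial_L2_norm_U: "sqrt (LBINT k::real^'d::finite. (norm (trial (n - j) k))\<^sup>2) = GN_U CARD('d) j n \<epsilon>"
proof -
  have "2 * (n - j) + real CARD('d) - 1 = 2 * n - 2 * j + real CARD('d) - 1" by simp
  thus ?thesis by (subst trial_L2_norm) (simp_all only: GN_U_def order_refl)
qed

lemma trial_L2_norm_V: "sqrt (LBINT k::real^'d::finite. (norm (trial (n - j + n) k))\<^sup>2) = GN_V CARD('d) j n \<epsilon>"
proof -
  have e: "2 * (n - j + n) + real CARD('d) - 1 = 4 * n - 2 * j + real CARD('d) - 1" by simp
  have "n - j + n \<ge> n - j" using j by simp
  thus ?thesis by (subst trial_L2_norm) (simp_all only: GN_V_def e)
qed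

lemma GN_M_integrand_eq:
  assumes "d > 0" "\<xi> > 0"
  shows "GN_M_integrand d j n \<epsilon> \<rho> \<xi> = \<xi> ^ (d - 1) * bessel_J_quot (real d / 2 - 1) (\<rho> * \<xi>) * trial_profile j n \<epsilon> n \<xi>"
proof -
  have "\<xi> powr (n + real d - 1) = \<xi> powr n * \<xi> powr (real d - 1)" by (simp flip: powr_add add_diff_eq)
  also have "\<xi> powr (real d - 1) = \<xi> ^ (d - 1)"
    using assms by (simp add: of_nat_diff flip: powr_realpow)
  finally have e: "\<xi> powr (n + real d - 1) = \<xi> powr n * \<xi> ^ (d - 1)" .
  show ?thesis
    unfolding GN_M_integrand_def e using assms(2) by (simp add: trial_profile_def)
qed

lemma GN_M_eq:
  assumes "d > 0"
  shows "GN_M d j n \<epsilon> \<rho> = (LBINT s:{0<..}. s ^ (d - 1) * bessel_J_quot (real d / 2 - 1) (\<rho> * s) * trial_profile j n \<epsilon> n s)"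
  unfolding GN_M_def
  by (rule set_lebesgue_integral_cong) (auto simp: GN_M_integrand_eq[OF assms])

lemma fourier_trial:
  "fourier (trial n) (x::real^'d::finite) = complex_of_real (GN_M CARD('d) j n \<epsilon> (norm x))"
proof -
  have "integrable lborel (\<lambda>k::real^'d. trial_profile j n \<epsilon> n (norm k))"
    by (rule profile_radial_integrable) (use j in simp)
  from fourier_radial[OF trial_profile_measurable[OF j(2) \<epsilon>] this, of x]
  show ?thesis by (simp add: trial_def[abs_def] GN_M_eq)
qed

lemma weighted_profile_integrable:
  "integrable lborel (\<lambda>s. indicator {0<..} s * (s ^ (CARD('d::finite) - 1) * trial_profile j n \<epsilon> n s))"
proof -
  have "integrable lborel (\<lambda>k::real^'d. trial_profile j n \<epsilon> n (norm k))"
    by (rule profile_radial_integrable) (use j in simp)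
  thus ?thesis
    unfolding radial_integrable[OF trial_profile_measurable[OF j(2) \<epsilon>]] by (simp add: set_integrable_def)
qed

lemma bessel_J_quot_bound': "s \<ge> 0 \<Longrightarrow> \<bar>bessel_J_quot (real CARD('d::finite) / 2 - 1) s\<bar> \<le> bessel_J_quot (real CARD('d) / 2 - 1) 0"
  using bessel_J_quot_bound[where 'a="real^'d", OF refl, of s] by simp

lemma GN_M_integrand_bound:
  assumes \<rho>: "\<rho> \<ge> 0"
  shows "\<bar>indicator {0<..} s * GN_M_integrand CARD('d::finite) j n \<epsilon> \<rho> s\<bar> \<le>
    bessel_J_quot (real CARD('d) / 2 - 1) 0 * \<bar>indicator {0<..} s * (s ^ (CARD('d) - 1) * trial_profile j n \<epsilon> n s)\<bar>"
proof (cases "s > 0")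
  case True
  have "\<bar>bessel_J_quot (real CARD('d) / 2 - 1) (\<rho> * s)\<bar> * \<bar>s ^ (CARD('d) - 1) * trial_profile j n \<epsilon> n s\<bar>
    \<le> bessel_J_quot (real CARD('d) / 2 - 1) 0 * \<bar>s ^ (CARD('d) - 1) * trial_profile j n \<epsilon> n s\<bar>"
    using \<rho> True by (intro mult_right_mono bessel_J_quot_bound') auto
  thus ?thesis using True by (simp add: GN_M_integrand_eq abs_mult mult_ac)
qed simp

lemma GN_M_integrand_measurable:
  assumes \<rho>: "\<rho> \<ge> 0"
  shows "(\<lambda>s. indicator {0<..} s * GN_M_integrand CARD('d::finite) j n \<epsilon> \<rho> s) \<in> borel_measurable borel"
proof -
  note [measurable] = trial_profile_measurable[OF j(2) \<epsilon>, of n] bessel_J_quot_measurable[OF _ \<rho>, of "CARD('d)", simplified]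
  have "(\<lambda>s. (indicator {0<..} s * bessel_J_quot (real CARD('d) / 2 - 1) (\<rho> * s)) * (s ^ (CARD('d) - 1) * trial_profile j n \<epsilon> n s)) \<in> borel_measurable borel"
    by measurable
  also have "(\<lambda>s. (indicator {0<..} s * bessel_J_quot (real CARD('d) / 2 - 1) (\<rho> * s)) * (s ^ (CARD('d) - 1) * trial_profile j n \<epsilon> n s))
    = (\<lambda>s. indicator {0<..} s * GN_M_integrand CARD('d) j n \<epsilon> \<rho> s)"
    by (auto simp: GN_M_integrand_eq split: split_indicator)
  finally show ?thesis .
qed

lemma GN_M_integrand_integrable:
  assumes \<rho>: "\<rho> \<ge> 0"
  shows "set_integrable lborel {0<..} (GN_M_integrand CARD('d::finite) j n \<epsilon> \<rho>)"
  unfolding set_integrable_def real_scaleR_def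
proof (rule Bochner_Integration.integrable_bound)
  show "integrable lborel (\<lambda>s. bessel_J_quot (real CARD('d) / 2 - 1) 0 * \<bar>indicator {0<..} s * (s ^ (CARD('d) - 1) * trial_profile j n \<epsilon> n s)\<bar>)"
    by (intro integrable_mult_right integrable_abs weighted_profile_integrable)
  show "AE s in lborel. norm (indicator {0<..} s * GN_M_integrand CARD('d) j n \<epsilon> \<rho> s) \<le> norm (bessel_J_quot (real CARD('d) / 2 - 1) 0 * \<bar>indicator {0<..} s * (s ^ (CARD('d) - 1) * trial_profile j n \<epsilon> n s)\<bar>)"
    unfolding real_norm_def by (rule AE_I2, rule order_trans[OF GN_M_integrand_bound[OF \<rho>] abs_ge_self])
qed (use GN_M_integrand_measurable[OF \<rho>] in simp)

lemma continuous_on_GN_M: "continuous_on {0..} (GN_M CARD('d::finite) j n \<epsilon>)"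
proof (rule continuous_on_sequentiallyI)
  fix X :: "nat \<Rightarrow> real" and a assume X: "\<forall>n. X n \<in> {0..}" "a \<in> {0..}" "X \<longlonglongrightarrow> a"
  have "(\<lambda>i. LBINT s. indicator {0<..} s * GN_M_integrand CARD('d) j n \<epsilon> (X i) s)
     \<longlonglongrightarrow> (LBINT s. indicator {0<..} s * GN_M_integrand CARD('d) j n \<epsilon> a s)"
  proof (rule integral_dominated_convergence)
    show "integrable lborel (\<lambda>s. bessel_J_quot (real CARD('d) / 2 - 1) 0 * \<bar>indicator {0<..} s * (s ^ (CARD('d) - 1) * trial_profile j n \<epsilon> n s)\<bar>)"
      by (intro integrable_mult_right integrable_abs weighted_profile_integrable)
    show "AE s in lborel. norm (indicator {0<..} s * GN_M_integrand CARD('d) j n \<epsilon> (X i) s) \<le> bessel_J_quot (real CARD('d) / 2 - 1) 0 * \<bar>indicator {0<..} s * (s ^ (CARD('d) - 1) * trial_profile j n \<epsilon> n s)\<bar>" for i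
      using X(1) GN_M_integrand_bound[of "X i"] by (auto intro!: AE_I2)
    show "AE s in lborel. (\<lambda>i. indicator {0<..} s * GN_M_integrand CARD('d) j n \<epsilon> (X i) s) \<longlonglongrightarrow> indicator {0<..} s * GN_M_integrand CARD('d) j n \<epsilon> a s"
      (is "AE s in _. ?P s")
    proof (rule AE_I2)
      fix s :: real
      show "?P s"
      proof (cases "s > 0")
        case True
        have "continuous_on {0..} (bessel_J_quot (real CARD('d) / 2 - 1))"
          by (rule continuous_on_bessel_J_quot) simp
        moreover have "(\<lambda>i. X i * s) \<longlonglongrightarrow> a * s" by (intro tendsto_intros X)
        moreover have "a * s \<in> {0..}" "\<forall>\<^sub>F i in sequentially. X i * s \<in> {0..}"
          using X True by (auto intro!: always_eventually)
        ultimately have lim: "(\<lambda>i. bessel_J_quot (real CARD('d) / 2 - 1) (X i * s)) \<longlonglongrightarrow> bessel_J_quot (real CARD('d) / 2 - 1) (a * s)"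
          by (rule continuous_on_tendsto_compose)
        show ?thesis unfolding GN_M_integrand_eq[OF zero_less_card_finite True]
          by (intro tendsto_intros lim)
      qed simp
    qed
  qed (use GN_M_integrand_measurable X in auto)
  thus "(\<lambda>i. GN_M CARD('d) j n \<epsilon> (X i)) \<longlonglongrightarrow> GN_M CARD('d) j n \<epsilon> a"
    by (simp add: GN_M_def set_lebesgue_integral_def)
qed

text \<open>By \<open>fourier_trial\<close> the function is \<open>M(|x|)\<close>. For \<open>r = \<infinity>\<close> the norm takes all values in the half
  line, so both suprema agree; for finite \<open>r\<close> polar coordinates give the integral in \<open>Y\<close>.\<close>

lemma L_norm_fourier_trial:
  assumes r: "2 \<le> r"
  shows "(fourier (trial n) :: real^'d::finite \<Rightarrow> complex) \<in> L_space r"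
    and "L_norm r (fourier (trial n) :: real^'d::finite \<Rightarrow> complex) = GN_Y CARD('d) r j n \<epsilon>"
proof -
  have p: "n \<ge> n - j" using j by simp
  note int = trial_integrable[OF p, where 'd='d]
  note ft = fourier_trial[where 'd='d]
  have "(fourier (trial n) :: real^'d \<Rightarrow> complex) \<in> L_space r \<and> L_norm r (fourier (trial n) :: real^'d \<Rightarrow> complex) = GN_Y CARD('d) r j n \<epsilon>"
  proof (cases r)
    case PInf
    have "(fourier (trial n :: real^'d \<Rightarrow> complex) \<longlongrightarrow> 0) at_infinity"
      by (rule riemann_lebesgue[OF int(1) trial_isCont])
    hence "(fourier (trial n) :: real^'d \<Rightarrow> complex) \<in> L_space r"
      using continuous_on_fourier[OF int(1)] PInf by (simp add: L_space_def)
    moreover have "range (\<lambda>x::real^'d. \<bar>GN_M CARD('d) j n \<epsilon> (norm x)\<bar>) = (\<lambda>\<rho>. \<bar>GN_M CARD('d) j n \<epsilon> \<rho>\<bar>) ` {0..}"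
    proof -
      have "range (norm :: real^'d \<Rightarrow> real) = {0..}"
      proof (intro equalityI subsetI)
        fix \<rho> :: real assume "\<rho> \<in> {0..}"
        hence "norm (\<rho> *\<^sub>R axis undefined 1 :: real^'d) = \<rho>" by simp
        thus "\<rho> \<in> range (norm :: real^'d \<Rightarrow> real)" by (metis rangeI)
      qed auto
      thus ?thesis by (metis image_image)
    qed
    ultimately show ?thesis using PInf by (simp add: L_norm_def GN_Y_def ft)
  next
    case (real r')
    hence r': "r' \<ge> 2" using r by simp
    \<comment> \<open>The polar coordinate formula expects a function that is measurable on the whole line.\<close>
    define F where "F = (\<lambda>\<rho>. \<bar>GN_M CARD('d) j n \<epsilon> (max 0 \<rho>)\<bar> powr r')"
    have "continuous_on UNIV (\<lambda>\<rho>. GN_M CARD('d) j n \<epsilon> (max 0 \<rho>))"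
      by (intro continuous_on_compose2[OF continuous_on_GN_M] continuous_intros) auto
    hence "(\<lambda>\<rho>. GN_M CARD('d) j n \<epsilon> (max 0 \<rho>)) \<in> borel_measurable borel"
      by (rule borel_measurable_continuous_onI)
    hence F: "F \<in> borel_measurable borel" unfolding F_def by measurable
    have "integral\<^sup>L lebesgue (\<lambda>x::real^'d. norm (fourier (trial n) x) powr r') = integral\<^sup>L lebesgue (\<lambda>x::real^'d. F (norm x))"
      by (simp add: ft F_def max_def)
    also have "\<dots> = (LBINT x::real^'d. F (norm x))"
      using F by (intro integral_completion) simp
    also have "\<dots> = sphere_area CARD('d) * (LBINT \<rho>:{0<..}. \<rho> ^ (CARD('d) - 1) * F \<rho>)"
      using radial_integral[OF F, where 'a="real^'d"] by simp
    also have "(LBINT \<rho>:{0<..}. \<rho> ^ (CARD('d) - 1) * F \<rho>) = (LBINT \<rho>:{0<..}. \<rho> ^ (CARD('d) - 1) * \<bar>GN_M CARD('d) j n \<epsilon> \<rho>\<bar> powr r')"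
      by (rule set_lebesgue_integral_cong) (auto simp: F_def max_def)
    finally have "L_norm r (fourier (trial n) :: real^'d \<Rightarrow> complex) = GN_Y CARD('d) r j n \<epsilon>"
      using real by (simp add: L_norm_def GN_Y_def)
    thus ?thesis using fourier_in_Lr[OF int r'] real by simp
  next
    case MInf
    with r show ?thesis by simp
  qed
  thus "(fourier (trial n) :: real^'d \<Rightarrow> complex) \<in> L_space r"
    "L_norm r (fourier (trial n) :: real^'d \<Rightarrow> complex) = GN_Y CARD('d) r j n \<epsilon>" by auto
qed

text \<open>The trial function and its two derivatives are inserted into the inequality. The bounds
  \<open>\<parallel>f\<parallel> \<le> U\<close> and \<open>\<parallel>D^n f\<parallel> \<le> V\<close> enlarge its right-hand side to \<open>G U^(1-\<theta>) V^\<theta>\<close>. A vanishing denominator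
  would make the quotient zero, which is at most \<open>G\<close>.\<close>

lemma GN_lower_eps_le:
  assumes r: "2 \<le> r" and \<theta>: "0 \<le> \<theta>" "\<theta> \<le> 1" and G: "G \<in> GN_constants TYPE('d::finite) r j n \<theta>"
  shows "GN_lower_eps CARD('d) r j n \<theta> \<epsilon> \<le> G"
proof -
  define f :: "real^'d \<Rightarrow> complex" where "f = fourier (trial (n - j))"
  define g :: "real^'d \<Rightarrow> complex" where "g = fourier (trial (n - j + n))"
  define h :: "real^'d \<Rightarrow> complex" where "h = fourier (trial n)"
  have n: "n \<ge> 0" using j by simp
  have p: "n - j \<ge> n - j" "n - j + n \<ge> n - j" using n by auto
  have f: "f \<in> L_space 2" "L_norm 2 f \<le> GN_U CARD('d) j n \<epsilon>"
    unfolding f_def trial_L2_norm_U[symmetric] by (rule fourier_in_L2 trial_integrable p)+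
  have g: "g \<in> L_space 2" "L_norm 2 g \<le> GN_V CARD('d) j n \<epsilon>"
    unfolding g_def trial_L2_norm_V[symmetric] by (rule fourier_in_L2 trial_integrable p)+
  have Dg: "to_dual g = D_pow n (to_dual f)" unfolding f_def g_def by (rule D_pow_trial[OF n, symmetric])
  have Dh: "to_dual h = D_pow j (to_dual f)" unfolding f_def h_def using D_pow_trial[OF j(1), where 'd='d] by simp
  have h: "h \<in> L_space r" "L_norm r h = GN_Y CARD('d) r j n \<epsilon>"
    unfolding h_def by (rule L_norm_fourier_trial[OF r])+
  have "f \<in> H_space n" unfolding H_space_def mem_Collect_eq Dg[symmetric] using f(1) g(1) by blast
  hence le: "L_norm r h \<le> G * rpow (L_norm 2 f) (1 - \<theta>) * rpow (L_norm 2 g) \<theta>" and G0: "0 \<le> G"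
    using G g(1) h(1) Dg Dh by (auto simp: GN_constants_def)
  have L0: "L_norm 2 u \<ge> 0" for u :: "real^'d \<Rightarrow> complex" by (simp add: L_norm_def)
  define Den where "Den = rpow (GN_U CARD('d) j n \<epsilon>) (1 - \<theta>) * rpow (GN_V CARD('d) j n \<epsilon>) \<theta>"
  have Den: "Den \<ge> 0" unfolding Den_def by (intro mult_nonneg_nonneg rpow_nonneg)
  have "rpow (L_norm 2 f) (1 - \<theta>) * rpow (L_norm 2 g) \<theta> \<le> Den"
    unfolding Den_def using \<theta> f g L0 by (intro mult_mono rpow_mono rpow_nonneg) auto
  hence "G * (rpow (L_norm 2 f) (1 - \<theta>) * rpow (L_norm 2 g) \<theta>) \<le> G * Den"
    using G0 by (rule mult_left_mono)
  with le h(2) have Y: "GN_Y CARD('d) r j n \<epsilon> \<le> G * Den" by (simp add: mult.assoc)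
  show ?thesis
  proof (cases "Den = 0")
    case True
    thus ?thesis using G0 by (simp add: GN_lower_eps_def Den_def[symmetric])
  next
    case False
    hence "Den > 0" using Den by simp
    thus ?thesis using Y by (simp add: GN_lower_eps_def Den_def[symmetric] divide_le_eq)
  qed
qed

end

theorem proposition5p17:
  fixes j n \<theta> G :: real and r :: ereal
  assumes "0 \<le> \<theta>" and "\<theta> \<le> 1" and "0 \<le> n" and "0 \<le> j"
    and "0 \<le> \<theta> * n - j" and "\<theta> * n - j \<le> real CARD('d::finite) / 2"
    and "n = j + real CARD('d) / 2 \<Longrightarrow> \<theta> \<noteq> 1"
    and "2 \<le> r" and "1 / r = ereal (1 / 2 - (\<theta> * n - j) / real CARD('d))"
    and "GN_sharp_constant TYPE('d) r j n \<theta> G"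
  shows "(\<forall>\<epsilon>>0.
            (\<forall>\<rho>\<ge>0. set_integrable lborel {0<..} (GN_M_integrand CARD('d) j n \<epsilon> \<rho>)) \<and>
            continuous_on {0..} (GN_M CARD('d) j n \<epsilon>) \<and>
            G \<ge> GN_lower_eps CARD('d) r j n \<theta> \<epsilon>) \<and>
         G \<ge> GN_lower CARD('d) r j n \<theta>"
proof -
  have "\<theta> * n \<le> 1 * n" using assms by (intro mult_right_mono) auto
  hence jn: "j \<le> n" using assms(5) by simp
  have G: "G \<in> GN_constants TYPE('d) r j n \<theta>" using assms(10) by (simp add: GN_sharp_constant_def)
  have le: "GN_lower_eps CARD('d) r j n \<theta> \<epsilon> \<le> G" if "\<epsilon> > 0" for \<epsilon>
    by (rule GN_lower_eps_le[OF assms(4) jn that assms(8,1,2) G])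
  moreover have "GN_lower CARD('d) r j n \<theta> \<le> G"
    unfolding GN_lower_def by (rule cSUP_least) (auto intro: le)
  ultimately show ?thesis
    using GN_M_integrand_integrable[OF assms(4) jn, where 'd='d] continuous_on_GN_M[OF assms(4) jn, where 'd='d] by blast
qed

end
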